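(* Let $K_\varepsilon,V_\varepsilon$ ($\varepsilon\in(0,\varepsilon_0]$), $\Sigma$, $\Omega$, $x_j$, $U$ and $d$ satisfy assumptions (A), (B) and (C) listed in the context, with $\Sigma=\Omega$ (so in particular $d\in C^2(\overline{\Sigma})$). Let $H_\varepsilon^\Sigma$ and $\hat H_\varepsilon^\Sigma$ be the operators with Dirichlet and Neumann boundary conditions on $\Sigma$ defined in the context. Fix $R_0>0$. Then there exist constants $\varepsilon_1\in(0,\varepsilon_0]$ and $B,C>0$ such that for all $\varepsilon\in(0,\varepsilon_1]$, all $E\in[0,\varepsilon R_0]$ and all real $u\in\mathcal D(H_\varepsilon^\Sigma)$ $$\left\|\left(1+\tfrac{d}{\varepsilon}\right)^{-B}e^{\frac d\varepsilon}u\right\|_{L^2(\Sigma)}\le C\left[\varepsilon^{-1}\left\|\left(1+\tfrac d\varepsilon\right)^{-B}e^{\frac d\varepsilon}\left(H_\varepsilon^\Sigma-E\right)u\right\|_{L^2(\Sigma)}+\|u\|_{L^2(\Sigma)}\right].$$ In particular, if $u\in\mathcal D(H_\varepsilon^\Sigma)$ is an eigenfunction of $H_\varepsilon^\Sigma$ with respect to an eigenvalue $E\in[0,\varepsilon R_0]$, then $$\left\|\left(1+\tfrac d\varepsilon\right)^{-B}e^{\frac d\varepsilon}u\right\|_{L^2(\Sigma)}\le C\|u\|_{L^2(\Sigma)}.$$ The analogous results hold for $u\in\mathcal D(\hat H_\varepsilon^\Sigma)$, respectively for $u$ a normalized eigenfunction of $\hat H_\varepsilon^\Sigma$, with $H_\varepsilon^\Sigma$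 replaced by $\hat H_\varepsilon^\Sigma$.
   Context: All function spaces are real; $\varepsilon_0>0$ is fixed and $\varepsilon\in(0,\varepsilon_0]$; $C_0$, $C_0^\infty$ denote compactly supported functions. **(A)** For each $\varepsilon\in(0,\varepsilon_0]$: $V_\varepsilon(x)\,dx$ is a positive Radon measure on $\mathbb R^d$; $K_\varepsilon$ is a measurable kernel such that for each $x\in\mathbb R^d$, $K_\varepsilon(x,\cdot)$ is a positive Radon measure on the Borel sets of $\mathbb R^d\setminus\{0\}$ with (i) $K_\varepsilon(x,E)<\infty$ for every Borel set $E\subset\mathbb R^d\setminus\{0\}$ with $\mathrm{dist}(E,0)\ge\delta>0$; (ii) $\int_{|\gamma|\le1}|\gamma|^2K_\varepsilon(x,d\gamma)\le C$ locally uniformly in $x\in\mathbb R^d$; (iii) (reversibility) for all non-negative $\phi,\psi\in C_0(\mathbb R^d)$, $\int_{\mathbb R^d}\int_{\mathbb R^d\setminus\{0\}}\phi(x+\varepsilon\gamma)\psi(x)K_\varepsilon(x,d\gamma)\,dx=\int_{\mathbb R^d}\int_{\mathbb R^d\setminus\{0\}}\phi(x)\psi(x+\varepsilon\gamma)K_\varepsilon(x,d\gamma)\,dx$. **(B)** (a) $K_\varepsilon(x,\cdot)=K^{(0)}(x,\cdot)+R^{(1)}_\varepsilon(x,\cdot)$ for $x\in\mathbb R^d$ (with $K^{(0)}(x,\cdot)$ positive and independent of $\varepsilon$, $R^{(1)}_\varepsilon(x,\cdot)$ possibly signed), where (i) for every $c>0$ there is $C>0$ such that uniformly in $x\in\mathbb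 R^d$ and $\varepsilon\in(0,\varepsilon_0]$: $\int_{|\gamma|\ge1}e^{c|\gamma|}K^{(0)}(x,d\gamma)\le C$, $\int_{|\gamma|\ge1}e^{c|\gamma|}|R^{(1)}_\varepsilon(x,d\gamma)|\le C\varepsilon$, $\int_{|\gamma|\le1}|\gamma|^2K^{(0)}(x,d\gamma)\le C$, $\int_{|\gamma|\le1}|\gamma|^2|R^{(1)}_\varepsilon(x,d\gamma)|\le C\varepsilon$; (ii) for every $x\in\mathbb R^d$ there is $c_x>0$ with $\int_{\mathbb R^d\setminus\{0\}}(\gamma\cdot v)^2K^{(0)}(x,d\gamma)\ge c_x\|v\|^2$ for all $v\in\mathbb R^d$. (b) (i) $V_\varepsilon\in C^2(\mathbb R^d,\mathbb R)$ and $V_\varepsilon(x)=V_0(x)+R_1(x;\varepsilon)$ with $V_0\in C^2(\mathbb R^d)$, $R_1\in C^2(\mathbb R^d\times(0,\varepsilon_0])$, and for every compact $M\subset\mathbb R^d$ there is $C_M$ with $\sup_{x\in M}|R_1(x;\varepsilon)|\le C_M\varepsilon$; (ii) $V_0\ge0$, and $V_0$ takes the value $0$ only at finitely many points $x_k$, $k\in\mathcal C=\{1,\dots,r\}$, which are non-degenerate minima: $D^2V_0|_{x_k}>0$. **Forms and operators.** For open $\Sigma\subset\mathbb R^d$ let $\Sigma'(x)=\{\gamma\in\mathbb R^d\setminus\{0\}: x+\varepsilon\gamma\in\Sigma\}$ and $$\hat{\mathcal E}^\Sigma_\varepsilon(u,v)=\tfrac12\int_\Sigma dx\int_{\Sigma'(x)}(u(x)-u(x+\varepsilon\gamma))(v(x)-v(x+\varepsilon\gamma))K_\varepsilon(x,d\gamma)+\int_\Sigma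 V_\varepsilon(x)u(x)v(x)\,dx$$ with domain $\mathcal D(\hat{\mathcal E}^\Sigma_\varepsilon)=\{u\in L^2(\Sigma):\hat{\mathcal E}^\Sigma_\varepsilon(u,u)<\infty\}$; this is a closed form. $\mathcal E^\Sigma_\varepsilon$ is the closure of the restriction of $\hat{\mathcal E}^\Sigma_\varepsilon$ to $C_0^\infty(\Sigma)$. $H^\Sigma_\varepsilon$ (Dirichlet boundary conditions) and $\hat H^\Sigma_\varepsilon$ (Neumann boundary conditions) are the unique self-adjoint operators in $L^2(\Sigma)$ associated with $\mathcal E^\Sigma_\varepsilon$ and $\hat{\mathcal E}^\Sigma_\varepsilon$ respectively. **The function $\tilde t_0$.** For $x,\xi\in\mathbb R^d$, $\tilde t_0(x,\xi)=\int_{\mathbb R^d\setminus\{0\}}(\cosh(\gamma\cdot\xi)-1)K^{(0)}(x,d\gamma)$. **(C)** $\Sigma\subset\mathbb R^d$ is open and bounded, $x_j\in\Sigma$ for exactly one $j\in\mathcal C$, and $x_k\notin\overline\Sigma$ for $k\in\mathcal C$, $k\ne j$. There are an open set $\Omega\subset\Sigma$ containing $x_j$ and a Lipschitz function $d:\overline\Sigma\to[0,\infty)$ such that (1) $d(x_j)=0$ and $d(x)\ne0$ for $x\ne x_j$; (2) $d\in C^2(\overline\Omega)$; (3) (eikonal equation) $\tilde t_0(x,\nabla d(x))=V_0(x)$ for all $x$ in some neighborhood $U\subset\Omega$ of $x_j$; (4) (eikonal inequality) $\tilde t_0(x,\nabla d(x))-V_0(x)\le0$ for all $x\in\Sigma$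 (where $\nabla d(x)$ exists, i.e. almost everywhere when $d$ is only Lipschitz). *)

theory Defs
  imports "HOL-Analysis.Analysis"
begin

text \<open>Throughout, the Euclidean space \<open>\<real>\<^sup>d\<close> is a type \<open>'a\<close> of class \<open>euclidean_space\<close>.\<close>

text \<open>\<open>Ck_on k W f\<close> is \<open>f \<in> C\<^sup>k(W)\<close> for open \<open>W\<close>.\<close>

primrec Ck_on :: "nat \<Rightarrow> 'a::euclidean_space set \<Rightarrow> ('a \<Rightarrow> real) \<Rightarrow> bool" where
  "Ck_on 0 W f \<longleftrightarrow> continuous_on W f"
| "Ck_on (Suc k) W f \<longleftrightarrow> (\<forall>x\<in>W. f differentiable (at x)) \<and>
     (\<forall>v. Ck_on k W (\<lambda>x. frechet_derivative f (at x) v))"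

text \<open>\<open>C\<^sup>2\<close> on an arbitrary set \<open>S\<close>: \<open>f\<close> agrees on \<open>S\<close> with a \<open>C\<^sup>2\<close> function on an open
  neighbourhood of \<open>S\<close>.  For open \<open>S\<close> this is the usual notion; it is also used for closures of
  open sets and for sets with boundary such as \<open>\<real>\<^sup>d \<times> (0, \<epsilon>\<^sub>0]\<close>.\<close>

definition C2_on :: "'a::euclidean_space set \<Rightarrow> ('a \<Rightarrow> real) \<Rightarrow> bool" where
  "C2_on S f \<longleftrightarrow> (\<exists>W g. open W \<and> S \<subseteq> W \<and> Ck_on 2 W g \<and> (\<forall>x\<in>S. g x = f x))"

definition C0_nonneg :: "('a::euclidean_space \<Rightarrow> real) set" where
  "C0_nonneg = {\<phi>. continuous_on UNIV \<phi> \<and> compact (closure {x. \<phi> x \<noteq> 0}) \<and> (\<forall>x. 0 \<le> \<phi> x)}"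

definition C0_infty :: "'a::euclidean_space set \<Rightarrow> ('a \<Rightarrow> real) set" where
  "C0_infty \<Sigma> = {\<phi>. (\<forall>k. Ck_on k UNIV \<phi>) \<and> compact (closure {x. \<phi> x \<noteq> 0}) \<and>
     closure {x. \<phi> x \<noteq> 0} \<subseteq> \<Sigma>}"

definition grad :: "('a::euclidean_space \<Rightarrow> real) \<Rightarrow> 'a \<Rightarrow> 'a" where
  "grad f x = (THE g. GDERIV f x :> g)"

definition second_deriv :: "('a::euclidean_space \<Rightarrow> real) \<Rightarrow> 'a \<Rightarrow> 'a \<Rightarrow> 'a \<Rightarrow> real" where
  "second_deriv f x v w = frechet_derivative (\<lambda>y. frechet_derivative f (at y) v) (at x) w"

definition radon_measure_on :: "'a::euclidean_space set \<Rightarrow> 'a measure \<Rightarrow> bool" where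
  "radon_measure_on X M \<longleftrightarrow> sets M = sets (restrict_space borel X) \<and>
     (\<forall>C. compact C \<and> C \<subseteq> X \<longrightarrow> emeasure M C < \<infinity>) \<and>
     (\<forall>E\<in>sets M. emeasure M E = (SUP C\<in>{C. compact C \<and> C \<subseteq> E}. emeasure M C))"

abbreviation punctured :: "'a::euclidean_space measure" where
  "punctured \<equiv> restrict_space borel (UNIV - {0})"

text \<open>\<open>signed_difference M N P Q\<close>: the signed measure \<open>M - N\<close> has the Jordan decomposition
  \<open>P - Q\<close>, with \<open>P\<close>, \<open>Q\<close> mutually singular, so that its variation is \<open>P + Q\<close>.  The identity
  \<open>M = N + (P - Q)\<close> is written without subtraction, because all four measures may be infinite on
  sets accumulating at \<open>0\<close>.\<close>

definition signed_difference ::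
  "'a::euclidean_space measure \<Rightarrow> 'a measure \<Rightarrow> 'a measure \<Rightarrow> 'a measure \<Rightarrow> bool" where
  "signed_difference M N P Q \<longleftrightarrow>
     sets P = sets punctured \<and> sets Q = sets punctured \<and>
     (\<exists>A\<in>sets punctured. emeasure Q A = 0 \<and> emeasure P (space punctured - A) = 0) \<and>
     (\<forall>E\<in>sets punctured. emeasure M E + emeasure Q E = emeasure N E + emeasure P E)"

definition variation_integral ::
  "'a measure \<Rightarrow> 'a measure \<Rightarrow> ('a \<Rightarrow> ennreal) \<Rightarrow> ennreal" where
  "variation_integral P Q f = (\<integral>\<^sup>+\<gamma>. f \<gamma> \<partial>P) + (\<integral>\<^sup>+\<gamma>. f \<gamma> \<partial>Q)"

definition assumption_A ::
  "real \<Rightarrow> (real \<Rightarrow> 'a::euclidean_space \<Rightarrow> 'a measure) \<Rightarrow> (real \<Rightarrow> 'a \<Rightarrow> real) \<Rightarrow> bool" where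
  "assumption_A \<epsilon>\<^sub>0 K V \<longleftrightarrow> (\<forall>\<epsilon>\<in>{0<..\<epsilon>\<^sub>0}.
     V \<epsilon> \<in> borel_measurable borel \<and> (AE x in lborel. 0 \<le> V \<epsilon> x) \<and>
     radon_measure_on UNIV (density lborel (\<lambda>x. ennreal (V \<epsilon> x))) \<and>
     (\<forall>x. radon_measure_on (UNIV - {0}) (K \<epsilon> x)) \<and>
     (\<forall>E\<in>sets punctured. (\<lambda>x. emeasure (K \<epsilon> x) E) \<in> borel_measurable borel) \<and>
     (\<forall>x. \<forall>E\<in>sets punctured. \<forall>\<delta>>0. (\<forall>\<gamma>\<in>E. \<delta> \<le> norm \<gamma>) \<longrightarrow> emeasure (K \<epsilon> x) E < \<infinity>) \<and>
     (\<forall>M. compact M \<longrightarrow> (\<exists>C. \<forall>x\<in>M.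
        (\<integral>\<^sup>+\<gamma>\<in>{\<gamma>. norm \<gamma> \<le> 1}. ennreal ((norm \<gamma>)\<^sup>2) \<partial>K \<epsilon> x) \<le> ennreal C)) \<and>
     (\<forall>\<phi>\<in>C0_nonneg. \<forall>\<psi>\<in>C0_nonneg.
        (\<integral>\<^sup>+x. (\<integral>\<^sup>+\<gamma>. ennreal (\<phi> (x + \<epsilon> *\<^sub>R \<gamma>) * \<psi> x) \<partial>K \<epsilon> x) \<partial>lborel) =
        (\<integral>\<^sup>+x. (\<integral>\<^sup>+\<gamma>. ennreal (\<phi> x * \<psi> (x + \<epsilon> *\<^sub>R \<gamma>)) \<partial>K \<epsilon> x) \<partial>lborel)))"

text \<open>\<open>R\<^sub>p \<epsilon> x\<close> and \<open>R\<^sub>m \<epsilon> x\<close> are the positive and negative parts of the signed measure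
  \<open>K\<^sub>\<epsilon>(x, \<cdot>) - K\<^sub>0(x, \<cdot>)\<close>; \<open>R\<^sub>1\<close> is the perturbation of the potential, and \<open>z k\<close>, \<open>1 \<le> k \<le> r\<close>, are
  the zeros \<open>x\<^sub>k\<close> of \<open>V\<^sub>0\<close>.\<close>

definition assumption_B_kernel ::
  "real \<Rightarrow> (real \<Rightarrow> 'a::euclidean_space \<Rightarrow> 'a measure) \<Rightarrow> ('a \<Rightarrow> 'a measure) \<Rightarrow>
   (real \<Rightarrow> 'a \<Rightarrow> 'a measure) \<Rightarrow> (real \<Rightarrow> 'a \<Rightarrow> 'a measure) \<Rightarrow> bool" where
  "assumption_B_kernel \<epsilon>\<^sub>0 K K\<^sub>0 R\<^sub>p R\<^sub>m \<longleftrightarrow>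
     (\<forall>x. sets (K\<^sub>0 x) = sets punctured) \<and>
     (\<forall>\<epsilon>\<in>{0<..\<epsilon>\<^sub>0}. \<forall>x. signed_difference (K \<epsilon> x) (K\<^sub>0 x) (R\<^sub>p \<epsilon> x) (R\<^sub>m \<epsilon> x)) \<and>
     (\<forall>c>0. \<exists>C>0. \<forall>x. \<forall>\<epsilon>\<in>{0<..\<epsilon>\<^sub>0}.
        (\<integral>\<^sup>+\<gamma>\<in>{\<gamma>. 1 \<le> norm \<gamma>}. ennreal (exp (c * norm \<gamma>)) \<partial>K\<^sub>0 x) \<le> ennreal C \<and>
        variation_integral (R\<^sub>p \<epsilon> x) (R\<^sub>m \<epsilon> x)
          (\<lambda>\<gamma>. ennreal (exp (c * norm \<gamma>)) * indicator {\<gamma>. 1 \<le> norm \<gamma>} \<gamma>) \<le> ennreal (C * \<epsilon>) \<and>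
        (\<integral>\<^sup>+\<gamma>\<in>{\<gamma>. norm \<gamma> \<le> 1}. ennreal ((norm \<gamma>)\<^sup>2) \<partial>K\<^sub>0 x) \<le> ennreal C \<and>
        variation_integral (R\<^sub>p \<epsilon> x) (R\<^sub>m \<epsilon> x)
          (\<lambda>\<gamma>. ennreal ((norm \<gamma>)\<^sup>2) * indicator {\<gamma>. norm \<gamma> \<le> 1} \<gamma>) \<le> ennreal (C * \<epsilon>)) \<and>
     (\<forall>x. \<exists>c>0. \<forall>v. ennreal (c * (norm v)\<^sup>2) \<le> (\<integral>\<^sup>+\<gamma>. ennreal ((\<gamma> \<bullet> v)\<^sup>2) \<partial>K\<^sub>0 x))"

definition assumption_B_potential ::
  "real \<Rightarrow> (real \<Rightarrow> 'a::euclidean_space \<Rightarrow> real) \<Rightarrow> ('a \<Rightarrow> real) \<Rightarrow> ('a \<Rightarrow> real \<Rightarrow> real) \<Rightarrow>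
   nat \<Rightarrow> (nat \<Rightarrow> 'a) \<Rightarrow> bool" where
  "assumption_B_potential \<epsilon>\<^sub>0 V V\<^sub>0 R\<^sub>1 r z \<longleftrightarrow>
     (\<forall>\<epsilon>\<in>{0<..\<epsilon>\<^sub>0}. C2_on UNIV (V \<epsilon>) \<and> (\<forall>x. V \<epsilon> x = V\<^sub>0 x + R\<^sub>1 x \<epsilon>)) \<and>
     C2_on UNIV V\<^sub>0 \<and> C2_on (UNIV \<times> {0<..\<epsilon>\<^sub>0}) (\<lambda>(x, \<epsilon>). R\<^sub>1 x \<epsilon>) \<and>
     (\<forall>M. compact M \<longrightarrow> (\<exists>C. \<forall>\<epsilon>\<in>{0<..\<epsilon>\<^sub>0}. \<forall>x\<in>M. \<bar>R\<^sub>1 x \<epsilon>\<bar> \<le> C * \<epsilon>)) \<and>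
     (\<forall>x. 0 \<le> V\<^sub>0 x) \<and> inj_on z {1..r} \<and> {x. V\<^sub>0 x = 0} = z ` {1..r} \<and>
     (\<forall>k\<in>{1..r}. \<forall>v. v \<noteq> 0 \<longrightarrow> 0 < second_deriv V\<^sub>0 (z k) v v)"

definition t0_tilde :: "('a::euclidean_space \<Rightarrow> 'a measure) \<Rightarrow> 'a \<Rightarrow> 'a \<Rightarrow> real" where
  "t0_tilde K\<^sub>0 x \<xi> = (\<integral>\<gamma>. cosh (\<gamma> \<bullet> \<xi>) - 1 \<partial>K\<^sub>0 x)"

definition assumption_C ::
  "('a::euclidean_space \<Rightarrow> 'a measure) \<Rightarrow> ('a \<Rightarrow> real) \<Rightarrow> nat \<Rightarrow> (nat \<Rightarrow> 'a) \<Rightarrow> nat \<Rightarrow>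
   'a set \<Rightarrow> 'a set \<Rightarrow> 'a set \<Rightarrow> ('a \<Rightarrow> real) \<Rightarrow> bool" where
  "assumption_C K\<^sub>0 V\<^sub>0 r z j \<Sigma> \<Omega> U d \<longleftrightarrow>
     open \<Sigma> \<and> bounded \<Sigma> \<and>
     j \<in> {1..r} \<and> z j \<in> \<Sigma> \<and> (\<forall>k\<in>{1..r}. k \<noteq> j \<longrightarrow> z k \<notin> closure \<Sigma>) \<and>
     open \<Omega> \<and> \<Omega> \<subseteq> \<Sigma> \<and> z j \<in> \<Omega> \<and>
     (\<exists>L. L-lipschitz_on (closure \<Sigma>) d) \<and> (\<forall>x\<in>closure \<Sigma>. 0 \<le> d x) \<and>
     d (z j) = 0 \<and> (\<forall>x\<in>closure \<Sigma>. x \<noteq> z j \<longrightarrow> d x \<noteq> 0) \<and>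
     C2_on (closure \<Omega>) d \<and>
     open U \<and> z j \<in> U \<and> U \<subseteq> \<Omega> \<and> (\<forall>x\<in>U. t0_tilde K\<^sub>0 x (grad d x) = V\<^sub>0 x) \<and>
     (\<forall>x\<in>\<Sigma>. d differentiable (at x) \<longrightarrow> t0_tilde K\<^sub>0 x (grad d x) - V\<^sub>0 x \<le> 0)"

text \<open>Elements of \<open>L\<^sup>2(\<Sigma>)\<close> are represented by Borel functions, of which only the values on
  \<open>\<Sigma>\<close> matter.  No quotient by a.e. equality is taken: an operator in \<open>L\<^sup>2(\<Sigma>)\<close> is given by
  its graph on representatives, which is closed under a.e. equality.\<close>

definition L2 :: "'a::euclidean_space set \<Rightarrow> ('a \<Rightarrow> real) set" where
  "L2 \<Sigma> = {u. set_borel_measurable lborel \<Sigma> u \<and> set_integrable lborel \<Sigma> (\<lambda>x. (u x)\<^sup>2)}"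

definition L2_inner :: "'a::euclidean_space set \<Rightarrow> ('a \<Rightarrow> real) \<Rightarrow> ('a \<Rightarrow> real) \<Rightarrow> real" where
  "L2_inner \<Sigma> u v = (LINT x:\<Sigma>|lborel. u x * v x)"

definition L2_norm :: "'a::euclidean_space set \<Rightarrow> ('a \<Rightarrow> real) \<Rightarrow> real" where
  "L2_norm \<Sigma> u = sqrt (L2_inner \<Sigma> u u)"

type_synonym 'a form = "('a \<Rightarrow> real) set \<times> (('a \<Rightarrow> real) \<Rightarrow> ('a \<Rightarrow> real) \<Rightarrow> real)"

text \<open>In the following definitions \<open>k = K\<^sub>\<epsilon>\<close> and \<open>W = V\<^sub>\<epsilon>\<close>.\<close>

definition jump_set :: "real \<Rightarrow> 'a::euclidean_space set \<Rightarrow> 'a \<Rightarrow> 'a set" where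
  "jump_set \<epsilon> \<Sigma> x = {\<gamma>. \<gamma> \<noteq> 0 \<and> x + \<epsilon> *\<^sub>R \<gamma> \<in> \<Sigma>}"

definition energy ::
  "real \<Rightarrow> ('a::euclidean_space \<Rightarrow> 'a measure) \<Rightarrow> ('a \<Rightarrow> real) \<Rightarrow> 'a set \<Rightarrow> ('a \<Rightarrow> real) \<Rightarrow> ennreal" where
  "energy \<epsilon> k W \<Sigma> u =
     ennreal (1/2) * (\<integral>\<^sup>+x\<in>\<Sigma>. (\<integral>\<^sup>+\<gamma>\<in>jump_set \<epsilon> \<Sigma> x. ennreal ((u x - u (x + \<epsilon> *\<^sub>R \<gamma>))\<^sup>2) \<partial>k x) \<partial>lborel)
     + (\<integral>\<^sup>+x\<in>\<Sigma>. ennreal (W x * (u x)\<^sup>2) \<partial>lborel)"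

definition neumann_form ::
  "real \<Rightarrow> ('a::euclidean_space \<Rightarrow> 'a measure) \<Rightarrow> ('a \<Rightarrow> real) \<Rightarrow> 'a set \<Rightarrow> 'a form" where
  "neumann_form \<epsilon> k W \<Sigma> =
     ({u \<in> L2 \<Sigma>. energy \<epsilon> k W \<Sigma> u < \<infinity>},
      \<lambda>u v. 1/2 * (LINT x:\<Sigma>|lborel. (LINT \<gamma>:jump_set \<epsilon> \<Sigma> x|k x.
                 (u x - u (x + \<epsilon> *\<^sub>R \<gamma>)) * (v x - v (x + \<epsilon> *\<^sub>R \<gamma>))))
            + (LINT x:\<Sigma>|lborel. W x * u x * v x))"

definition form_restrict :: "'a form \<Rightarrow> ('a \<Rightarrow> real) set \<Rightarrow> 'a form" where
  "form_restrict F D = (fst F \<inter> D, snd F)"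

text \<open>Closure of a closable form: \<open>u\<close> is in the domain if it is the \<open>L\<^sup>2\<close>-limit of a sequence
  in the original domain that is Cauchy with respect to the form, and the values of the closure
  are the limits of the values along such sequences.\<close>

definition form_approx ::
  "'a::euclidean_space set \<Rightarrow> 'a form \<Rightarrow> ('a \<Rightarrow> real) \<Rightarrow> (nat \<Rightarrow> 'a \<Rightarrow> real) \<Rightarrow> bool" where
  "form_approx \<Sigma> F u w \<longleftrightarrow> (\<forall>n. w n \<in> fst F) \<and>
     (\<lambda>n. L2_norm \<Sigma> (\<lambda>x. w n x - u x)) \<longlonglongrightarrow> 0 \<and>
     (\<forall>e>0. \<exists>N. \<forall>m\<ge>N. \<forall>n\<ge>N. snd F (\<lambda>x. w m x - w n x) (\<lambda>x. w m x - w n x) < e)"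

definition form_closure :: "'a::euclidean_space set \<Rightarrow> 'a form \<Rightarrow> 'a form" where
  "form_closure \<Sigma> F =
     ({u \<in> L2 \<Sigma>. \<exists>w. form_approx \<Sigma> F u w},
      \<lambda>u v. THE l. \<forall>w w'. form_approx \<Sigma> F u w \<and> form_approx \<Sigma> F v w' \<longrightarrow>
                (\<lambda>n. snd F (w n) (w' n)) \<longlonglongrightarrow> l)"

definition dirichlet_form ::
  "real \<Rightarrow> ('a::euclidean_space \<Rightarrow> 'a measure) \<Rightarrow> ('a \<Rightarrow> real) \<Rightarrow> 'a set \<Rightarrow> 'a form" where
  "dirichlet_form \<epsilon> k W \<Sigma> = form_closure \<Sigma> (form_restrict (neumann_form \<epsilon> k W \<Sigma>) (C0_infty \<Sigma>))"

text \<open>Graph of the self-adjoint operator \<open>H\<close> associated with a closed form \<open>F = (D, q)\<close> (first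
  representation theorem): \<open>u \<in> D(H)\<close> and \<open>H u = f\<close> iff \<open>u \<in> D\<close>, \<open>f \<in> L\<^sup>2(\<Sigma>)\<close> and
  \<open>q(u, v) = \<langle>f, v\<rangle>\<close> for all \<open>v \<in> D\<close>.\<close>

definition form_operator ::
  "'a::euclidean_space set \<Rightarrow> 'a form \<Rightarrow> (('a \<Rightarrow> real) \<times> ('a \<Rightarrow> real)) set" where
  "form_operator \<Sigma> F =
     {(u, f). u \<in> fst F \<and> f \<in> L2 \<Sigma> \<and> (\<forall>v\<in>fst F. snd F u v = L2_inner \<Sigma> f v)}"

definition H_dirichlet ::
  "real \<Rightarrow> ('a::euclidean_space \<Rightarrow> 'a measure) \<Rightarrow> ('a \<Rightarrow> real) \<Rightarrow> 'a set \<Rightarrow>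
   (('a \<Rightarrow> real) \<times> ('a \<Rightarrow> real)) set" where
  "H_dirichlet \<epsilon> k W \<Sigma> = form_operator \<Sigma> (dirichlet_form \<epsilon> k W \<Sigma>)"

definition H_neumann ::
  "real \<Rightarrow> ('a::euclidean_space \<Rightarrow> 'a measure) \<Rightarrow> ('a \<Rightarrow> real) \<Rightarrow> 'a set \<Rightarrow>
   (('a \<Rightarrow> real) \<times> ('a \<Rightarrow> real)) set" where
  "H_neumann \<epsilon> k W \<Sigma> = form_operator \<Sigma> (neumann_form \<epsilon> k W \<Sigma>)"

definition eigenfunction ::
  "'a::euclidean_space set \<Rightarrow> (('a \<Rightarrow> real) \<times> ('a \<Rightarrow> real)) set \<Rightarrow> real \<Rightarrow> ('a \<Rightarrow> real) \<Rightarrow> bool" where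
  "eigenfunction \<Sigma> H E u \<longleftrightarrow> (u, \<lambda>x. E * u x) \<in> H \<and> L2_norm \<Sigma> u \<noteq> 0"

definition weight :: "real \<Rightarrow> real \<Rightarrow> ('a \<Rightarrow> real) \<Rightarrow> 'a \<Rightarrow> real" where
  "weight B \<epsilon> d x = (1 + d x / \<epsilon>) powr (- B) * exp (d x / \<epsilon>)"

end

theory Submission
  imports Defs "HOL-Probability.Giry_Monad"
begin

text \<open>With \<open>w = e\<^sup>\<Phi> u\<close>, the identity
  \<open>(u x - u y) (e\<^bsup>2\<Phi> x\<^esup> u x - e\<^bsup>2\<Phi> y\<^esup> u y) = (w x)\<^sup>2 + (w y)\<^sup>2 - 2 w x w y cosh (\<Phi> x - \<Phi> y)\<close>
  and reversibility of the jump kernel bound the form from below: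
  \<open>q(u, e\<^bsup>2\<Phi>\<^esup> u) \<ge> \<integral> (V\<^sub>\<epsilon> - g) w\<^sup>2\<close> with
  \<open>g x = \<integral> (cosh (\<Phi> (x + \<epsilon>\<gamma>) - \<Phi> x) - 1) K\<^sub>\<epsilon>(x, d\<gamma>)\<close>.
  The weight is \<open>\<Phi> = \<psi>(d / \<epsilon>)\<close> with the convex profile \<open>\<psi>(s) = s - B ln (B + s)\<close>,
  \<open>\<psi>'(s) = s / (B + s) \<in> [0, 1)\<close>, so that \<open>e\<^sup>\<Phi>\<close> is comparable to the weight of the theorem.
  Taylor expansion, convexity of \<open>t\<^sub>0\<close> in \<open>\<xi>\<close> and the eikonal inequality give
  \<open>g \<le> \<psi>'(d / \<epsilon>) V\<^sub>0 + C\<epsilon>\<close> with \<open>C\<close> independent of \<open>B\<close>, because \<open>\<bar>\<nabla>d\<bar>\<^sup>2 \<le> P d\<close>.  Since \<open>V\<^sub>0 \<ge> c d\<close>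
  (by nondegeneracy at the well, by compactness elsewhere), \<open>V\<^sub>\<epsilon> - g - E \<ge> \<epsilon>\<close> on \<open>{d \<ge> B\<epsilon>}\<close> once \<open>B\<close> is large, while on \<open>{d < B\<epsilon>}\<close> the weight \<open>e\<^sup>\<Phi>\<close> is bounded
  and \<open>V\<^sub>\<epsilon> - g - E \<ge> -C\<epsilon>\<close>.
  In the Dirichlet case \<open>e\<^bsup>2\<Phi>\<^esup> u\<close> is reached as a limit of \<open>p u\<close> with smooth multipliers \<open>p\<close>.\<close>

section \<open>Smooth approximation of Lipschitz functions\<close>

text \<open>The order in which the constants are chosen shapes the construction. The gain that pays
  for all errors is \<open>(1 - \<psi>'(d / \<epsilon>)) V\<^sub>0\<close>, which is at least B c
  \<epsilon> / 2 where d \<ge> B \<epsilon>; the errors (Taylor remainder, perturbations of kernel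
  and potential, E) amount to a multiple of \<epsilon>. B can be chosen last only if that multiple
  does not grow with B. The critical error is the curvature of the phase,
  \<open>\<psi>''(s) (\<nabla>d \<bullet> \<gamma>)^2\<close> with \<open>s = d / \<epsilon>\<close>
  and \<open>\<psi>''(s) = B / (B + s)^2\<close>: the bound of the squared gradient by P d turns it
  into at most P \<epsilon> |\<gamma>|^2 B s / (B + s)^2, and B s \<le> (B + s)^2 / 4.

  The other obstacle is reversibility. It is given only against continuous compactly supported
  functions, whereas jumps may have infinite total mass near the diagonal. It is first upgraded to
  the symmetry of a measure on pairs of points. That symmetry also makes every Lebesgue null set
  negligible as a set of jump targets, so that forms and their limits can be handled by almost
  everywhere arguments.\<close>

lemma Ck_on_SucI:
  assumes "\<And>x. (f has_derivative f' x) (at x)" "\<And>v. Ck_on k UNIV (\<lambda>x. f' x v)"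
  shows "Ck_on (Suc k) UNIV f"
proof -
  have "frechet_derivative f (at x) = f' x" for x
    using frechet_derivative_at[OF assms(1)] by simp
  then show ?thesis using assms by (auto simp: differentiable_def)
qed

lemma Ck_on_Suc_has_derivative:
  "Ck_on (Suc k) UNIV f \<Longrightarrow> (f has_derivative frechet_derivative f (at x)) (at x)"
  by (simp add: frechet_derivative_works)

lemma Ck_on_SucD: "Ck_on (Suc k) UNIV f \<Longrightarrow> Ck_on k UNIV f"
proof (induction k arbitrary: f)
  case 0
  then show ?case
    by (auto intro!: continuous_at_imp_continuous_on differentiable_imp_continuous_within)
qed auto

lemma Ck_on_const: "Ck_on k UNIV (\<lambda>x. c)"
proof (induction k arbitrary: c)
  case (Suc k)
  show ?case by (rule Ck_on_SucI[of _ "\<lambda>x v. 0"]) (auto simp: Suc)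
qed simp

lemma Ck_on_add:
  "Ck_on k UNIV f \<Longrightarrow> Ck_on k UNIV g \<Longrightarrow> Ck_on k UNIV (\<lambda>x. f x + g x)"
proof (induction k arbitrary: f g)
  case (Suc k)
  show ?case
    by (rule Ck_on_SucI[OF has_derivative_add[OF Suc.prems[THEN Ck_on_Suc_has_derivative]]])
      (use Suc in auto)
qed (auto intro: continuous_intros)

lemma Ck_on_mult:
  "Ck_on k UNIV f \<Longrightarrow> Ck_on k UNIV g \<Longrightarrow> Ck_on k UNIV (\<lambda>x. f x * g x)"
proof (induction k arbitrary: f g)
  case (Suc k)
  note D = Suc.prems[THEN Ck_on_SucD]
  show ?case
    by (rule Ck_on_SucI[OF has_derivative_mult[OF Suc.prems[THEN Ck_on_Suc_has_derivative]]])
      (use Suc D in \<open>auto intro!: Ck_on_add\<close>)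
qed (auto intro: continuous_intros)

lemma Ck_on_sum:
  "(\<And>i. i \<in> I \<Longrightarrow> Ck_on k UNIV (f i)) \<Longrightarrow> Ck_on k UNIV (\<lambda>x. \<Sum>i\<in>I. f i x)"
  by (induction I rule: infinite_finite_induct) (auto intro: Ck_on_add Ck_on_const)

lemma Ck_on_inner_left: "Ck_on k UNIV (\<lambda>x. (x - y) \<bullet> v)"
proof (cases k)
  case (Suc n)
  have "((\<lambda>x. (x - y) \<bullet> v) has_derivative (\<lambda>h. h \<bullet> v)) (at x)" for x
    by (auto intro!: derivative_eq_intros)
  from Ck_on_SucI[OF this Ck_on_const] show ?thesis using Suc by simp
qed (auto intro!: continuous_intros)

lemma Ck_on_norm_square: "Ck_on k UNIV (\<lambda>x. (norm (x - y))\<^sup>2)"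
proof (cases k)
  case (Suc n)
  have D: "((\<lambda>x. (norm (x - y))\<^sup>2) has_derivative (\<lambda>h. 2 * ((x - y) \<bullet> h))) (at x)" for x
    unfolding power2_norm_eq_inner
    by (auto intro!: derivative_eq_intros simp: inner_commute)
  show ?thesis unfolding Suc
    by (rule Ck_on_SucI[OF D]) (intro Ck_on_mult Ck_on_const Ck_on_inner_left)
qed (auto intro!: continuous_intros)

lemma Ck_on_exp: "Ck_on k UNIV f \<Longrightarrow> Ck_on k UNIV (\<lambda>x. exp (f x))"
proof (induction k arbitrary: f)
  case (Suc k)
  note D = Suc.prems[THEN Ck_on_SucD]
  show ?case
    by (rule Ck_on_SucI[OF has_derivative_exp[OF Suc.prems[THEN Ck_on_Suc_has_derivative]]])
      (use Suc D in \<open>auto intro!: Ck_on_mult\<close>)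
qed (auto intro: continuous_intros)

lemma Ck_on_inverse:
  "Ck_on k UNIV f \<Longrightarrow> (\<And>x. f x \<noteq> 0) \<Longrightarrow> Ck_on k UNIV (\<lambda>x. inverse (f x))"
proof (induction k arbitrary: f)
  case (Suc k)
  note D = Suc.prems(1)[THEN Ck_on_SucD]
  have "((\<lambda>x. inverse (f x)) has_derivative
     (\<lambda>h. (-1) * (inverse (f x) * frechet_derivative f (at x) h * inverse (f x)))) (at x)" for x
    using Deriv.has_derivative_inverse[OF Suc.prems(2) Ck_on_Suc_has_derivative[OF Suc.prems(1)]]
    by simp
  from this show ?case
    by (rule Ck_on_SucI) (intro Ck_on_mult Ck_on_const; use Suc D in simp)
qed (auto intro: continuous_intros)

lemma Ck_on_ln: "Ck_on k UNIV f \<Longrightarrow> (\<And>x. 0 < f x) \<Longrightarrow> Ck_on k UNIV (\<lambda>x. ln (f x))"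
proof (cases k)
  case (Suc n)
  assume f: "Ck_on k UNIV f" "\<And>x. 0 < f x"
  have "((\<lambda>x. ln (f x)) has_derivative (\<lambda>h. frechet_derivative f (at x) h * inverse (f x))) (at x)" for x
    using Ck_on_Suc_has_derivative[OF f(1)[unfolded Suc], of x] f(2)[of x]
    by (auto intro!: derivative_eq_intros simp: field_simps)
  from this show ?thesis unfolding Suc
  proof (rule Ck_on_SucI)
    show "Ck_on n UNIV (\<lambda>x. frechet_derivative f (at x) v * inverse (f x))" for v
      using f Ck_on_SucD[of n f] Suc
      by (intro Ck_on_mult Ck_on_inverse) (auto simp: less_imp_neq[symmetric])
  qed
qed (auto intro!: continuous_on_ln simp: less_imp_neq[symmetric])

lemma Ck_on_sqrt:
  assumes "Ck_on k UNIV f" "\<And>x. 0 < f x"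
  shows "Ck_on k UNIV (\<lambda>x. sqrt (f x))"
proof -
  have "sqrt (f x) = exp (1/2 * ln (f x))" for x
    using assms(2)[of x] by (simp add: ln_sqrt[symmetric])
  moreover have "Ck_on k UNIV (\<lambda>x. exp (1/2 * ln (f x)))"
    using assms by (intro Ck_on_exp Ck_on_mult Ck_on_const Ck_on_ln)
  ultimately show ?thesis by simp
qed

text \<open>The approximation is the soft minimum
  \<open>- ln (\<Sum>y. exp (- \<beta> (m y + L \<surd>(\<bar>x - y\<bar>\<^sup>2 + \<delta>\<^sup>2)))) / \<beta>\<close> over a finite net of points \<open>y\<close>.
  It inherits the Lipschitz constant of its arguments, and for \<open>\<beta> \<rightarrow> \<infinity>\<close> it tends to the McShane
  extension formula \<open>m x = min (m y + L \<bar>x - y\<bar>)\<close>.\<close>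

lemma lipschitz_smooth_approximation:
  fixes m :: "'a::euclidean_space \<Rightarrow> real"
  assumes S: "bounded S" and m: "L-lipschitz_on S m" and "0 < e"
  shows "\<exists>p. (\<forall>k. Ck_on k UNIV p) \<and> L-lipschitz_on S p \<and> (\<forall>x\<in>S. \<bar>p x - m x\<bar> \<le> e)"
proof (cases "S = {}")
  case True
  have "L-lipschitz_on S (\<lambda>x. 0)" using True m by (simp add: lipschitz_on_def)
  then show ?thesis using Ck_on_const True by blast
next
  case False
  have L: "0 \<le> L" using m by (rule lipschitz_on_nonneg)
  \<comment> \<open>\<open>\<delta>\<close> is both the mesh of the net and the smoothing radius. At
    the nearest net point the errors are L \<delta> from m and at most 2 L \<delta> from the
    smoothed distance, hence the factor 3; L + 1 avoids dividing by 0.\<close>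
  define \<delta> where "\<delta> = e / (3 * (L + 1))"
  have \<delta>: "0 < \<delta>" using L \<open>0 < e\<close> by (simp add: \<delta>_def)
  have L\<delta>: "3 * (L * \<delta>) \<le> e" using L \<open>0 < e\<close> by (simp add: \<delta>_def field_simps)
  have "compact (closure S)" using S by simp
  moreover have "closure S \<subseteq> (\<Union>y\<in>S. ball y \<delta>)"
    using \<delta> by (auto simp: closure_approachable)
  ultimately obtain T where T: "T \<subseteq> S" "finite T" "closure S \<subseteq> (\<Union>y\<in>T. ball y \<delta>)"
    by (metis compactE_image open_ball)
  have T0: "T \<noteq> {}" using T(3) False closure_subset by fastforce
  define N where "N = card T"
  have N: "1 \<le> real N" using T0 T(2) by (simp add: N_def Suc_leI card_gt_0_iff)
  \<comment> \<open>A soft minimum of N terms lies at most (ln N) / \<open>\<beta>\<close> below the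
    true minimum. The summand 1 keeps \<open>\<beta>\<close> positive for N = 1.\<close>
  define \<beta> where "\<beta> = (ln N + 1) / e"
  have \<beta>: "0 < \<beta>" using N \<open>0 < e\<close> by (simp add: \<beta>_def add_nonneg_pos)
  define h where "h y x = m y + L * sqrt ((norm (x - y))\<^sup>2 + \<delta>\<^sup>2)" for x y
  define s where "s x = (\<Sum>y\<in>T. exp (- \<beta> * h y x))" for x
  define p where "p x = (- inverse \<beta>) * ln (s x)" for x
  have s0: "0 < s x" for x unfolding s_def using T T0 by (intro sum_pos) auto
  have ck: "Ck_on k UNIV p" for k
    unfolding p_def
  proof (intro Ck_on_mult Ck_on_ln Ck_on_const s0)
    have "0 < (norm (x - y))\<^sup>2 + \<delta>\<^sup>2" for x y :: 'a
      using \<delta> by (simp add: add_nonneg_pos)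
    then show "Ck_on k UNIV s" unfolding s_def h_def
      by (intro Ck_on_sum Ck_on_exp Ck_on_mult Ck_on_add Ck_on_const Ck_on_sqrt Ck_on_norm_square)
  qed
  \<comment> \<open>The smoothed distance is the norm of (x - y, \<open>\<delta>\<close>) in the
    product space, so the triangle inequality makes it 1-Lipschitz in x.\<close>
  have hL: "h y x \<le> h y x' + L * dist x x'" for x x' y
  proof -
    have "sqrt ((norm (x - y))\<^sup>2 + \<delta>\<^sup>2) = norm (x - y, \<delta>)" for x by (simp add: norm_Pair)
    moreover have "norm (x - y, \<delta>) \<le> norm (x' - y, \<delta>) + norm (x - x', 0::real)"
      using norm_triangle_ineq[of "(x' - y, \<delta>)" "(x - x', 0)"] by simp
    ultimately have "sqrt ((norm (x - y))\<^sup>2 + \<delta>\<^sup>2) \<le> sqrt ((norm (x' - y))\<^sup>2 + \<delta>\<^sup>2) + dist x x'"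
      by (simp add: norm_Pair dist_norm)
    then show ?thesis using L by (auto simp: h_def distrib_left[symmetric] intro!: mult_left_mono)
  qed
  have pL: "p x \<le> p x' + L * dist x x'" for x x'
  proof -
    have "exp (- \<beta> * (L * dist x x')) * s x' \<le> s x"
      unfolding s_def sum_distrib_left exp_add[symmetric]
      using mult_left_mono[OF hL[of _ x x'], of \<beta>] \<beta>
      by (intro sum_mono) (simp add: algebra_simps)
    then have "ln (exp (- \<beta> * (L * dist x x')) * s x') \<le> ln (s x)"
      using s0 by (subst ln_le_cancel_iff) auto
    then have "- (\<beta> * (L * dist x x')) + ln (s x') \<le> ln (s x)"
      using s0[of x'] by (simp add: ln_mult)
    then show ?thesis using \<beta> by (simp add: p_def field_simps)
  qed
  have "L-lipschitz_on S p"
  proof (rule lipschitz_onI)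
    show "dist (p x) (p y) \<le> L * dist x y" for x y
      using pL[of x y] pL[of y x] by (auto simp: dist_real_def dist_commute abs_le_iff)
  qed fact
  moreover have "\<bar>p x - m x\<bar> \<le> e" if x: "x \<in> S" for x
  proof -
    have lower: "m x \<le> h y x" if "y \<in> T" for y
    proof -
      have "\<bar>m x - m y\<bar> \<le> L * norm (x - y)"
        using lipschitz_onD[OF m x] that T by (auto simp: dist_real_def dist_norm)
      also have "\<dots> \<le> L * sqrt ((norm (x - y))\<^sup>2 + \<delta>\<^sup>2)"
        using L by (intro mult_left_mono real_le_rsqrt) auto
      finally show ?thesis by (simp add: h_def)
    qed
    have "s x \<le> (\<Sum>y\<in>T. exp (- \<beta> * m x))"
      unfolding s_def using lower \<beta> by (intro sum_mono) auto
    also have "\<dots> = N * exp (- \<beta> * m x)" by (simp add: N_def)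
    finally have "ln (s x) \<le> ln (N * exp (- \<beta> * m x))"
      using s0 by (subst ln_le_cancel_iff) (use N in auto)
    then have "ln (s x) \<le> ln N - \<beta> * m x" using N by (simp add: ln_mult)
    moreover have "ln N \<le> \<beta> * e" using \<open>0 < e\<close> by (simp add: \<beta>_def)
    ultimately have "m x - p x \<le> e" using \<beta> by (simp add: p_def field_simps)
    moreover have "p x - m x \<le> e"
    proof -
      obtain y where y: "y \<in> T" "norm (x - y) < \<delta>"
        using T(3) x closure_subset[of S] by (auto simp: dist_norm norm_minus_commute subset_iff)
      have "\<bar>m x - m y\<bar> \<le> L * norm (x - y)"
        using lipschitz_onD[OF m x] y T by (auto simp: dist_real_def dist_norm)
      also have "\<dots> \<le> L * \<delta>" using L y by (intro mult_left_mono) auto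
      finally have "m y \<le> m x + L * \<delta>" by simp
      moreover have "L * sqrt ((norm (x - y))\<^sup>2 + \<delta>\<^sup>2) \<le> L * (\<delta> + \<delta>)"
        using sqrt_sum_squares_le_sum[of "norm (x - y)" \<delta>] \<delta> y L by (intro mult_left_mono) auto
      ultimately have "h y x \<le> m x + e" using L\<delta> by (simp add: h_def algebra_simps)
      then have "exp (- \<beta> * (m x + e)) \<le> exp (- \<beta> * h y x)" using \<beta> by simp
      also have "\<dots> \<le> s x" unfolding s_def using y T by (intro member_le_sum) auto
      finally have "ln (exp (- \<beta> * (m x + e))) \<le> ln (s x)"
        using s0 by (subst ln_le_cancel_iff) auto
      then show ?thesis using \<beta> by (simp add: p_def field_simps)
    qed
    ultimately show ?thesis by (simp add: abs_le_iff)
  qed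
  ultimately show ?thesis using ck by blast
qed

section \<open>The symmetric jump measure\<close>

text \<open>The density \<open>\<bar>\<gamma>\<bar>\<^sup>2 / C\<close> turns the possibly infinite measures \<open>k x\<close> into subprobabilities, for
  which measurability in \<open>x\<close> is known.\<close>

lemma borel_measurable_kernel_integral:
  fixes k :: "'a::euclidean_space \<Rightarrow> 'a measure" and f :: "'a \<times> 'a \<Rightarrow> ennreal"
  assumes sets_k: "\<And>x. sets (k x) = sets punctured"
    and meas: "\<And>E. E \<in> sets punctured \<Longrightarrow> (\<lambda>x. emeasure (k x) E) \<in> borel_measurable borel"
    and C: "\<And>x. (\<integral>\<^sup>+\<gamma>. ennreal ((norm \<gamma>)\<^sup>2) \<partial>k x) \<le> ennreal C" "0 < C"
    and f: "f \<in> borel_measurable borel"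
  shows "(\<lambda>x. \<integral>\<^sup>+\<gamma>. f (x, \<gamma>) \<partial>k x) \<in> borel_measurable borel"
proof -
  have space_k: "space (k x) = UNIV - {0}" for x
    using sets_eq_imp_space_eq[OF sets_k[of x]] by (simp add: space_restrict_space)
  \<comment> \<open>Integrands of \<gamma> alone come first: they yield the measurability of
    \<open>L x\<close> on each set, from which the integrands depending on both variables
    follow.\<close>
  have single: "(\<lambda>x. \<integral>\<^sup>+\<gamma>. g \<gamma> \<partial>k x) \<in> borel_measurable borel"
    if "g \<in> borel_measurable punctured" for g :: "'a \<Rightarrow> ennreal"
    using that
  proof (induction g rule: borel_measurable_induct)
    case (cong f g)
    have "(\<integral>\<^sup>+\<gamma>. f \<gamma> \<partial>k x) = (\<integral>\<^sup>+\<gamma>. g \<gamma> \<partial>k x)" for x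
      using cong by (intro nn_integral_cong) (auto simp: space_k space_restrict_space)
    then show ?case using cong by simp
  next
    case (set A)
    then show ?case using meas sets_k by simp
  next
    case (mult u c)
    have [measurable]: "u \<in> borel_measurable (k x)" for x
      using mult(2) by (simp add: measurable_cong_sets[OF sets_k refl])
    show ?case using mult by (simp add: nn_integral_cmult)
  next
    case (add u v)
    have "u \<in> borel_measurable (k x)" "v \<in> borel_measurable (k x)" for x
      using add by (simp_all add: measurable_cong_sets[OF sets_k refl])
    then show ?case using add by (simp add: nn_integral_add)
  next
    case (seq U)
    have "U i \<in> borel_measurable (k x)" for x i
      using seq by (simp add: measurable_cong_sets[OF sets_k refl])
    then have "(\<integral>\<^sup>+\<gamma>. (SUP i. U i) \<gamma> \<partial>k x) = (SUP i. \<integral>\<^sup>+\<gamma>. U i \<gamma> \<partial>k x)" for x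
      using seq by (simp add: nn_integral_monotone_convergence_SUP[symmetric] image_comp)
    then show ?case using seq by simp
  qed
  define L where "L x = density (k x) (\<lambda>\<gamma>. ennreal ((norm \<gamma>)\<^sup>2 / C))" for x
  have id_meas [measurable]: "(\<lambda>x. x) \<in> measurable punctured (borel :: 'a measure)"
    by (rule measurable_restrict_space1) simp
  have n_meas: "(\<lambda>\<gamma>::'a. ennreal ((norm \<gamma>)\<^sup>2 / C)) \<in> borel_measurable punctured"
    by measurable
  then have n_meas': "(\<lambda>\<gamma>::'a. ennreal ((norm \<gamma>)\<^sup>2 / C)) \<in> borel_measurable (k x)" for x
    by (simp add: measurable_cong_sets[OF sets_k refl])
  have L: "L \<in> measurable borel (subprob_algebra punctured)"
  proof (rule measurable_subprob_algebra)
    fix x :: 'a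
    have "emeasure (L x) (space (L x)) = (\<integral>\<^sup>+\<gamma>. ennreal ((norm \<gamma>)\<^sup>2 / C) \<partial>k x)"
      using n_meas' by (subst L_def, subst emeasure_density) (auto simp: L_def intro!: nn_integral_cong)
    also have "\<dots> = (\<integral>\<^sup>+\<gamma>. ennreal (inverse C) * ennreal ((norm \<gamma>)\<^sup>2) \<partial>k x)"
      using C by (intro nn_integral_cong) (simp add: ennreal_mult[symmetric] divide_inverse mult.commute)
    also have "\<dots> = ennreal (inverse C) * (\<integral>\<^sup>+\<gamma>. ennreal ((norm \<gamma>)\<^sup>2) \<partial>k x)"
      by (rule nn_integral_cmult)
        (simp add: measurable_cong_sets[OF sets_k refl], measurable)
    also have "\<dots> \<le> ennreal (inverse C) * ennreal C" by (intro mult_left_mono C) simp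
    also have "\<dots> = 1" using C by (simp add: ennreal_mult[symmetric])
    finally have "emeasure (L x) (space (L x)) \<le> 1" .
    moreover have "space (L x) \<noteq> {}"
      using nonzero_Basis nonempty_Basis by (auto simp: L_def space_k)
    ultimately show "subprob_space (L x)" by (rule subprob_spaceI)
    show "sets (L x) = sets punctured" by (simp add: L_def sets_k)
  next
    fix A :: "'a set" assume A: "A \<in> sets punctured"
    have "(\<lambda>x. \<integral>\<^sup>+\<gamma>. ennreal ((norm \<gamma>)\<^sup>2 / C) * indicator A \<gamma> \<partial>k x) \<in> borel_measurable borel"
      using A n_meas by (intro single borel_measurable_times_ennreal borel_measurable_indicator)
    then show "(\<lambda>x. emeasure (L x) A) \<in> borel_measurable borel"
      unfolding L_def using A sets_k by (subst emeasure_density[OF n_meas']) auto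
  qed
  have "(\<lambda>p. (fst p, snd p)) \<in> measurable (borel \<Otimes>\<^sub>M punctured) (borel \<Otimes>\<^sub>M (borel :: 'a measure))"
    by measurable
  then have "(\<lambda>p. f (fst p, snd p)) \<in> borel_measurable (borel \<Otimes>\<^sub>M punctured)"
    using f by (auto simp: borel_prod intro: measurable_compose)
  \<comment> \<open>The extra factor cancels the density of \<open>L x\<close>; this is legitimate
    because 0 does not belong to the space of \<open>k x\<close>.\<close>
  then have "(\<lambda>(x, \<gamma>). f (x, \<gamma>) * ennreal (C / (norm \<gamma>)\<^sup>2)) \<in> borel_measurable (borel \<Otimes>\<^sub>M punctured)"
    by (simp add: split_beta') measurable
  from nn_integral_measurable_subprob_algebra2[OF this L]
  have "(\<lambda>x. \<integral>\<^sup>+\<gamma>. f (x, \<gamma>) * ennreal (C / (norm \<gamma>)\<^sup>2) \<partial>L x) \<in> borel_measurable borel" .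
  also have "(\<lambda>x. \<integral>\<^sup>+\<gamma>. f (x, \<gamma>) * ennreal (C / (norm \<gamma>)\<^sup>2) \<partial>L x) = (\<lambda>x. \<integral>\<^sup>+\<gamma>. f (x, \<gamma>) \<partial>k x)"
  proof
    fix x
    have "(\<lambda>\<gamma>. f (x, \<gamma>)) \<in> borel_measurable borel"
      using f by (rule measurable_compose[rotated]) (simp add: borel_prod[symmetric])
    moreover have "(\<lambda>\<gamma>::'a. ennreal (C / (norm \<gamma>)\<^sup>2)) \<in> borel_measurable borel"
      by measurable
    ultimately have "(\<lambda>\<gamma>. f (x, \<gamma>) * ennreal (C / (norm \<gamma>)\<^sup>2)) \<in> borel_measurable (k x)"
      unfolding measurable_cong_sets[OF sets_k refl]
      by (intro measurable_restrict_space1 borel_measurable_times_ennreal)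
    then have "(\<integral>\<^sup>+\<gamma>. f (x, \<gamma>) * ennreal (C / (norm \<gamma>)\<^sup>2) \<partial>L x)
        = (\<integral>\<^sup>+\<gamma>. ennreal ((norm \<gamma>)\<^sup>2 / C) * (f (x, \<gamma>) * ennreal (C / (norm \<gamma>)\<^sup>2)) \<partial>k x)"
      unfolding L_def by (intro nn_integral_density n_meas')
    also have "\<dots> = (\<integral>\<^sup>+\<gamma>. f (x, \<gamma>) \<partial>k x)"
    proof (rule nn_integral_cong)
      fix \<gamma> assume "\<gamma> \<in> space (k x)"
      then have "ennreal ((norm \<gamma>)\<^sup>2 / C) * ennreal (C / (norm \<gamma>)\<^sup>2) = 1"
        using C by (simp add: space_k ennreal_mult[symmetric])
      then show "ennreal ((norm \<gamma>)\<^sup>2 / C) * (f (x, \<gamma>) * ennreal (C / (norm \<gamma>)\<^sup>2)) = f (x, \<gamma>)"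
        by (metis mult.assoc mult.commute mult_1)
    qed
    finally show "(\<integral>\<^sup>+\<gamma>. f (x, \<gamma>) * ennreal (C / (norm \<gamma>)\<^sup>2) \<partial>L x) = (\<integral>\<^sup>+\<gamma>. f (x, \<gamma>) \<partial>k x)" .
  qed
  finally show ?thesis .
qed

text \<open>The second moment is taken over all \<gamma> and bounded uniformly in x. Assumption (A)
  bounds it only for |\<gamma>| \<le> 1 and locally in x; the constant comes from (B) through
  \<open>kernel_second_moment\<close>.\<close>

locale reversible_kernel =
  fixes \<epsilon> :: real and k :: "'a::euclidean_space \<Rightarrow> 'a measure" and C :: real
  assumes eps: "0 < \<epsilon>" and C_pos: "0 < C"
    and sets_k: "\<And>x. sets (k x) = sets punctured"
    and emeasure_k: "\<And>E. E \<in> sets punctured \<Longrightarrow> (\<lambda>x. emeasure (k x) E) \<in> borel_measurable borel"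
    and second_moment: "\<And>x. (\<integral>\<^sup>+\<gamma>. ennreal ((norm \<gamma>)\<^sup>2) \<partial>k x) \<le> ennreal C"
    and reversible: "\<And>\<phi> \<psi>. \<phi> \<in> C0_nonneg \<Longrightarrow> \<psi> \<in> C0_nonneg \<Longrightarrow>
        (\<integral>\<^sup>+x. (\<integral>\<^sup>+\<gamma>. ennreal (\<phi> (x + \<epsilon> *\<^sub>R \<gamma>) * \<psi> x) \<partial>k x) \<partial>lborel) =
        (\<integral>\<^sup>+x. (\<integral>\<^sup>+\<gamma>. ennreal (\<phi> x * \<psi> (x + \<epsilon> *\<^sub>R \<gamma>)) \<partial>k x) \<partial>lborel)"
begin

lemma space_k: "space (k x) = UNIV - {0}"
  using sets_eq_imp_space_eq[OF sets_k[of x]] by (simp add: space_restrict_space)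

lemma measurable_k: "f \<in> measurable borel M \<Longrightarrow> f \<in> measurable (k x) M"
  unfolding measurable_cong_sets[OF sets_k refl] by (rule measurable_restrict_space1)

lemma measurable_k_jump:
  assumes "F \<in> measurable (borel :: ('a \<times> 'a) measure) M"
  shows "(\<lambda>\<gamma>. F (x, x + \<epsilon> *\<^sub>R \<gamma>)) \<in> measurable (k x) M"
  by (intro measurable_k measurable_compose[OF _ assms]) (simp add: borel_prod[symmetric])

lemma borel_measurable_jump_integral:
  fixes F :: "'a \<times> 'a \<Rightarrow> ennreal"
  assumes "F \<in> borel_measurable borel"
  shows "(\<lambda>x. \<integral>\<^sup>+\<gamma>. F (x, x + \<epsilon> *\<^sub>R \<gamma>) \<partial>k x) \<in> borel_measurable borel"
proof -
  have "(\<lambda>p::'a\<times>'a. (fst p, fst p + \<epsilon> *\<^sub>R snd p)) \<in> measurable (borel \<Otimes>\<^sub>M borel) (borel \<Otimes>\<^sub>M borel)"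
    by measurable
  then have "(\<lambda>p. F (fst p, fst p + \<epsilon> *\<^sub>R snd p)) \<in> borel_measurable borel"
    unfolding borel_prod by (rule measurable_compose) fact
  from borel_measurable_kernel_integral[OF sets_k emeasure_k second_moment C_pos this]
  show ?thesis by simp
qed

text \<open>The image of K(x, d\<gamma>) dx under (x, \<gamma>) \<mapsto> (x, x +
  \<epsilon>\<gamma>). On pairs of endpoints the jump energy is an L2 inner product and
  reversibility becomes invariance under exchange of coordinates.\<close>

definition J :: "('a \<times> 'a) measure" where
  "J = measure_of UNIV (sets borel)
     (\<lambda>A. \<integral>\<^sup>+x. (\<integral>\<^sup>+\<gamma>. indicator A (x, x + \<epsilon> *\<^sub>R \<gamma>) \<partial>k x) \<partial>lborel)"

lemma sets_J [simp, measurable_cong]: "sets J = sets borel"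
  and space_J [simp]: "space J = UNIV"
  using sets.sigma_sets_eq[of "borel :: ('a \<times> 'a) measure"] by (simp_all add: J_def)

lemma measurable_J: "f \<in> measurable J M \<longleftrightarrow> f \<in> measurable borel M"
  by (simp add: measurable_cong_sets[OF sets_J refl])

lemma emeasure_J:
  assumes "A \<in> sets borel"
  shows "emeasure J A = (\<integral>\<^sup>+x. (\<integral>\<^sup>+\<gamma>. indicator A (x, x + \<epsilon> *\<^sub>R \<gamma>) \<partial>k x) \<partial>lborel)"
  unfolding J_def
proof (rule emeasure_measure_of_sigma)
  show "sigma_algebra UNIV (sets (borel :: ('a \<times> 'a) measure))"
    using sets.sigma_algebra_axioms[of "borel :: ('a \<times> 'a) measure"] by simp
  show "positive (sets borel)
    (\<lambda>A. \<integral>\<^sup>+x. (\<integral>\<^sup>+\<gamma>. indicator A (x, x + \<epsilon> *\<^sub>R \<gamma>) \<partial>k x) \<partial>lborel)"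
    by (simp add: positive_def)
  show "countably_additive (sets borel)
    (\<lambda>A. \<integral>\<^sup>+x. (\<integral>\<^sup>+\<gamma>. indicator A (x, x + \<epsilon> *\<^sub>R \<gamma>) \<partial>k x) \<partial>lborel)"
  proof (rule countably_additiveI)
    fix A :: "nat \<Rightarrow> ('a \<times> 'a) set"
    assume A: "range A \<subseteq> sets borel" "disjoint_family A"
    have m: "indicator (A i) \<in> borel_measurable (borel :: ('a \<times> 'a) measure)" for i
      using A by (intro borel_measurable_indicator) auto
    have "(\<integral>\<^sup>+\<gamma>. indicator (\<Union>i. A i) (x, x + \<epsilon> *\<^sub>R \<gamma>) \<partial>k x)
        = (\<Sum>i. \<integral>\<^sup>+\<gamma>. indicator (A i) (x, x + \<epsilon> *\<^sub>R \<gamma>) \<partial>k x)" for x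
      by (subst nn_integral_suminf[symmetric])
        (auto intro!: measurable_k_jump m simp: suminf_indicator[OF A(2)])
    then show "(\<Sum>i. \<integral>\<^sup>+x. (\<integral>\<^sup>+\<gamma>. indicator (A i) (x, x + \<epsilon> *\<^sub>R \<gamma>) \<partial>k x) \<partial>lborel) =
        (\<integral>\<^sup>+x. (\<integral>\<^sup>+\<gamma>. indicator (\<Union>i. A i) (x, x + \<epsilon> *\<^sub>R \<gamma>) \<partial>k x) \<partial>lborel)"
      by (subst nn_integral_suminf[symmetric]) (auto intro!: borel_measurable_jump_integral m)
  qed
qed fact

lemma nn_integral_J:
  fixes F :: "'a \<times> 'a \<Rightarrow> ennreal"
  assumes "F \<in> borel_measurable borel"
  shows "(\<integral>\<^sup>+p. F p \<partial>J) = (\<integral>\<^sup>+x. (\<integral>\<^sup>+\<gamma>. F (x, x + \<epsilon> *\<^sub>R \<gamma>) \<partial>k x) \<partial>lborel)"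
  using assms
proof (induction F rule: borel_measurable_induct)
  case (cong f g)
  then have "f = g" by auto
  then show ?case using cong by simp
next
  case (set A)
  then show ?case by (simp add: emeasure_J)
next
  case (mult u c)
  then show ?case
    by (simp add: nn_integral_cmult measurable_J measurable_k_jump borel_measurable_jump_integral)
next
  case (add u v)
  then show ?case
    by (simp add: nn_integral_add measurable_J measurable_k_jump borel_measurable_jump_integral)
next
  case (seq U)
  have 1: "(\<integral>\<^sup>+p. (SUP i. U i) p \<partial>J) = (SUP i. \<integral>\<^sup>+p. U i p \<partial>J)"
    unfolding SUP_apply
    using seq by (intro nn_integral_monotone_convergence_SUP) (auto simp: measurable_J)
  have 2: "(\<integral>\<^sup>+\<gamma>. (SUP i. U i) (x, x + \<epsilon> *\<^sub>R \<gamma>) \<partial>k x) = (SUP i. \<integral>\<^sup>+\<gamma>. U i (x, x + \<epsilon> *\<^sub>R \<gamma>) \<partial>k x)" for x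
    unfolding SUP_apply
    using seq by (intro nn_integral_monotone_convergence_SUP measurable_k_jump) (auto simp: incseq_def le_fun_def)
  show ?case unfolding 1 2
    using seq by (subst nn_integral_monotone_convergence_SUP)
      (auto intro!: borel_measurable_jump_integral nn_integral_mono simp: incseq_def le_fun_def)
qed

section \<open>Symmetry of the jump measure under exchange of the endpoints\<close>

lemma emeasure_J_diagonal: "emeasure J {p. fst p = snd p} = 0"
proof -
  have *: "{p::'a\<times>'a. fst p = snd p} \<in> sets borel"
    by (intro borel_closed closed_Collect_eq continuous_intros)
  have "(\<integral>\<^sup>+\<gamma>. indicator {p. fst p = snd p} (x, x + \<epsilon> *\<^sub>R \<gamma>) \<partial>k x) = (\<integral>\<^sup>+\<gamma>. 0 \<partial>k x)" for x
    using eps by (intro nn_integral_cong) (auto simp: space_k indicator_def)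
  then show ?thesis by (simp add: emeasure_J[OF *])
qed

lemma borel_measurable_swap: "prod.swap \<in> measurable (borel :: ('a \<times> 'a) measure) borel"
  by (intro borel_measurable_continuous_onI continuous_on_swap)

text \<open>The indicator of a bounded open set is the increasing limit of min 1 (n dist(x,
  complement)), which are admissible in the reversibility hypothesis. Monotone convergence works
  even if both sides are infinite.\<close>

lemma emeasure_J_open_rectangle:
  assumes "open A" "bounded A" "open B" "bounded B"
  shows "emeasure J (A \<times> B) = emeasure J (B \<times> A)"
proof -
  define \<eta> where "\<eta> A n x = min 1 (real n * infdist x (- A))" for A :: "'a set" and n x
  have *: "\<eta> A n \<in> C0_nonneg" "incseq (\<lambda>n. \<eta> A n x)" "(SUP n. ennreal (\<eta> A n x)) = indicator A x"
    if A: "open A" "bounded A" for A n x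
  proof -
    \<comment> \<open>\<open>infdist\<close> to the empty set is 0 by convention, so the cutoffs
      make sense only because a bounded set has a nonempty complement.\<close>
    have ne: "- A \<noteq> {}" using A(2) not_bounded_UNIV by (metis Compl_UNIV_eq double_complement)
    have pos: "0 < infdist x (- A) \<longleftrightarrow> x \<in> A" for x
      using in_closed_iff_infdist_zero[OF _ ne, of x] infdist_nonneg[of x "- A"] A(1)
      by (auto simp: closed_Compl less_le)
    have "{x. \<eta> A n x \<noteq> 0} \<subseteq> A"
    proof
      fix y assume "y \<in> {x. \<eta> A n x \<noteq> 0}"
      then have "infdist y (- A) \<noteq> 0" by (auto simp: \<eta>_def)
      then show "y \<in> A" using pos[of y] infdist_nonneg[of y "- A"] by auto
    qed
    then have "compact (closure {x. \<eta> A n x \<noteq> 0})"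
      using A(2) bounded_subset by auto
    then show "\<eta> A n \<in> C0_nonneg"
      unfolding C0_nonneg_def by (auto simp: \<eta>_def infdist_nonneg intro!: continuous_intros)
    show "incseq (\<lambda>n. \<eta> A n x)"
      unfolding incseq_def \<eta>_def
      by (intro allI impI min.mono order_refl mult_right_mono infdist_nonneg) simp
    show "(SUP n. ennreal (\<eta> A n x)) = indicator A x"
    proof (cases "x \<in> A")
      case True
      obtain n where "1 / infdist x (- A) < real n" using reals_Archimedean2 by blast
      then have "1 \<le> real n * infdist x (- A)" using True pos[of x] by (simp add: field_simps)
      then have "\<eta> A n x = 1" by (simp add: \<eta>_def)
      then have "1 \<le> (SUP n. ennreal (\<eta> A n x))" by (intro SUP_upper2[of n]) auto
      moreover have "(SUP n. ennreal (\<eta> A n x)) \<le> 1" by (intro SUP_least) (simp add: \<eta>_def)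
      ultimately show ?thesis using True by simp
    next
      case False
      then have "infdist x (- A) = 0" by simp
      then show ?thesis using False by (simp add: \<eta>_def)
    qed
  qed
  have pos: "0 \<le> \<eta> A n x" for A n x by (simp add: \<eta>_def infdist_nonneg)
  have cont: "continuous_on UNIV (\<eta> A n)" if "open A" "bounded A" for A n
    using *(1)[OF that] by (simp add: C0_nonneg_def)
  have SUP: "(\<integral>\<^sup>+p. indicator (A \<times> B) p \<partial>J) = (SUP n. \<integral>\<^sup>+p. ennreal (\<eta> A n (fst p) * \<eta> B n (snd p)) \<partial>J)"
    if "open A" "bounded A" "open B" "bounded B" for A B
  proof -
    have "(SUP n. ennreal (\<eta> A n x * \<eta> B n y)) = indicator (A \<times> B) (x, y)" for x y
    proof -
      have "incseq (\<lambda>n. ennreal (\<eta> A n x))" "incseq (\<lambda>n. ennreal (\<eta> B n y))"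
        using *(2)[of A x] *(2)[of B y] that by (auto simp: incseq_def intro!: ennreal_leI)
      note inc = this
      have "(\<lambda>n. ennreal (\<eta> A n x)) \<longlonglongrightarrow> indicator A x" "(\<lambda>n. ennreal (\<eta> B n y)) \<longlonglongrightarrow> indicator B y"
        using LIMSEQ_SUP[OF inc(1)] LIMSEQ_SUP[OF inc(2)] *(3) that by simp_all
      then have "(\<lambda>n. ennreal (\<eta> A n x) * ennreal (\<eta> B n y)) \<longlonglongrightarrow> indicator A x * indicator B y"
        by (rule tendsto_mult_ennreal) (auto simp: indicator_def)
      moreover have "incseq (\<lambda>n. ennreal (\<eta> A n x) * ennreal (\<eta> B n y))"
        using inc by (auto simp: incseq_def intro!: mult_mono)
      ultimately have "(SUP n. ennreal (\<eta> A n x) * ennreal (\<eta> B n y)) = indicator A x * indicator B y"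
        using LIMSEQ_SUP LIMSEQ_unique by blast
      then show ?thesis by (simp add: ennreal_mult pos indicator_times)
    qed
    then have "(\<integral>\<^sup>+p. indicator (A \<times> B) p \<partial>J) = (\<integral>\<^sup>+p. (SUP n. ennreal (\<eta> A n (fst p) * \<eta> B n (snd p))) \<partial>J)"
      by (intro nn_integral_cong) auto
    also have "\<dots> = (SUP n. \<integral>\<^sup>+p. ennreal (\<eta> A n (fst p) * \<eta> B n (snd p)) \<partial>J)"
    proof (rule nn_integral_monotone_convergence_SUP)
      show "incseq (\<lambda>n p. ennreal (\<eta> A n (fst p) * \<eta> B n (snd p)))"
        using *(2) that by (auto simp: incseq_def le_fun_def pos intro!: ennreal_leI mult_mono)
      show "(\<lambda>p. ennreal (\<eta> A n (fst p) * \<eta> B n (snd p))) \<in> borel_measurable J" for n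
        unfolding measurable_J
        by (intro measurable_compose[OF _ measurable_ennreal] borel_measurable_continuous_onI
          continuous_intros continuous_on_compose2[OF cont]) (use that in auto)
    qed
    finally show ?thesis .
  qed
  have "(\<integral>\<^sup>+p. ennreal (\<eta> A n (fst p) * \<eta> B n (snd p)) \<partial>J) = (\<integral>\<^sup>+p. ennreal (\<eta> B n (fst p) * \<eta> A n (snd p)) \<partial>J)" for n
  proof -
    have m: "(\<lambda>p. ennreal (\<eta> A n (fst p) * \<eta> B n (snd p))) \<in> borel_measurable borel"
      if "open A" "bounded A" "open B" "bounded B" for A B
      by (intro measurable_compose[OF _ measurable_ennreal] borel_measurable_continuous_onI
          continuous_intros continuous_on_compose2[OF cont]) (use that in auto)
    show ?thesis
      using reversible[OF *(1)[of A n] *(1)[of B n]] assms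
      unfolding nn_integral_J[OF m[OF assms]] nn_integral_J[OF m[OF assms(3,4,1,2)]] fst_conv snd_conv
      by (simp add: mult.commute)
  qed
  then have "(\<integral>\<^sup>+p. indicator (A \<times> B) p \<partial>J) = (\<integral>\<^sup>+p. indicator (B \<times> A) p \<partial>J)"
    using SUP assms by simp
  then show ?thesis using assms by (simp add: borel_open open_Times)
qed

text \<open>A Chebyshev estimate: a jump from P to Q has \<epsilon>|\<gamma>| \<ge> \<delta>, so the
  indicator is at most (\<epsilon>/\<delta>)^2 |\<gamma>|^2, and P has finite volume.\<close>

lemma emeasure_J_separated_finite:
  assumes "open P" "bounded P" "open Q" and "0 < \<delta>" and \<delta>: "\<And>p q. p \<in> P \<Longrightarrow> q \<in> Q \<Longrightarrow> \<delta> \<le> dist p q"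
  shows "emeasure J (P \<times> Q) < \<infinity>"
proof -
  define c where "c = (\<epsilon> / \<delta>)\<^sup>2"
  have "(\<integral>\<^sup>+\<gamma>. indicator (P \<times> Q) (x, x + \<epsilon> *\<^sub>R \<gamma>) \<partial>k x) \<le> ennreal (c * C) * indicator P x" for x
  proof (cases "x \<in> P")
    case True
    have "(\<integral>\<^sup>+\<gamma>. indicator (P \<times> Q) (x, x + \<epsilon> *\<^sub>R \<gamma>) \<partial>k x) \<le> (\<integral>\<^sup>+\<gamma>. ennreal c * ennreal ((norm \<gamma>)\<^sup>2) \<partial>k x)"
    proof (rule nn_integral_mono)
      fix \<gamma>
      have "1 \<le> c * (norm \<gamma>)\<^sup>2" if "x + \<epsilon> *\<^sub>R \<gamma> \<in> Q"
      proof -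
        have "1 \<le> \<epsilon> / \<delta> * norm \<gamma>"
          using \<delta>[OF True that] eps \<open>0 < \<delta>\<close> by (simp add: dist_norm field_simps)
        then show ?thesis by (simp add: c_def power_mult_distrib[symmetric] one_le_power del: power_divide)
      qed
      then show "indicator (P \<times> Q) (x, x + \<epsilon> *\<^sub>R \<gamma>) \<le> ennreal c * ennreal ((norm \<gamma>)\<^sup>2)"
        by (auto simp: indicator_def c_def ennreal_mult[symmetric] ennreal_1[symmetric] simp del: ennreal_1 intro!: ennreal_leI)
    qed
    also have "\<dots> = ennreal c * (\<integral>\<^sup>+\<gamma>. ennreal ((norm \<gamma>)\<^sup>2) \<partial>k x)"
      by (intro nn_integral_cmult measurable_k) measurable
    also have "\<dots> \<le> ennreal c * ennreal C" by (intro mult_left_mono second_moment) simp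
    finally show ?thesis using True C_pos by (simp add: c_def ennreal_mult)
  qed (simp add: indicator_def)
  then have "(\<integral>\<^sup>+x. (\<integral>\<^sup>+\<gamma>. indicator (P \<times> Q) (x, x + \<epsilon> *\<^sub>R \<gamma>) \<partial>k x) \<partial>lborel)
      \<le> (\<integral>\<^sup>+x. ennreal (c * C) * indicator P x \<partial>lborel)"
    by (intro nn_integral_mono)
  also have "\<dots> = ennreal (c * C) * emeasure lborel P"
    using assms by (subst nn_integral_cmult) auto
  also have "\<dots> < \<infinity>"
    using emeasure_bounded_finite[OF \<open>bounded P\<close>] by (simp add: ennreal_mult_less_top)
  finally show ?thesis using assms by (simp add: emeasure_J borel_open open_Times)
qed

text \<open>\<open>J\<close> may be infinite on rectangles that meet the diagonal, so uniqueness of measures is applied on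
  products \<open>P \<times> Q\<close> of bounded sets at positive distance.  Countably many of them cover the complement
  of the diagonal, which is a null set.\<close>

lemma distr_J_swap: "distr J borel prod.swap = J"
proof (rule measure_eqI)
  let ?J' = "distr J borel prod.swap"
  show "sets ?J' = sets J" by simp
  have swap_meas: "prod.swap \<in> measurable J borel"
    unfolding measurable_J by (rule borel_measurable_swap)
  have local: "emeasure ?J' (A \<inter> P \<times> Q) = emeasure J (A \<inter> P \<times> Q)"
    if A: "A \<in> sets borel" and P: "open P" "bounded P" and Q: "open Q" "bounded Q"
      and \<delta>: "0 < \<delta>" "\<And>p q. p \<in> P \<Longrightarrow> q \<in> Q \<Longrightarrow> \<delta> \<le> dist p q" for A P Q \<delta>
  proof -
    have PQ: "P \<times> Q \<in> sets borel" using P Q by (simp add: borel_open open_Times)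
    let ?E = "{A \<times> B | A B. open A \<and> open (B :: 'a set)} :: ('a \<times> 'a) set set"
    \<comment> \<open>Restriction to the separated rectangle produces finite measures, so a single
      set, the whole space, serves as the exhausting sequence in the uniqueness theorem.\<close>
    have "density J (indicator (P \<times> Q)) = density ?J' (indicator (P \<times> Q))"
    proof (rule measure_eqI_generator_eq[where E="?E" and \<Omega>=UNIV and A="\<lambda>_::nat. UNIV \<times> UNIV"])
      show "Int_stable ?E"
      proof (rule Int_stableI)
        fix a b assume "a \<in> ?E" "b \<in> ?E"
        then obtain A B A' B' where "a = A \<times> B" "b = A' \<times> B'"
          "open A" "open B" "open A'" "open B'" by auto
        then have "a \<inter> b = (A \<inter> A') \<times> (B \<inter> B')" "open (A \<inter> A')" "open (B \<inter> B')"
          by (auto simp: Times_Int_Times)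
        then show "a \<inter> b \<in> ?E" by blast
      qed
      \<comment> \<open>Second countability: every open set of the product is a countable union of
        open rectangles.\<close>
      have "sigma_sets UNIV (Collect open) = sigma_sets UNIV ?E"
      proof (rule sigma_sets_eqI)
        fix X :: "('a \<times> 'a) set" assume "X \<in> Collect open"
        then have X: "open X" by simp
        obtain \<B> :: "('a \<times> 'a) set set" where "\<B> \<subseteq> ?E" "countable \<B>" "X = \<Union>\<B>"
        proof -
          obtain \<A> :: "'a set set" where \<A>: "countable \<A>" "topological_basis \<A>"
            using ex_countable_basis by blast
          have b: "topological_basis ((\<lambda>(a, b). a \<times> b) ` (\<A> \<times> \<A>))"
            using topological_basis_prod[OF \<A>(2) \<A>(2)] .
          then obtain \<B> where "\<B> \<subseteq> (\<lambda>(a, b). a \<times> b) ` (\<A> \<times> \<A>)" "X = \<Union>\<B>"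
            using X unfolding topological_basis_def by metis
          moreover have "(\<lambda>(a, b). a \<times> b) ` (\<A> \<times> \<A>) \<subseteq> ?E"
            using topological_basis_open[OF \<A>(2)] by auto
          moreover have "countable \<B>"
            using calculation(1) \<A>(1) by (meson countable_SIGMA countable_image countable_subset)
          ultimately show ?thesis by - (rule that[OF subset_trans])
        qed
        then show "X \<in> sigma_sets UNIV ?E"
          by (metis (no_types, lifting) sigma_sets_UNION sigma_sets.Basic subsetD)
      next
        fix X :: "('a \<times> 'a) set" assume "X \<in> ?E"
        then show "X \<in> sigma_sets UNIV (Collect open)" by (auto simp: open_Times)
      qed
      then have "sets (borel :: ('a \<times> 'a) measure) = sigma_sets UNIV ?E"
        by (simp add: borel_def)
      then show "sets (density J (indicator (P \<times> Q))) = sigma_sets UNIV ?E"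
        "sets (density ?J' (indicator (P \<times> Q))) = sigma_sets UNIV ?E" by simp_all
      have "indicator (P \<times> Q) \<in> borel_measurable J" using PQ by simp
      then show "emeasure (density J (indicator (P \<times> Q))) (UNIV \<times> UNIV) \<noteq> \<infinity>" for i :: nat
        using emeasure_J_separated_finite[OF P(1,2) Q(1) \<delta>] PQ
        by (subst emeasure_density) (auto simp: less_top)
      show "emeasure (density J (indicator (P \<times> Q))) X = emeasure (density ?J' (indicator (P \<times> Q))) X"
        if "X \<in> ?E" for X
      proof -
        obtain A B where X: "X = A \<times> B" "open A" "open B" using \<open>X \<in> ?E\<close> by auto
        then have X_b: "X \<in> sets borel" by (simp add: borel_open open_Times)
        \<comment> \<open>Cutting an open rectangle with P \<times> Q gives a bounded open
          rectangle, to which the symmetry already proved applies.\<close>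
        have op: "open (A \<inter> P)" "open (B \<inter> Q)" "bounded (A \<inter> P)" "bounded (B \<inter> Q)"
          using X P Q by (auto intro: open_Int)
        have "emeasure (density J (indicator (P \<times> Q))) X = emeasure J (P \<times> Q \<inter> X)"
          using PQ X_b by (subst emeasure_density) (auto simp: indicator_inter_arith[symmetric])
        also have "\<dots> = emeasure J ((A \<inter> P) \<times> (B \<inter> Q))"
          by (rule arg_cong[where f="emeasure J"]) (auto simp: X)
        also have "\<dots> = emeasure J ((B \<inter> Q) \<times> (A \<inter> P))"
          using op by (intro emeasure_J_open_rectangle)
        also have "\<dots> = emeasure ?J' (P \<times> Q \<inter> X)"
          using PQ X_b by (subst emeasure_distr[OF swap_meas])
            (auto simp: X intro!: arg_cong[where f="emeasure J"])
        also have "\<dots> = emeasure (density ?J' (indicator (P \<times> Q))) X"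
          using PQ X_b by (subst emeasure_density) (auto simp: indicator_inter_arith[symmetric])
        finally show ?thesis .
      qed
    qed (auto intro!: exI[of _ UNIV])
    then have "emeasure (density J (indicator (P \<times> Q))) A = emeasure (density ?J' (indicator (P \<times> Q))) A"
      by simp
    then show ?thesis
      using A PQ by (simp add: emeasure_density indicator_inter_arith[symmetric] Int_commute)
  qed
  obtain \<A> :: "'a set set" where \<A>: "countable \<A>" "topological_basis \<A>"
    using ex_countable_basis by blast
  \<comment> \<open>Taking both factors from a countable base keeps the family countable; the
    separation condition is what \<open>local\<close> requires.\<close>
  define I where "I = {(P, Q). P \<in> \<A> \<and> Q \<in> \<A> \<and> bounded P \<and> bounded Q \<and>
     (\<exists>\<delta>>0. \<forall>p\<in>P. \<forall>q\<in>Q. \<delta> \<le> dist p q)}"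
  have I_count: "countable I"
    by (rule countable_subset[of _ "\<A> \<times> \<A>"]) (use \<A> in \<open>auto simp: I_def\<close>)
  have I_cover: "\<exists>PQ\<in>I. x \<in> fst PQ \<and> y \<in> snd PQ" if "x \<noteq> y" for x y
  proof -
    \<comment> \<open>Balls of radius a quarter of the distance stay at least 2r apart.\<close>
    define r where "r = dist x y / 4"
    have r: "0 < r" using that by (simp add: r_def)
    obtain P where P: "P \<in> \<A>" "x \<in> P" "P \<subseteq> ball x r"
      using topological_basisE[OF \<A>(2) open_ball centre_in_ball[THEN iffD2, OF r]] by metis
    obtain Q where Q: "Q \<in> \<A>" "y \<in> Q" "Q \<subseteq> ball y r"
      using topological_basisE[OF \<A>(2) open_ball centre_in_ball[THEN iffD2, OF r]] by metis
    have "r \<le> dist p q" if "p \<in> P" "q \<in> Q" for p q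
    proof -
      have "dist x p < r" "dist q y < r" using that P Q by (auto simp: dist_commute)
      moreover have "dist x y \<le> dist x p + dist p q + dist q y"
        by (metis add.commute add_left_mono dist_triangle dist_triangle2 order_trans dist_commute add.assoc)
      ultimately show ?thesis using zero_le_dist[of x y] unfolding r_def by linarith
    qed
    then have "(P, Q) \<in> I"
      using P Q r bounded_subset[OF bounded_ball] by (auto simp: I_def)
    then show ?thesis using P Q by force
  qed
  obtain b :: 'a where "b \<noteq> 0" using nonempty_Basis nonzero_Basis by blast
  then have I_ne: "I \<noteq> {}" using I_cover by blast
  define D where "D n = (case from_nat_into I n of (P, Q) \<Rightarrow> P \<times> Q)" for n
  have D_ex: "\<exists>P Q \<delta>. D n = P \<times> Q \<and> open P \<and> open Q \<and> bounded P \<and> bounded Q \<and> 0 < \<delta> \<and>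
      (\<forall>p\<in>P. \<forall>q\<in>Q. \<delta> \<le> dist p q)" for n
    using from_nat_into[OF I_ne, of n] topological_basis_open[OF \<A>(2)]
    by (auto simp: D_def I_def split: prod.splits)
  have D_sets: "D n \<in> sets borel" for n
    using D_ex[of n] by (auto simp: borel_open open_Times)
  have D_cover: "{p. fst p \<noteq> snd p} \<subseteq> (\<Union>n. D n)"
  proof
    fix p :: "'a \<times> 'a" assume "p \<in> {p. fst p \<noteq> snd p}"
    then obtain PQ where PQ: "PQ \<in> I" "fst p \<in> fst PQ" "snd p \<in> snd PQ" using I_cover by blast
    obtain n where "from_nat_into I n = PQ"
      using from_nat_into_surj[OF I_count PQ(1)] by blast
    then have "p \<in> D n" using PQ by (simp add: D_def mem_Times_iff split_beta)
    then show "p \<in> (\<Union>n. D n)" by blast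
  qed
  have dD: "disjointed D n \<in> sets borel" for n
    using D_sets sets.range_disjointed_sets[of D borel] by auto
  \<comment> \<open>The diagonal being null, the disjoint pieces carry the whole mass, and each of
    them lies inside one separated rectangle, where the two measures agree.\<close>
  have decomp: "emeasure M A = (\<Sum>n. emeasure M (A \<inter> disjointed D n))"
    if M: "sets M = sets borel" "emeasure M {p. fst p = snd p} = 0" and A: "A \<in> sets borel"
    for M :: "('a \<times> 'a) measure" and A
  proof -
    have "{p. fst p = snd p} \<in> null_sets M"
      using M by (auto simp: null_sets_def intro!: borel_closed closed_Collect_eq continuous_intros)
    then have "AE p in M. p \<notin> {p. fst p = snd p}" by (rule AE_not_in)
    then have "emeasure M A = emeasure M (\<Union>n. A \<inter> disjointed D n)"
    proof (intro emeasure_eq_AE, eventually_elim)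
      case (elim p)
      then show ?case using D_cover UN_disjointed_eq[of D] by blast
    qed (use M A dD in \<open>auto intro!: sets.countable_UN\<close>)
    also have "\<dots> = (\<Sum>n. emeasure M (A \<inter> disjointed D n))"
    proof (rule suminf_emeasure[symmetric])
      show "disjoint_family (\<lambda>n. A \<inter> disjointed D n)"
        using disjoint_family_disjointed[of D] unfolding disjoint_family_on_def by blast
    qed (use M A dD in auto)
    finally show ?thesis .
  qed
  fix A assume "A \<in> sets ?J'"
  then have A: "A \<in> sets borel" by simp
  have diag: "emeasure ?J' {p. fst p = snd p} = 0"
  proof -
    have "{p::'a\<times>'a. fst p = snd p} \<in> sets borel"
      by (intro borel_closed closed_Collect_eq continuous_intros)
    moreover have "prod.swap -` {p. fst p = snd p} = {p::'a\<times>'a. fst p = snd p}" by auto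
    ultimately show ?thesis by (simp add: emeasure_distr[OF swap_meas] emeasure_J_diagonal)
  qed
  have "emeasure ?J' (A \<inter> disjointed D n) = emeasure J (A \<inter> disjointed D n)" for n
  proof -
    obtain P Q \<delta> where PQ: "D n = P \<times> Q" "open P" "open Q" "bounded P" "bounded Q" "0 < \<delta>"
      "\<And>p q. p \<in> P \<Longrightarrow> q \<in> Q \<Longrightarrow> \<delta> \<le> dist p q" using D_ex[of n] by metis
    have "(A \<inter> disjointed D n) \<inter> P \<times> Q = A \<inter> disjointed D n"
      using disjointed_subset[of D n] PQ(1) by auto
    then show ?thesis
      using local[of "A \<inter> disjointed D n" P Q \<delta>] PQ A dD[of n] by simp
  qed
  then show "emeasure ?J' A = emeasure J A"
    using decomp[OF _ diag A] decomp[OF _ emeasure_J_diagonal A] by simp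
qed

lemma nn_integral_J_swap:
  fixes F :: "'a \<times> 'a \<Rightarrow> ennreal"
  assumes "F \<in> borel_measurable borel"
  shows "(\<integral>\<^sup>+p. F (prod.swap p) \<partial>J) = (\<integral>\<^sup>+p. F p \<partial>J)"
proof -
  have "(\<integral>\<^sup>+p. F p \<partial>distr J borel prod.swap) = (\<integral>\<^sup>+p. F (prod.swap p) \<partial>J)"
    using assms borel_measurable_swap by (intro nn_integral_distr) (auto simp: measurable_J)
  then show ?thesis by (simp add: distr_J_swap)
qed

lemma AE_J_fst:
  assumes "AE x in lborel. R x"
  shows "AE p in J. R (fst p)"
proof -
  obtain N where N: "{x. \<not> R x} \<subseteq> N" "N \<in> sets borel" "emeasure lborel N = 0"
    using assms unfolding eventually_ae_filter null_sets_def by auto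
  have NU: "N \<times> UNIV \<in> sets (borel :: ('a \<times> 'a) measure)"
    using N by (simp add: borel_prod[symmetric])
  have "(\<integral>\<^sup>+\<gamma>. indicator (N \<times> UNIV) (x, x + \<epsilon> *\<^sub>R \<gamma>) \<partial>k x) = (\<integral>\<^sup>+\<gamma>. 1 \<partial>k x) * indicator N x" for x
    by (cases "x \<in> N") (auto simp: indicator_def)
  then have "emeasure J (N \<times> UNIV) = (\<integral>\<^sup>+x. (\<integral>\<^sup>+\<gamma>. 1 \<partial>k x) * indicator N x \<partial>lborel)"
    by (simp add: emeasure_J[OF NU])
  also have "\<dots> = 0"
    using N by (intro nn_integral_null_set) (auto simp: null_sets_def)
  finally have "N \<times> UNIV \<in> null_sets J" using NU by (auto simp: null_sets_def)
  then have "AE p in J. p \<notin> N \<times> UNIV" by (rule AE_not_in)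
  then show ?thesis using N(1) by (auto elim!: eventually_mono)
qed

text \<open>K(x, d\<gamma>) may be singular to Lebesgue measure, so nothing in the definition of
  \<open>J\<close> prevents jumps from concentrating on a null set of targets. Symmetry rules this
  out by reducing it to the case of starting points.\<close>

lemma AE_J_snd:
  assumes "AE x in lborel. R x"
  shows "AE p in J. R (snd p)"
proof -
  obtain N where N: "{x. \<not> R x} \<subseteq> N" "N \<in> sets borel" "emeasure lborel N = 0"
    using assms unfolding eventually_ae_filter null_sets_def by auto
  have U: "UNIV \<times> N \<in> sets (borel :: ('a \<times> 'a) measure)" "N \<times> UNIV \<in> sets (borel :: ('a \<times> 'a) measure)"
    using N by (simp_all add: borel_prod[symmetric])
  have "AE x in lborel. x \<notin> N" using N by (intro AE_not_in) (auto simp: null_sets_def)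
  then have "AE p in J. fst p \<notin> N" by (rule AE_J_fst)
  then have "N \<times> UNIV \<in> null_sets J"
    using U by (intro AE_iff_null_sets[THEN iffD2]) (auto simp: mem_Times_iff)
  then have "emeasure J (N \<times> UNIV) = 0" by blast
  moreover have "emeasure J (UNIV \<times> N) = emeasure J (N \<times> UNIV)"
    using nn_integral_J_swap[of "indicator (N \<times> UNIV)"] U
    by (simp add: indicator_def mem_Times_iff nn_integral_indicator[symmetric] del: nn_integral_indicator)
  ultimately have "UNIV \<times> N \<in> null_sets J" using U by (auto simp: null_sets_def)
  then have "AE p in J. p \<notin> UNIV \<times> N" by (rule AE_not_in)
  then show ?thesis using N(1) by (auto elim!: eventually_mono simp: mem_Times_iff)
qed

text \<open>The forms are defined by iterated Bochner integrals. Splitting into positive and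
  negative parts reduces them to \<open>nn_integral_J\<close>, with no appeal to a Fubini theorem
  for \<sigma>-finite products.\<close>

lemma integral_J:
  fixes F :: "'a \<times> 'a \<Rightarrow> real"
  assumes "integrable J F"
  shows "(LINT x|lborel. (LINT \<gamma>|k x. F (x, x + \<epsilon> *\<^sub>R \<gamma>))) = (LINT p|J. F p)"
proof -
  have F: "F \<in> borel_measurable borel" using assms measurable_J by auto
  have mF: "(\<lambda>\<gamma>. F (x, x + \<epsilon> *\<^sub>R \<gamma>)) \<in> borel_measurable (k x)" for x
    using F by (rule measurable_k_jump)
  define a where "a s x = (\<integral>\<^sup>+\<gamma>. ennreal (s * F (x, x + \<epsilon> *\<^sub>R \<gamma>)) \<partial>k x)" for s x
  have a_meas: "a s \<in> borel_measurable borel" for s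
    unfolding a_def using F by (intro borel_measurable_jump_integral[of "\<lambda>p. ennreal (s * F p)"]) measurable
  have a_int: "(\<integral>\<^sup>+x. a s x \<partial>lborel) = (\<integral>\<^sup>+p. ennreal (s * F p) \<partial>J)" for s
    unfolding a_def using F by (subst nn_integral_J) auto
  have fin: "(\<integral>\<^sup>+x. a s x \<partial>lborel) < \<infinity>" for s
    using integrableD(2)[OF integrable_mult_right[OF assms, of s]]
    by (simp add: a_int less_top)
  have AE_fin: "AE x in lborel. a s x \<noteq> \<infinity>" for s
    using a_meas fin by (intro nn_integral_PInf_AE) (auto simp: less_top)
  have a_real: "integrable lborel (\<lambda>x. enn2real (a s x))"
    "(LINT x|lborel. enn2real (a s x)) = enn2real (\<integral>\<^sup>+p. ennreal (s * F p) \<partial>J)" for s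
  proof -
    have "(\<integral>\<^sup>+x. ennreal (enn2real (a s x)) \<partial>lborel) = (\<integral>\<^sup>+x. a s x \<partial>lborel)"
      using AE_fin[of s] by (intro nn_integral_cong_AE) (auto simp: less_top)
    then show "integrable lborel (\<lambda>x. enn2real (a s x))"
      "(LINT x|lborel. enn2real (a s x)) = enn2real (\<integral>\<^sup>+p. ennreal (s * F p) \<partial>J)"
      using a_meas fin[of s] a_int[of s]
      by (auto intro!: integrableI_nonneg simp: integral_eq_nn_integral)
  qed
  \<comment> \<open>For a null set of x the inner integral may fail to exist and is then 0 by
    convention. This formula holds at every x, so the inner integral is measurable and almost
    everywhere the difference of the two parts.\<close>
  have LINT_eq: "(LINT \<gamma>|k x. F (x, x + \<epsilon> *\<^sub>R \<gamma>)) =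
      (if a 1 x \<noteq> \<infinity> \<and> a (-1) x \<noteq> \<infinity> then enn2real (a 1 x) - enn2real (a (-1) x) else 0)" for x
  proof (cases "integrable (k x) (\<lambda>\<gamma>. F (x, x + \<epsilon> *\<^sub>R \<gamma>))")
    case True
    then show ?thesis using mF[of x]
      by (simp add: real_lebesgue_integral_def real_integrable_def a_def)
  next
    case False
    then show ?thesis using mF[of x]
      by (auto simp: not_integrable_integral_eq real_integrable_def a_def)
  qed
  have "(LINT x|lborel. (LINT \<gamma>|k x. F (x, x + \<epsilon> *\<^sub>R \<gamma>)))
      = (LINT x|lborel. enn2real (a 1 x) - enn2real (a (-1) x))"
  proof (rule integral_cong_AE)
    have [measurable]: "a s \<in> borel_measurable lborel" for s using a_meas by simp
    show "(\<lambda>x. LINT \<gamma>|k x. F (x, x + \<epsilon> *\<^sub>R \<gamma>)) \<in> borel_measurable lborel"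
      unfolding LINT_eq by measurable
    show "(\<lambda>x. enn2real (a 1 x) - enn2real (a (-1) x)) \<in> borel_measurable lborel"
      by measurable
    show "AE x in lborel. (LINT \<gamma>|k x. F (x, x + \<epsilon> *\<^sub>R \<gamma>)) = enn2real (a 1 x) - enn2real (a (-1) x)"
      using AE_fin[of 1] AE_fin[of "-1"] by eventually_elim (simp add: LINT_eq)
  qed
  also have "\<dots> = (LINT p|J. F p)"
    using a_real[of 1] a_real[of "-1"] by (simp add: real_lebesgue_integral_def[OF assms])
  finally show ?thesis .
qed

end

section \<open>Square integrable functions\<close>

definition square_integrable :: "'b measure \<Rightarrow> ('b \<Rightarrow> real) \<Rightarrow> bool" where
  "square_integrable M f \<longleftrightarrow> f \<in> borel_measurable M \<and> integrable M (\<lambda>x. (f x)\<^sup>2)"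

lemma square_integrable_measurable [dest]: "square_integrable M f \<Longrightarrow> f \<in> borel_measurable M"
  and square_integrable_integrable [dest]: "square_integrable M f \<Longrightarrow> integrable M (\<lambda>x. (f x)\<^sup>2)"
  by (auto simp: square_integrable_def)

lemma square_integrable_dominated:
  assumes "square_integrable M f" "g \<in> borel_measurable M" "\<And>x. \<bar>g x\<bar> \<le> \<bar>f x\<bar>"
  shows "square_integrable M g"
  unfolding square_integrable_def
proof
  show "integrable M (\<lambda>x. (g x)\<^sup>2)"
    by (rule Bochner_Integration.integrable_bound[OF square_integrable_integrable[OF assms(1)]])
      (use assms in \<open>auto simp: abs_le_square_iff[symmetric]\<close>)
qed fact

lemma square_integrable_cmult: "square_integrable M f \<Longrightarrow> square_integrable M (\<lambda>x. c * f x)"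
  by (auto simp: square_integrable_def power_mult_distrib)

lemma square_integrable_abs: "square_integrable M f \<Longrightarrow> square_integrable M (\<lambda>x. \<bar>f x\<bar>)"
  by (auto simp: square_integrable_def)

lemma square_integrable_mult:
  assumes f: "square_integrable M f" and g: "square_integrable M g"
  shows "integrable M (\<lambda>x. f x * g x)"
proof (rule Bochner_Integration.integrable_bound)
  show "integrable M (\<lambda>x. (f x)\<^sup>2 + (g x)\<^sup>2)" using f g by auto
  show "(\<lambda>x. f x * g x) \<in> borel_measurable M"
    by (intro borel_measurable_times square_integrable_measurable f g)
  have "\<bar>a * b\<bar> \<le> a\<^sup>2 + b\<^sup>2" for a b :: real
    using sum_squares_bound[of "\<bar>a\<bar>" "\<bar>b\<bar>"] mult_nonneg_nonneg[of "\<bar>a\<bar>" "\<bar>b\<bar>"]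
    by (simp add: abs_mult del: mult_nonneg_nonneg)
  then show "AE x in M. norm (f x * g x) \<le> norm ((f x)\<^sup>2 + (g x)\<^sup>2)" by simp
qed

lemma square_integrable_add:
  assumes f: "square_integrable M f" and g: "square_integrable M g"
  shows "square_integrable M (\<lambda>x. f x + g x)"
  using assms square_integrable_mult[OF f g]
  by (auto simp: square_integrable_def power2_sum mult.assoc)

lemma square_integrable_diff:
  assumes "square_integrable M f" and "square_integrable M g"
  shows "square_integrable M (\<lambda>x. f x - g x)"
  using square_integrable_add[OF assms(1) square_integrable_cmult[OF assms(2), of "-1"]] by simp

lemma integral_Cauchy_Schwarz:
  assumes f: "square_integrable M f" and g: "square_integrable M g"
  shows "(LINT x|M. \<bar>f x * g x\<bar>) \<le> sqrt (LINT x|M. (f x)\<^sup>2) * sqrt (LINT x|M. (g x)\<^sup>2)"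
proof -
  have "(\<integral>\<^sup>+x. ennreal \<bar>f x\<bar> * ennreal \<bar>g x\<bar> \<partial>M)\<^sup>2
      \<le> (\<integral>\<^sup>+x. (ennreal \<bar>f x\<bar>)\<^sup>2 \<partial>M) * (\<integral>\<^sup>+x. (ennreal \<bar>g x\<bar>)\<^sup>2 \<partial>M)"
    using f g by (intro Cauchy_Schwarz_nn_integral) auto
  also have "(\<integral>\<^sup>+x. ennreal \<bar>f x\<bar> * ennreal \<bar>g x\<bar> \<partial>M) = ennreal (LINT x|M. \<bar>f x * g x\<bar>)"
    using integrable_abs[OF square_integrable_mult[OF f g]]
    by (subst nn_integral_eq_integral[symmetric]) (simp_all add: abs_mult ennreal_mult)
  also have "(\<integral>\<^sup>+x. (ennreal \<bar>f x\<bar>)\<^sup>2 \<partial>M) = ennreal (LINT x|M. (f x)\<^sup>2)"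
    using f by (subst nn_integral_eq_integral[symmetric]) (auto simp: ennreal_power)
  also have "(\<integral>\<^sup>+x. (ennreal \<bar>g x\<bar>)\<^sup>2 \<partial>M) = ennreal (LINT x|M. (g x)\<^sup>2)"
    using g by (subst nn_integral_eq_integral[symmetric]) (auto simp: ennreal_power)
  finally have "(LINT x|M. \<bar>f x * g x\<bar>)\<^sup>2 \<le> (LINT x|M. (f x)\<^sup>2) * (LINT x|M. (g x)\<^sup>2)"
    by (simp add: ennreal_power ennreal_mult[symmetric])
  then show ?thesis
    by (simp add: real_le_rsqrt real_sqrt_mult[symmetric])
qed

lemma integral_add_square_le:
  assumes f: "square_integrable M f" and g: "square_integrable M g"
  shows "(LINT x|M. (f x + g x)\<^sup>2) \<le> 2 * (LINT x|M. (f x)\<^sup>2) + 2 * (LINT x|M. (g x)\<^sup>2)"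
proof -
  have "(LINT x|M. (f x + g x)\<^sup>2) \<le> (LINT x|M. 2 * (f x)\<^sup>2 + 2 * (g x)\<^sup>2)"
  proof (intro integral_mono)
    show "integrable M (\<lambda>x. 2 * (f x)\<^sup>2 + 2 * (g x)\<^sup>2)"
      by (intro Bochner_Integration.integrable_add integrable_mult_right square_integrable_integrable f g)
    show "(f x + g x)\<^sup>2 \<le> 2 * (f x)\<^sup>2 + 2 * (g x)\<^sup>2" for x
      using sum_squares_bound[of "f x" "g x"] by (simp add: power2_sum)
  qed (use square_integrable_add[OF f g] in auto)
  also have "\<dots> = 2 * (LINT x|M. (f x)\<^sup>2) + 2 * (LINT x|M. (g x)\<^sup>2)"
    using f g by (subst Bochner_Integration.integral_add) auto
  finally show ?thesis .
qed

lemma integral_diff_square_le: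
  assumes f: "square_integrable M f" and g: "square_integrable M g"
  shows "(LINT x|M. (f x - g x)\<^sup>2) \<le> 2 * (LINT x|M. (f x)\<^sup>2) + 2 * (LINT x|M. (g x)\<^sup>2)"
  using integral_add_square_le[OF f square_integrable_cmult[OF g, of "-1"]] by simp

lemma tendsto_integral_mult:
  assumes f: "\<And>n. square_integrable M (f n)" "square_integrable M f'"
    and g: "\<And>n. square_integrable M (g n)" "square_integrable M g'"
    and lim: "(\<lambda>n. LINT x|M. (f n x - f' x)\<^sup>2) \<longlonglongrightarrow> 0" "(\<lambda>n. LINT x|M. (g n x - g' x)\<^sup>2) \<longlonglongrightarrow> 0"
  shows "(\<lambda>n. LINT x|M. f n x * g n x) \<longlonglongrightarrow> (LINT x|M. f' x * g' x)"
proof -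
  define a where "a n = (LINT x|M. (f n x - f' x)\<^sup>2)" for n
  define b where "b n = (LINT x|M. (g n x - g' x)\<^sup>2)" for n
  define A where "A = (LINT x|M. (f' x)\<^sup>2)"
  define B where "B = (LINT x|M. (g' x)\<^sup>2)"
  have "norm ((LINT x|M. f n x * g n x) - (LINT x|M. f' x * g' x))
      \<le> sqrt (a n) * sqrt (b n) + sqrt (a n) * sqrt B + sqrt A * sqrt (b n)" for n
  proof -
    have F: "square_integrable M (\<lambda>x. f n x - f' x)" and G: "square_integrable M (\<lambda>x. g n x - g' x)"
      by (intro square_integrable_diff f g)+
    have "(LINT x|M. f n x * g n x) - (LINT x|M. f' x * g' x) =
        (LINT x|M. f n x * g n x - f' x * g' x)"
      by (intro Bochner_Integration.integral_diff[symmetric] square_integrable_mult f g)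
    also have "\<dots> = (LINT x|M. (f n x - f' x) * (g n x - g' x) + (f n x - f' x) * g' x + f' x * (g n x - g' x))"
      by (simp add: algebra_simps)
    also have "\<dots> = (LINT x|M. (f n x - f' x) * (g n x - g' x)) + (LINT x|M. (f n x - f' x) * g' x)
        + (LINT x|M. f' x * (g n x - g' x))"
      using square_integrable_mult[OF F G] square_integrable_mult[OF F g(2)]
        square_integrable_mult[OF f(2) G]
      by (simp add: Bochner_Integration.integral_add Bochner_Integration.integrable_add)
    finally have "norm ((LINT x|M. f n x * g n x) - (LINT x|M. f' x * g' x)) \<le>
        norm (LINT x|M. (f n x - f' x) * (g n x - g' x)) + norm (LINT x|M. (f n x - f' x) * g' x)
        + norm (LINT x|M. f' x * (g n x - g' x))"
      by (simp only:) (intro norm_triangle_ineq[THEN order_trans] add_mono order_refl)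
    also have "\<dots> \<le> (LINT x|M. \<bar>(f n x - f' x) * (g n x - g' x)\<bar>) + (LINT x|M. \<bar>(f n x - f' x) * g' x\<bar>)
        + (LINT x|M. \<bar>f' x * (g n x - g' x)\<bar>)"
      by (intro add_mono integral_norm_bound[THEN order_trans]) simp_all
    also have "\<dots> \<le> sqrt (a n) * sqrt (b n) + sqrt (a n) * sqrt B + sqrt A * sqrt (b n)"
      unfolding a_def b_def A_def B_def by (intro add_mono integral_Cauchy_Schwarz F G f g)
    finally show ?thesis .
  qed
  note bound = this
  have "(\<lambda>n. sqrt (a n) * sqrt (b n) + sqrt (a n) * sqrt B + sqrt A * sqrt (b n)) \<longlonglongrightarrow>
      sqrt 0 * sqrt 0 + sqrt 0 * sqrt B + sqrt A * sqrt 0"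
    using lim unfolding a_def[symmetric] b_def[symmetric] by (intro tendsto_intros)
  then have "(\<lambda>n. sqrt (a n) * sqrt (b n) + sqrt (a n) * sqrt B + sqrt A * sqrt (b n)) \<longlonglongrightarrow> 0"
    by simp
  then have "(\<lambda>n. (LINT x|M. f n x * g n x) - (LINT x|M. f' x * g' x)) \<longlonglongrightarrow> 0"
    by (rule Lim_null_comparison[OF always_eventually[OF allI[OF bound]]])
  then show ?thesis by (simp add: LIM_zero_iff)
qed

text \<open>The limit function is prescribed by almost everywhere convergence of a subsequence.
  Fatou's lemma along that subsequence turns the Cauchy bound into an L2 bound for f n - f' valid
  for all large n.\<close>

lemma square_integrable_Cauchy_limit:
  assumes f: "\<And>n. square_integrable M (f n)" and f': "f' \<in> borel_measurable M"
    and r: "strict_mono r" and lim: "AE x in M. (\<lambda>n. f (r n) x) \<longlonglongrightarrow> f' x"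
    and cauchy: "\<And>e. 0 < e \<Longrightarrow> \<exists>N. \<forall>m\<ge>N. \<forall>n\<ge>N. (LINT x|M. (f m x - f n x)\<^sup>2) < e"
  shows "square_integrable M f'" "(\<lambda>n. LINT x|M. (f n x - f' x)\<^sup>2) \<longlonglongrightarrow> 0"
proof -
  have [measurable]: "f n \<in> borel_measurable M" "f' \<in> borel_measurable M" for n using f f' by auto
  have bound: "\<exists>N. \<forall>n\<ge>N. (\<integral>\<^sup>+x. ennreal ((f n x - f' x)\<^sup>2) \<partial>M) \<le> ennreal e" if "0 < e" for e
  proof -
    obtain N where N: "\<And>m n. m \<ge> N \<Longrightarrow> n \<ge> N \<Longrightarrow> (LINT x|M. (f m x - f n x)\<^sup>2) < e"
      using cauchy[of e] \<open>0 < e\<close> by blast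
    have "(\<integral>\<^sup>+x. ennreal ((f n x - f' x)\<^sup>2) \<partial>M) \<le> ennreal e" if "n \<ge> N" for n
    proof -
      have "(\<integral>\<^sup>+x. ennreal ((f n x - f' x)\<^sup>2) \<partial>M) = (\<integral>\<^sup>+x. liminf (\<lambda>i. ennreal ((f n x - f (r i) x)\<^sup>2)) \<partial>M)"
      proof (rule nn_integral_cong_AE, use lim in eventually_elim)
        case (elim x)
        then have "(\<lambda>i. ennreal ((f n x - f (r i) x)\<^sup>2)) \<longlonglongrightarrow> ennreal ((f n x - f' x)\<^sup>2)"
          by (intro tendsto_ennrealI tendsto_intros)
        then show ?case by (intro lim_imp_Liminf[symmetric]) simp_all
      qed
      also have "\<dots> \<le> liminf (\<lambda>i. \<integral>\<^sup>+x. ennreal ((f n x - f (r i) x)\<^sup>2) \<partial>M)"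
        by (rule nn_integral_liminf) measurable
      also have "\<dots> \<le> ennreal e"
      proof (rule Liminf_le)
        show "\<forall>\<^sub>F i in sequentially. (\<integral>\<^sup>+x. ennreal ((f n x - f (r i) x)\<^sup>2) \<partial>M) \<le> ennreal e"
          using eventually_ge_at_top[of N]
        proof eventually_elim
          case (elim i)
          then have "N \<le> r i" using r by (meson le_trans seq_suble)
          have "(\<integral>\<^sup>+x. ennreal ((f n x - f (r i) x)\<^sup>2) \<partial>M) = ennreal (LINT x|M. (f n x - f (r i) x)\<^sup>2)"
            using square_integrable_diff[OF f[of n] f[of "r i"]] by (intro nn_integral_eq_integral) auto
          also have "\<dots> \<le> ennreal e"
            using N[OF \<open>n \<ge> N\<close> \<open>N \<le> r i\<close>] by (intro ennreal_leI) simp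
          finally show ?case .
        qed
      qed simp
      finally show ?thesis .
    qed
    then show ?thesis by blast
  qed
  obtain N where "\<And>n. n \<ge> N \<Longrightarrow> (\<integral>\<^sup>+x. ennreal ((f n x - f' x)\<^sup>2) \<partial>M) \<le> ennreal 1"
    using bound[of 1] by auto
  then have "(\<integral>\<^sup>+x. ennreal ((f N x - f' x)\<^sup>2) \<partial>M) < \<infinity>"
    by (metis ennreal_less_top infinity_ennreal_def le_less_trans order_refl)
  then have "square_integrable M (\<lambda>x. f N x - f' x)"
    unfolding square_integrable_def by (auto intro!: integrableI_nonneg)
  from square_integrable_diff[OF f[of N] this] show f'_int: "square_integrable M f'" by simp
  show "(\<lambda>n. LINT x|M. (f n x - f' x)\<^sup>2) \<longlonglongrightarrow> 0"
  proof (rule LIMSEQ_I)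
    fix e :: real assume "0 < e"
    then obtain N where N: "\<And>n. n \<ge> N \<Longrightarrow> (\<integral>\<^sup>+x. ennreal ((f n x - f' x)\<^sup>2) \<partial>M) \<le> ennreal (e / 2)"
      using bound[of "e / 2"] by auto
    have "(LINT x|M. (f n x - f' x)\<^sup>2) < e" if "n \<ge> N" for n
    proof -
      have "ennreal (LINT x|M. (f n x - f' x)\<^sup>2) \<le> ennreal (e / 2)"
        using N[OF that] square_integrable_diff[OF f[of n] f'_int]
        by (subst nn_integral_eq_integral[symmetric]) auto
      then show ?thesis using \<open>0 < e\<close> by simp
    qed
    then show "\<exists>N. \<forall>n\<ge>N. norm ((LINT x|M. (f n x - f' x)\<^sup>2) - 0) < e" by auto
  qed
qed

lemma square_integrable_limit_subseq:
  assumes f: "\<And>n. square_integrable M (f n)" and f': "square_integrable M f'"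
    and lim: "(\<lambda>n. LINT x|M. (f n x - f' x)\<^sup>2) \<longlonglongrightarrow> 0"
  obtains r where "strict_mono r" "AE x in M. (\<lambda>n. f (r n) x) \<longlonglongrightarrow> f' x"
proof -
  have "\<exists>r. strict_mono r \<and> (AE x in M. (\<lambda>n. (f (r n) x - f' x)\<^sup>2) \<longlonglongrightarrow> 0)"
    using square_integrable_diff[OF f f'] lim by (intro tendsto_L1_AE_subseq) auto
  then obtain r where r: "strict_mono r" "AE x in M. (\<lambda>n. (f (r n) x - f' x)\<^sup>2) \<longlonglongrightarrow> 0" by blast
  from r(2) have "AE x in M. (\<lambda>n. f (r n) x) \<longlonglongrightarrow> f' x"
  proof eventually_elim
    case (elim x)
    then have "(\<lambda>n. sqrt ((f (r n) x - f' x)\<^sup>2)) \<longlonglongrightarrow> sqrt 0" by (rule tendsto_real_sqrt)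
    then have "(\<lambda>n. f (r n) x - f' x) \<longlonglongrightarrow> 0" by (simp add: tendsto_rabs_zero_iff)
    then show ?case by (rule LIM_zero_cancel)
  qed
  with r(1) show ?thesis by (rule that)
qed

section \<open>Jump forms and their operators\<close>

text \<open>A representative of an element of L2(S) is controlled only on S. Cutting it off gives a
  Borel function on the whole space, so set integrals become plain integrals and
  \<open>square_integrable\<close> applies.\<close>

definition zero_ext :: "'a set \<Rightarrow> ('a \<Rightarrow> real) \<Rightarrow> 'a \<Rightarrow> real" where
  "zero_ext S u x = indicator S x * u x"

text \<open>The nonlocal gradient: the jump part of the form is half the L2(J) inner product of two
  such functions.\<close>

definition jump :: "'a set \<Rightarrow> ('a \<Rightarrow> real) \<Rightarrow> 'a \<times> 'a \<Rightarrow> real" where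
  "jump S u p = indicator (S \<times> S) p * (u (fst p) - u (snd p))"

lemma zero_ext_square: "(zero_ext S u x)\<^sup>2 = indicator S x * (u x)\<^sup>2"
  by (simp add: zero_ext_def indicator_def)

lemma L2_iff: "u \<in> L2 S \<longleftrightarrow> square_integrable lborel (zero_ext S u)"
proof -
  have "(\<lambda>x. indicator S x *\<^sub>R u x) = zero_ext S u"
    "(\<lambda>x. indicator S x *\<^sub>R (u x)\<^sup>2) = (\<lambda>x. (zero_ext S u x)\<^sup>2)"
    by (auto simp: zero_ext_square) (simp add: zero_ext_def fun_eq_iff)
  then show ?thesis
    by (simp add: L2_def square_integrable_def set_borel_measurable_def set_integrable_def)
qed

lemma L2_inner_zero_ext: "L2_inner S u v = (LINT x|lborel. zero_ext S u x * zero_ext S v x)"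
  unfolding L2_inner_def set_lebesgue_integral_def
  by (intro Bochner_Integration.integral_cong) (auto simp: zero_ext_def indicator_def)

lemma L2_norm_zero_ext: "L2_norm S u = sqrt (LINT x|lborel. (zero_ext S u x)\<^sup>2)"
  by (simp add: L2_norm_def L2_inner_zero_ext power2_eq_square)

lemma square_integrable_lborelD: "square_integrable lborel f \<Longrightarrow> f \<in> borel_measurable borel"
  by (simp add: square_integrable_def)

lemma zero_ext_diff: "zero_ext S (\<lambda>x. u x - v x) x = zero_ext S u x - zero_ext S v x"
  by (simp add: zero_ext_def algebra_simps)

lemma zero_ext_mult: "zero_ext S (\<lambda>x. u x * v x) x = zero_ext S u x * zero_ext S v x"
  by (simp add: zero_ext_def indicator_def)

lemma jump_diff: "jump S (\<lambda>x. u x - v x) p = jump S u p - jump S v p"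
  by (simp add: jump_def algebra_simps)

lemma jump_zero_ext: "jump S u p = indicator (S \<times> S) p * (zero_ext S u (fst p) - zero_ext S u (snd p))"
  by (auto simp: jump_def zero_ext_def indicator_def mem_Times_iff)

lemma borel_measurable_jump:
  fixes S :: "'a::euclidean_space set"
  assumes S: "S \<in> sets borel" and u: "zero_ext S u \<in> borel_measurable borel"
  shows "jump S u \<in> borel_measurable borel"
proof -
  have "S \<times> S \<in> sets (borel \<Otimes>\<^sub>M borel)" using S by simp
  then have "(\<lambda>p. indicator (S \<times> S) p * (zero_ext S u (fst p) - zero_ext S u (snd p))) \<in>
      borel_measurable (borel \<Otimes>\<^sub>M borel)"
    using u by measurable
  then show ?thesis by (simp add: borel_prod jump_zero_ext[abs_def])
qed

lemma borel_measurable_zero_ext_continuous: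
  "open S \<Longrightarrow> continuous_on S f \<Longrightarrow> zero_ext S f \<in> borel_measurable borel"
  using borel_measurable_continuous_on_indicator[of S f]
  by (simp add: zero_ext_def[abs_def] borel_open)

lemma abs_exp_diff_le:
  fixes a b :: real
  assumes "a \<le> M" "b \<le> M"
  shows "\<bar>exp a - exp b\<bar> \<le> exp M * \<bar>a - b\<bar>"
proof -
  have le: "exp a - exp b \<le> exp M * (a - b)" if "b \<le> a" "a \<le> M" for a b :: real
  proof -
    have "1 - exp (b - a) \<le> a - b" using exp_ge_add_one_self[of "b - a"] by linarith
    then have "exp a * (1 - exp (b - a)) \<le> exp a * (a - b)" by (intro mult_left_mono) auto
    also have "\<dots> \<le> exp M * (a - b)" using that by (intro mult_right_mono) auto
    finally show ?thesis by (simp add: algebra_simps flip: exp_add)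
  qed
  show ?thesis using le[of a b] le[of b a] assms by (cases "b \<le> a") auto
qed

lemma lipschitz_on_exp:
  fixes f :: "'b::metric_space \<Rightarrow> real"
  assumes f: "L-lipschitz_on S f" and M: "\<And>x. x \<in> S \<Longrightarrow> f x \<le> M"
  shows "(exp M * L)-lipschitz_on S (\<lambda>x. exp (f x))"
proof (rule lipschitz_onI)
  fix x y assume xy: "x \<in> S" "y \<in> S"
  have "dist (exp (f x)) (exp (f y)) \<le> exp M * dist (f x) (f y)"
    using abs_exp_diff_le[of "f x" M "f y"] M xy by (simp add: dist_real_def)
  also have "\<dots> \<le> exp M * (L * dist x y)"
    using lipschitz_onD[OF f xy] by (intro mult_left_mono) auto
  finally show "dist (exp (f x)) (exp (f y)) \<le> exp M * L * dist x y" by (simp add: mult.assoc)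
qed (use lipschitz_on_nonneg[OF f] in simp)

section \<open>The Neumann form and the Dirichlet form as one bilinear expression\<close>

locale jump_form = reversible_kernel \<epsilon> k C
  for \<epsilon> :: real and k :: "'a::euclidean_space \<Rightarrow> 'a measure" and C :: real +
  fixes W :: "'a \<Rightarrow> real" and S :: "'a set"
  assumes open_S: "open S" and bounded_S: "bounded S"
    and W_cont: "continuous_on UNIV W" and W_nonneg: "\<And>x. 0 \<le> W x"
begin

abbreviation N where "N \<equiv> fst (neumann_form \<epsilon> k W S)"

text \<open>The square root makes the potential term an L2 inner product, to which the convergence
  lemmas for products apply.\<close>

definition weighted_ext :: "('a \<Rightarrow> real) \<Rightarrow> 'a \<Rightarrow> real" where
  "weighted_ext u x = sqrt (W x) * zero_ext S u x"

definition Q :: "('a \<Rightarrow> real) \<Rightarrow> ('a \<Rightarrow> real) \<Rightarrow> real" where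
  "Q u v = 1/2 * (LINT p|J. jump S u p * jump S v p) + (LINT x|lborel. weighted_ext u x * weighted_ext v x)"

lemma S_borel: "S \<in> sets borel"
  using open_S by simp

lemma W_bound: obtains M where "0 < M" "\<And>x. x \<in> S \<Longrightarrow> W x \<le> M"
proof -
  have "compact (W ` closure S)"
    using bounded_S W_cont by (intro compact_continuous_image) (auto intro: continuous_on_subset)
  then obtain M where "\<And>y. y \<in> W ` closure S \<Longrightarrow> norm y \<le> M"
    using compact_imp_bounded bounded_iff by metis
  then have "W x \<le> \<bar>M\<bar> + 1" if "x \<in> S" for x
    using that closure_subset[of S] by fastforce
  then show ?thesis by (intro that[of "\<bar>M\<bar> + 1"]) auto
qed

lemma weighted_ext_diff: "weighted_ext (\<lambda>x. u x - v x) x = weighted_ext u x - weighted_ext v x"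
  by (simp add: weighted_ext_def zero_ext_diff algebra_simps)

lemma square_integrable_weighted_ext:
  assumes "square_integrable lborel (zero_ext S u)"
  shows "square_integrable lborel (weighted_ext u)"
proof -
  obtain M where M: "0 < M" "\<And>x. x \<in> S \<Longrightarrow> W x \<le> M" using W_bound by blast
  show ?thesis
  proof (rule square_integrable_dominated[OF square_integrable_cmult[OF assms, of "sqrt M"]])
    have "W \<in> borel_measurable borel" using W_cont by (rule borel_measurable_continuous_onI)
    then show "weighted_ext u \<in> borel_measurable lborel"
      using square_integrable_lborelD[OF assms] unfolding weighted_ext_def[abs_def]
      by (simp add: borel_measurable_times)
    show "\<bar>weighted_ext u x\<bar> \<le> \<bar>sqrt M * zero_ext S u x\<bar>" for x
      using M W_nonneg[of x] by (auto simp: weighted_ext_def zero_ext_def abs_mult indicator_def intro!: mult_right_mono)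
  qed
qed

lemma weighted_ext_tendsto:
  assumes u: "\<And>n. square_integrable lborel (zero_ext S (u n))" "square_integrable lborel (zero_ext S u')"
    and lim: "(\<lambda>n. LINT x|lborel. (zero_ext S (u n) x - zero_ext S u' x)\<^sup>2) \<longlonglongrightarrow> 0"
  shows "(\<lambda>n. LINT x|lborel. (weighted_ext (u n) x - weighted_ext u' x)\<^sup>2) \<longlonglongrightarrow> 0"
proof -
  obtain M where M: "0 < M" "\<And>x. x \<in> S \<Longrightarrow> W x \<le> M" using W_bound by blast
  have "(LINT x|lborel. (weighted_ext (u n) x - weighted_ext u' x)\<^sup>2) \<le> M * (LINT x|lborel. (zero_ext S (u n) x - zero_ext S u' x)\<^sup>2)" for n
  proof -
    have "(LINT x|lborel. (weighted_ext (u n) x - weighted_ext u' x)\<^sup>2) \<le> (LINT x|lborel. M * (zero_ext S (u n) x - zero_ext S u' x)\<^sup>2)"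
    proof (rule integral_mono)
      show "integrable lborel (\<lambda>x. (weighted_ext (u n) x - weighted_ext u' x)\<^sup>2)"
        by (intro square_integrable_integrable square_integrable_diff square_integrable_weighted_ext u)
      show "integrable lborel (\<lambda>x. M * (zero_ext S (u n) x - zero_ext S u' x)\<^sup>2)"
        by (intro integrable_mult_right square_integrable_integrable square_integrable_diff u)
      fix x
      have "(weighted_ext (u n) x - weighted_ext u' x)\<^sup>2 = W x * (zero_ext S (u n) x - zero_ext S u' x)\<^sup>2"
        using W_nonneg[of x] by (simp add: weighted_ext_def power_mult_distrib flip: right_diff_distrib)
      also have "\<dots> \<le> M * (zero_ext S (u n) x - zero_ext S u' x)\<^sup>2"
        using M by (cases "x \<in> S") (auto simp: zero_ext_def intro!: mult_right_mono)
      finally show "(weighted_ext (u n) x - weighted_ext u' x)\<^sup>2 \<le> M * (zero_ext S (u n) x - zero_ext S u' x)\<^sup>2" .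
    qed
    then show ?thesis by simp
  qed
  then have "norm (LINT x|lborel. (weighted_ext (u n) x - weighted_ext u' x)\<^sup>2) \<le> M * (LINT x|lborel. (zero_ext S (u n) x - zero_ext S u' x)\<^sup>2)" for n
    by simp
  then show ?thesis
    by (rule Lim_null_comparison[OF always_eventually[OF allI]]) (rule tendsto_mult_right_zero[OF lim])
qed

lemma energy_eq:
  assumes u: "zero_ext S u \<in> borel_measurable borel"
  shows "energy \<epsilon> k W S u = ennreal (1/2) * (\<integral>\<^sup>+p. ennreal ((jump S u p)\<^sup>2) \<partial>J)
     + (\<integral>\<^sup>+x. ennreal ((weighted_ext u x)\<^sup>2) \<partial>lborel)"
proof -
  have [measurable]: "jump S u \<in> borel_measurable borel"
    by (rule borel_measurable_jump[OF S_borel u])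
  have "(\<integral>\<^sup>+\<gamma>\<in>jump_set \<epsilon> S x. ennreal ((u x - u (x + \<epsilon> *\<^sub>R \<gamma>))\<^sup>2) \<partial>k x) * indicator S x =
      (\<integral>\<^sup>+\<gamma>. ennreal ((jump S u (x, x + \<epsilon> *\<^sub>R \<gamma>))\<^sup>2) \<partial>k x)" for x
    by (cases "x \<in> S")
      (auto intro!: nn_integral_cong simp: jump_def jump_set_def indicator_def space_k)
  moreover have "ennreal (W x * (u x)\<^sup>2) * indicator S x = ennreal ((weighted_ext u x)\<^sup>2)" for x
    using W_nonneg[of x] by (auto simp: weighted_ext_def zero_ext_def indicator_def power_mult_distrib)
  ultimately show ?thesis by (simp add: energy_def nn_integral_J)
qed

text \<open>The potential is continuous and S is bounded, so every L2 function has finite potential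
  energy and only the jump part restricts the domain.\<close>

lemma N_iff: "u \<in> N \<longleftrightarrow> square_integrable lborel (zero_ext S u) \<and> square_integrable J (jump S u)"
proof -
  have "energy \<epsilon> k W S u < \<infinity> \<longleftrightarrow> square_integrable J (jump S u)" if u: "square_integrable lborel (zero_ext S u)"
  proof -
    have m: "zero_ext S u \<in> borel_measurable borel" using u by (auto simp: square_integrable_def)
    have "jump S u \<in> borel_measurable J"
      unfolding measurable_J by (rule borel_measurable_jump[OF S_borel m])
    moreover have "(\<integral>\<^sup>+x. ennreal ((weighted_ext u x)\<^sup>2) \<partial>lborel) < \<infinity>"
      using square_integrable_weighted_ext[OF u] by (auto simp: square_integrable_def integrable_iff_bounded)
    moreover have "ennreal (1/2) * I < \<infinity> \<longleftrightarrow> I < \<infinity>" for I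
      using ennreal_less_top[of "1/2"] by (auto simp: ennreal_mult_less_top simp del: ennreal_less_top)
    ultimately show ?thesis
      unfolding energy_eq[OF m] square_integrable_def by (auto simp: integrable_iff_bounded)
  qed
  then show ?thesis by (auto simp: neumann_form_def L2_iff)
qed

lemma neumann_form_eq:
  assumes u: "u \<in> N" and v: "v \<in> N"
  shows "snd (neumann_form \<epsilon> k W S) u v = Q u v"
proof -
  have "(LINT x:S|lborel. (LINT \<gamma>:jump_set \<epsilon> S x|k x.
          (u x - u (x + \<epsilon> *\<^sub>R \<gamma>)) * (v x - v (x + \<epsilon> *\<^sub>R \<gamma>)))) =
      (LINT x|lborel. (LINT \<gamma>|k x. jump S u (x, x + \<epsilon> *\<^sub>R \<gamma>) * jump S v (x, x + \<epsilon> *\<^sub>R \<gamma>)))"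
    unfolding set_lebesgue_integral_def
  proof (rule Bochner_Integration.integral_cong[OF refl])
    fix x
    show "indicator S x *\<^sub>R (LINT \<gamma>|k x. indicator (jump_set \<epsilon> S x) \<gamma> *\<^sub>R
          ((u x - u (x + \<epsilon> *\<^sub>R \<gamma>)) * (v x - v (x + \<epsilon> *\<^sub>R \<gamma>)))) =
        (LINT \<gamma>|k x. jump S u (x, x + \<epsilon> *\<^sub>R \<gamma>) * jump S v (x, x + \<epsilon> *\<^sub>R \<gamma>))"
      by (cases "x \<in> S")
        (auto intro!: Bochner_Integration.integral_cong simp: jump_def jump_set_def indicator_def space_k)
  qed
  also have "\<dots> = (LINT p|J. jump S u p * jump S v p)"
    using u v by (intro integral_J square_integrable_mult) (auto simp: N_iff)
  finally have 1: "(LINT x:S|lborel. (LINT \<gamma>:jump_set \<epsilon> S x|k x.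
          (u x - u (x + \<epsilon> *\<^sub>R \<gamma>)) * (v x - v (x + \<epsilon> *\<^sub>R \<gamma>)))) = (LINT p|J. jump S u p * jump S v p)" .
  have 2: "(LINT x:S|lborel. W x * u x * v x) = (LINT x|lborel. weighted_ext u x * weighted_ext v x)"
    unfolding set_lebesgue_integral_def
    using W_nonneg by (intro Bochner_Integration.integral_cong) (auto simp: weighted_ext_def zero_ext_def indicator_def)
  show ?thesis by (simp add: neumann_form_def Q_def 1 2)
qed

lemma N_diff: "u \<in> N \<Longrightarrow> v \<in> N \<Longrightarrow> (\<lambda>x. u x - v x) \<in> N"
  by (auto simp: N_iff zero_ext_diff[abs_def] jump_diff[abs_def] intro!: square_integrable_diff)

lemma Q_tendsto:
  assumes "\<And>n. u n \<in> N" "u' \<in> N" "\<And>n. v n \<in> N" "v' \<in> N"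
    and "(\<lambda>n. LINT x|lborel. (zero_ext S (u n) x - zero_ext S u' x)\<^sup>2) \<longlonglongrightarrow> 0"
    and "(\<lambda>n. LINT x|lborel. (zero_ext S (v n) x - zero_ext S v' x)\<^sup>2) \<longlonglongrightarrow> 0"
    and "(\<lambda>n. LINT p|J. (jump S (u n) p - jump S u' p)\<^sup>2) \<longlonglongrightarrow> 0"
    and "(\<lambda>n. LINT p|J. (jump S (v n) p - jump S v' p)\<^sup>2) \<longlonglongrightarrow> 0"
  shows "(\<lambda>n. Q (u n) (v n)) \<longlonglongrightarrow> Q u' v'"
  unfolding Q_def
  by (intro tendsto_add tendsto_mult tendsto_const tendsto_integral_mult weighted_ext_tendsto square_integrable_weighted_ext)
    (use assms in \<open>auto simp: N_iff\<close>)

text \<open>Closability. A subsequence converges almost everywhere; because both marginals of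
  \<open>J\<close> ignore null sets, its jumps converge \<open>J\<close>-almost everywhere to the
  jump of u, and the Cauchy property in L2(J) upgrades this to norm convergence. With D =
  \<open>C0_infty S\<close> it places the Dirichlet domain inside the Neumann domain.\<close>

lemma form_approx_limit:
  assumes w: "form_approx S (form_restrict (neumann_form \<epsilon> k W S) D) u w" and u: "u \<in> L2 S"
  shows "w n \<in> N" "w n \<in> D" "u \<in> N"
    "(\<lambda>n. LINT x|lborel. (zero_ext S (w n) x - zero_ext S u x)\<^sup>2) \<longlonglongrightarrow> 0"
    "(\<lambda>n. LINT p|J. (jump S (w n) p - jump S u p)\<^sup>2) \<longlonglongrightarrow> 0"
proof -
  have wN: "w n \<in> N" and "w n \<in> D" for n
    using w by (auto simp: form_approx_def form_restrict_def)
  then show "w n \<in> N" "w n \<in> D" by auto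
  have wL: "square_integrable lborel (zero_ext S (w n))" "square_integrable J (jump S (w n))" for n
    using wN by (auto simp: N_iff)
  have uL: "square_integrable lborel (zero_ext S u)" using u by (simp add: L2_iff)
  have "(\<lambda>n. (L2_norm S (\<lambda>x. w n x - u x))\<^sup>2) \<longlonglongrightarrow> 0\<^sup>2"
    using w by (intro tendsto_power) (auto simp: form_approx_def)
  then show lim: "(\<lambda>n. LINT x|lborel. (zero_ext S (w n) x - zero_ext S u x)\<^sup>2) \<longlonglongrightarrow> 0"
    by (simp add: L2_norm_zero_ext zero_ext_diff)
  obtain r where r: "strict_mono r" "AE x in lborel. (\<lambda>n. zero_ext S (w (r n)) x) \<longlonglongrightarrow> zero_ext S u x"
    using square_integrable_limit_subseq[OF wL(1) uL lim] by blast
  have cauchy: "\<exists>M. \<forall>m\<ge>M. \<forall>n\<ge>M. (LINT p|J. (jump S (w m) p - jump S (w n) p)\<^sup>2) < e" if "0 < e" for e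
  proof -
    obtain M where M: "\<And>m n. m \<ge> M \<Longrightarrow> n \<ge> M \<Longrightarrow>
        snd (neumann_form \<epsilon> k W S) (\<lambda>x. w m x - w n x) (\<lambda>x. w m x - w n x) < e / 2"
      using w half_gt_zero[OF \<open>0 < e\<close>] unfolding form_approx_def form_restrict_def snd_conv by metis
    have "(LINT p|J. (jump S (w m) p - jump S (w n) p)\<^sup>2) < e" if "m \<ge> M" "n \<ge> M" for m n
    proof -
      have "Q (\<lambda>x. w m x - w n x) (\<lambda>x. w m x - w n x) < e / 2"
        using M[OF that] N_diff[OF wN wN] by (simp add: neumann_form_eq)
      moreover have "0 \<le> (LINT x|lborel. weighted_ext (\<lambda>x. w m x - w n x) x * weighted_ext (\<lambda>x. w m x - w n x) x)"
        by (intro Bochner_Integration.integral_nonneg) simp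
      ultimately show ?thesis unfolding Q_def jump_diff power2_eq_square by linarith
    qed
    then show ?thesis by blast
  qed
  have "AE p in J. (\<lambda>n. jump S (w (r n)) p) \<longlonglongrightarrow> jump S u p"
    using AE_J_fst[OF r(2)] AE_J_snd[OF r(2)]
    by eventually_elim (auto simp: jump_zero_ext intro!: tendsto_intros)
  moreover have "jump S u \<in> borel_measurable J"
    unfolding measurable_J using uL by (intro borel_measurable_jump S_borel square_integrable_lborelD)
  ultimately have "square_integrable J (jump S u)"
    "(\<lambda>n. LINT p|J. (jump S (w n) p - jump S u p)\<^sup>2) \<longlonglongrightarrow> 0"
    using square_integrable_Cauchy_limit[OF wL(2) _ r(1) _ cauchy] by blast+
  then show "u \<in> N" "(\<lambda>n. LINT p|J. (jump S (w n) p - jump S u p)\<^sup>2) \<longlonglongrightarrow> 0"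
    using uL by (auto simp: N_iff)
qed

lemma dirichlet_domain_subset: "u \<in> fst (dirichlet_form \<epsilon> k W S) \<Longrightarrow> u \<in> N"
  by (auto simp: dirichlet_form_def form_closure_def intro: form_approx_limit(3))

text \<open>The value of the closure is a definite description over all pairs of approximating
  sequences. Convergence of \<open>Q\<close> along each pair gives existence; that some pair exists
  gives uniqueness.\<close>

lemma dirichlet_form_eq:
  assumes u: "u \<in> fst (dirichlet_form \<epsilon> k W S)" and v: "v \<in> fst (dirichlet_form \<epsilon> k W S)"
  shows "snd (dirichlet_form \<epsilon> k W S) u v = Q u v"
proof -
  let ?F = "form_restrict (neumann_form \<epsilon> k W S) (C0_infty S)"
  have L: "u \<in> L2 S" "v \<in> L2 S" using u v by (auto simp: dirichlet_form_def form_closure_def)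
  obtain w\<^sub>0 w\<^sub>0' where w0: "form_approx S ?F u w\<^sub>0" "form_approx S ?F v w\<^sub>0'"
    using u v by (auto simp: dirichlet_form_def form_closure_def)
  have lim: "(\<lambda>n. snd ?F (w n) (w' n)) \<longlonglongrightarrow> Q u v" if w: "form_approx S ?F u w" "form_approx S ?F v w'" for w w'
  proof -
    note a = form_approx_limit[OF w(1) L(1)] and b = form_approx_limit[OF w(2) L(2)]
    have "(\<lambda>n. Q (w n) (w' n)) \<longlonglongrightarrow> Q u v"
      by (rule Q_tendsto[OF a(1,3) b(1,3) a(4) b(4) a(5) b(5)])
    moreover have "snd ?F (w n) (w' n) = Q (w n) (w' n)" for n
      using a(1) b(1) by (simp add: form_restrict_def neumann_form_eq)
    ultimately show ?thesis by simp
  qed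
  have "(THE l. \<forall>w w'. form_approx S ?F u w \<and> form_approx S ?F v w' \<longrightarrow>
                (\<lambda>n. snd ?F (w n) (w' n)) \<longlonglongrightarrow> l) = Q u v"
  proof (rule the_equality)
    fix l assume "\<forall>w w'. form_approx S ?F u w \<and> form_approx S ?F v w' \<longrightarrow> (\<lambda>n. snd ?F (w n) (w' n)) \<longlonglongrightarrow> l"
    then have "(\<lambda>n. snd ?F (w\<^sub>0 n) (w\<^sub>0' n)) \<longlonglongrightarrow> l" using w0 by blast
    then show "l = Q u v" using lim[OF w0] by (rule LIMSEQ_unique)
  qed (use lim in blast)
  then show ?thesis by (simp add: dirichlet_form_def form_closure_def)
qed

section \<open>Multiplication by Lipschitz functions in the form domains\<close>

definition step :: "('a \<Rightarrow> real) \<Rightarrow> 'a \<times> 'a \<Rightarrow> real" where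
  "step u p = indicator (S \<times> S) p * norm (fst p - snd p) * zero_ext S u (fst p)"

lemma nn_integral_step_le:
  fixes f :: "'a \<Rightarrow> ennreal"
  assumes "f \<in> borel_measurable borel"
  shows "(\<integral>\<^sup>+p. ennreal ((norm (fst p - snd p))\<^sup>2) * f (fst p) \<partial>J) \<le> ennreal (\<epsilon>\<^sup>2 * C) * (\<integral>\<^sup>+x. f x \<partial>lborel)"
proof -
  have "(\<lambda>p. ennreal ((norm (fst p - snd p :: 'a))\<^sup>2) * f (fst p)) \<in> borel_measurable borel"
    unfolding borel_prod[symmetric] using assms by measurable
  then have "(\<integral>\<^sup>+p. ennreal ((norm (fst p - snd p))\<^sup>2) * f (fst p) \<partial>J) =
      (\<integral>\<^sup>+x. (\<integral>\<^sup>+\<gamma>. (ennreal (\<epsilon>\<^sup>2) * f x) * ennreal ((norm \<gamma>)\<^sup>2) \<partial>k x) \<partial>lborel)"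
    using eps by (simp add: nn_integral_J power_mult_distrib ennreal_mult mult_ac)
  also have "\<dots> = (\<integral>\<^sup>+x. (ennreal (\<epsilon>\<^sup>2) * f x) * (\<integral>\<^sup>+\<gamma>. ennreal ((norm \<gamma>)\<^sup>2) \<partial>k x) \<partial>lborel)"
    by (intro nn_integral_cong nn_integral_cmult measurable_k) measurable
  also have "\<dots> \<le> (\<integral>\<^sup>+x. (ennreal (\<epsilon>\<^sup>2) * f x) * ennreal C \<partial>lborel)"
    by (intro nn_integral_mono mult_left_mono second_moment) simp
  also have "\<dots> = (\<integral>\<^sup>+x. ennreal (\<epsilon>\<^sup>2 * C) * f x \<partial>lborel)"
    using C_pos by (simp add: ennreal_mult mult_ac)
  also have "\<dots> = ennreal (\<epsilon>\<^sup>2 * C) * (\<integral>\<^sup>+x. f x \<partial>lborel)"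
    using assms by (intro nn_integral_cmult) simp
  finally show ?thesis .
qed

lemma square_integrable_step:
  assumes u: "square_integrable lborel (zero_ext S u)"
  shows "square_integrable J (step u)"
    and "(LINT p|J. (step u p)\<^sup>2) \<le> \<epsilon>\<^sup>2 * C * (LINT x|lborel. (zero_ext S u x)\<^sup>2)"
proof -
  have m: "zero_ext S u \<in> borel_measurable borel" using u by (auto simp: square_integrable_def)
  have "S \<times> S \<in> sets (borel \<Otimes>\<^sub>M borel)" using S_borel by simp
  then have "step u \<in> borel_measurable (borel \<Otimes>\<^sub>M borel)"
    unfolding step_def[abs_def] using m by measurable
  then have ms: "step u \<in> borel_measurable J" by (simp add: measurable_J borel_prod)
  have "(\<integral>\<^sup>+p. ennreal ((step u p)\<^sup>2) \<partial>J) \<le> (\<integral>\<^sup>+p. ennreal ((norm (fst p - snd p))\<^sup>2) * ennreal ((zero_ext S u (fst p))\<^sup>2) \<partial>J)"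
    by (intro nn_integral_mono) (auto simp: step_def indicator_def power_mult_distrib ennreal_mult)
  also have "\<dots> \<le> ennreal (\<epsilon>\<^sup>2 * C) * (\<integral>\<^sup>+x. ennreal ((zero_ext S u x)\<^sup>2) \<partial>lborel)"
    using m by (intro nn_integral_step_le) measurable
  also have "(\<integral>\<^sup>+x. ennreal ((zero_ext S u x)\<^sup>2) \<partial>lborel) = ennreal (LINT x|lborel. (zero_ext S u x)\<^sup>2)"
    using u by (intro nn_integral_eq_integral) auto
  finally have le: "(\<integral>\<^sup>+p. ennreal ((step u p)\<^sup>2) \<partial>J) \<le> ennreal (\<epsilon>\<^sup>2 * C * (LINT x|lborel. (zero_ext S u x)\<^sup>2))"
    using C_pos by (simp add: ennreal_mult)
  then have "(\<integral>\<^sup>+p. ennreal ((step u p)\<^sup>2) \<partial>J) < \<infinity>"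
    by (metis ennreal_less_top infinity_ennreal_def le_less_trans)
  then show *: "square_integrable J (step u)"
    using ms unfolding square_integrable_def by (auto intro!: integrableI_nonneg)
  have "ennreal (LINT p|J. (step u p)\<^sup>2) \<le> ennreal (\<epsilon>\<^sup>2 * C * (LINT x|lborel. (zero_ext S u x)\<^sup>2))"
    using le * by (subst nn_integral_eq_integral[symmetric]) auto
  then show "(LINT p|J. (step u p)\<^sup>2) \<le> \<epsilon>\<^sup>2 * C * (LINT x|lborel. (zero_ext S u x)\<^sup>2)"
    using C_pos by (subst (asm) ennreal_le_iff) (auto intro!: mult_nonneg_nonneg Bochner_Integration.integral_nonneg)
qed

text \<open>The discrete product rule m x u x - m y u y = m y (u x - u y) + (m x - m y) u x. The
  second term is controlled by \<open>step\<close>, whose L2(J) norm is bounded by the second moment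
  of the kernel.\<close>

lemma jump_mult_le:
  assumes m: "L-lipschitz_on S m" "\<And>x. x \<in> S \<Longrightarrow> \<bar>m x\<bar> \<le> M"
  shows "\<bar>jump S (\<lambda>x. m x * u x) p\<bar> \<le> M * \<bar>jump S u p\<bar> + L * \<bar>step u p\<bar>"
proof (cases "p \<in> S \<times> S")
  case True
  then obtain x y where p: "p = (x, y)" "x \<in> S" "y \<in> S" by auto
  have "m x * u x - m y * u y = m y * (u x - u y) + (m x - m y) * u x" by (simp add: algebra_simps)
  then have "\<bar>m x * u x - m y * u y\<bar> \<le> \<bar>m y\<bar> * \<bar>u x - u y\<bar> + \<bar>m x - m y\<bar> * \<bar>u x\<bar>"
    by (metis abs_mult abs_triangle_ineq)
  also have "\<dots> \<le> M * \<bar>u x - u y\<bar> + (L * norm (x - y)) * \<bar>u x\<bar>"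
    using m(2)[OF p(3)] lipschitz_onD[OF m(1) p(2,3)]
    by (intro add_mono mult_right_mono) (auto simp: dist_real_def dist_norm)
  finally show ?thesis using p by (simp add: jump_def step_def zero_ext_def abs_mult)
qed (simp add: jump_def step_def)

text \<open>The bounds are quantitative because they are later applied to differences w n - u, where
  they say that multiplication is continuous in the form norm.\<close>

lemma mult_N:
  assumes m: "L-lipschitz_on S m" "\<And>x. x \<in> S \<Longrightarrow> \<bar>m x\<bar> \<le> M" and u: "u \<in> N"
  shows "(\<lambda>x. m x * u x) \<in> N"
    and "(LINT p|J. (jump S (\<lambda>x. m x * u x) p)\<^sup>2) \<le>
      2 * M\<^sup>2 * (LINT p|J. (jump S u p)\<^sup>2) + 2 * L\<^sup>2 * (\<epsilon>\<^sup>2 * C * (LINT x|lborel. (zero_ext S u x)\<^sup>2))"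
    and "(LINT x|lborel. (zero_ext S (\<lambda>x. m x * u x) x)\<^sup>2) \<le> M\<^sup>2 * (LINT x|lborel. (zero_ext S u x)\<^sup>2)"
proof -
  have uL: "square_integrable lborel (zero_ext S u)" "square_integrable J (jump S u)"
    using u by (auto simp: N_iff)
  have "zero_ext S m \<in> borel_measurable borel"
    using lipschitz_on_continuous_on[OF m(1)] open_S by (intro borel_measurable_zero_ext_continuous)
  then have mm: "zero_ext S (\<lambda>x. m x * u x) \<in> borel_measurable borel"
    using square_integrable_lborelD[OF uL(1)] unfolding zero_ext_mult[abs_def] by measurable
  have le: "\<bar>zero_ext S (\<lambda>x. m x * u x) x\<bar> \<le> \<bar>M * zero_ext S u x\<bar>" for x
    using m(2)[of x] by (auto simp: zero_ext_def indicator_def abs_mult intro!: mult_right_mono)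
  have 1: "square_integrable lborel (zero_ext S (\<lambda>x. m x * u x))"
    by (rule square_integrable_dominated[OF square_integrable_cmult[OF uL(1)] _ le]) (use mm in simp)
  have st: "square_integrable J (step u)" using uL by (intro square_integrable_step)
  let ?b = "\<lambda>p. M * \<bar>jump S u p\<bar> + L * \<bar>step u p\<bar>"
  have b: "square_integrable J (\<lambda>p. M * \<bar>jump S u p\<bar>)" "square_integrable J (\<lambda>p. L * \<bar>step u p\<bar>)"
    by (intro square_integrable_cmult square_integrable_abs uL st)+
  have le': "\<bar>jump S (\<lambda>x. m x * u x) p\<bar> \<le> \<bar>?b p\<bar>" for p
    using jump_mult_le[OF m, of u p] by linarith
  have 2: "square_integrable J (jump S (\<lambda>x. m x * u x))"
    by (rule square_integrable_dominated[OF square_integrable_add[OF b] _ le'])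
      (simp add: measurable_J borel_measurable_jump[OF S_borel mm])
  show "(\<lambda>x. m x * u x) \<in> N" using 1 2 by (simp add: N_iff)
  have "(LINT p|J. (jump S (\<lambda>x. m x * u x) p)\<^sup>2) \<le> (LINT p|J. (?b p)\<^sup>2)"
    using square_integrable_add[OF b] 2 le' by (intro integral_mono) (auto simp: abs_le_square_iff)
  also have "\<dots> \<le> 2 * (LINT p|J. (M * \<bar>jump S u p\<bar>)\<^sup>2) + 2 * (LINT p|J. (L * \<bar>step u p\<bar>)\<^sup>2)"
    by (rule integral_add_square_le[OF b])
  also have "\<dots> = 2 * M\<^sup>2 * (LINT p|J. (jump S u p)\<^sup>2) + 2 * L\<^sup>2 * (LINT p|J. (step u p)\<^sup>2)"
    by (simp add: power_mult_distrib)
  also have "\<dots> \<le> 2 * M\<^sup>2 * (LINT p|J. (jump S u p)\<^sup>2) + 2 * L\<^sup>2 * (\<epsilon>\<^sup>2 * C * (LINT x|lborel. (zero_ext S u x)\<^sup>2))"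
    by (intro add_left_mono mult_left_mono square_integrable_step uL) simp
  finally show "(LINT p|J. (jump S (\<lambda>x. m x * u x) p)\<^sup>2) \<le>
      2 * M\<^sup>2 * (LINT p|J. (jump S u p)\<^sup>2) + 2 * L\<^sup>2 * (\<epsilon>\<^sup>2 * C * (LINT x|lborel. (zero_ext S u x)\<^sup>2))" .
  have "(LINT x|lborel. (zero_ext S (\<lambda>x. m x * u x) x)\<^sup>2) \<le> (LINT x|lborel. (M * zero_ext S u x)\<^sup>2)"
    using 1 square_integrable_cmult[OF uL(1), of M] le
    by (intro integral_mono) (auto simp: abs_le_square_iff)
  then show "(LINT x|lborel. (zero_ext S (\<lambda>x. m x * u x) x)\<^sup>2) \<le> M\<^sup>2 * (LINT x|lborel. (zero_ext S u x)\<^sup>2)"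
    by (simp add: power_mult_distrib)
qed

text \<open>Pointwise convergence of the multipliers suffices once their Lipschitz constants and sup
  norms are uniform: with the other argument fixed, the product rule supplies an integrable majorant
  for dominated convergence.\<close>

lemma mult_tendsto:
  assumes p: "\<And>n. L-lipschitz_on S (p n)" "\<And>n x. x \<in> S \<Longrightarrow> \<bar>p n x\<bar> \<le> M"
    and lim: "\<And>x. x \<in> S \<Longrightarrow> (\<lambda>n. p n x) \<longlonglongrightarrow> m x"
    and f: "f \<in> N" and u: "u \<in> N" and g: "g \<in> L2 S"
  shows "(\<lambda>n. Q f (\<lambda>x. p n x * u x)) \<longlonglongrightarrow> Q f (\<lambda>x. m x * u x)"
    and "(\<lambda>n. L2_inner S g (\<lambda>x. p n x * u x)) \<longlonglongrightarrow> L2_inner S g (\<lambda>x. m x * u x)"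
proof -
  have uL: "square_integrable lborel (zero_ext S u)" "square_integrable J (jump S u)"
    using u by (auto simp: N_iff)
  have fL: "square_integrable lborel (zero_ext S f)" "square_integrable J (jump S f)"
    using f by (auto simp: N_iff)
  have pN: "(\<lambda>x. p n x * u x) \<in> N" for n using mult_N(1)[OF p u] .
  have pL: "square_integrable lborel (zero_ext S (\<lambda>x. p n x * u x))"
    "square_integrable J (jump S (\<lambda>x. p n x * u x))" for n using pN by (auto simp: N_iff)
  have cl: "(\<lambda>n. zero_ext S (\<lambda>x. p n x * u x) x) \<longlonglongrightarrow> zero_ext S (\<lambda>x. m x * u x) x" for x
    using lim[of x] by (cases "x \<in> S") (auto simp: zero_ext_def intro!: tendsto_intros)
  have jl: "(\<lambda>n. jump S (\<lambda>x. p n x * u x) q) \<longlonglongrightarrow> jump S (\<lambda>x. m x * u x) q" for q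
    unfolding jump_zero_ext by (intro tendsto_intros cl)
  have cm: "zero_ext S (\<lambda>x. m x * u x) \<in> borel_measurable lborel"
    by (rule borel_measurable_LIMSEQ_real[OF cl square_integrable_measurable[OF pL(1)]])
  have jm: "jump S (\<lambda>x. m x * u x) \<in> borel_measurable J"
    by (rule borel_measurable_LIMSEQ_real[OF jl square_integrable_measurable[OF pL(2)]])
  have ce: "\<bar>zero_ext S (\<lambda>x. p n x * u x) x\<bar> \<le> M * \<bar>zero_ext S u x\<bar>" for n x
    using p(2)[of x n] by (auto simp: zero_ext_def indicator_def abs_mult intro!: mult_right_mono)
  have L2_lim: "(\<lambda>n. LINT x|lborel. h x * zero_ext S (\<lambda>x. p n x * u x) x) \<longlonglongrightarrow> (LINT x|lborel. h x * zero_ext S (\<lambda>x. m x * u x) x)"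
    if h: "square_integrable lborel h" for h
  proof (rule integral_dominated_convergence[where w="\<lambda>x. \<bar>h x\<bar> * (M * \<bar>zero_ext S u x\<bar>)"])
    show "integrable lborel (\<lambda>x. \<bar>h x\<bar> * (M * \<bar>zero_ext S u x\<bar>))"
      by (intro square_integrable_mult square_integrable_cmult square_integrable_abs h uL)
    show "AE x in lborel. (\<lambda>n. h x * zero_ext S (\<lambda>x. p n x * u x) x) \<longlonglongrightarrow> h x * zero_ext S (\<lambda>x. m x * u x) x"
      by (intro AE_I2 tendsto_intros cl)
    show "AE x in lborel. norm (h x * zero_ext S (\<lambda>x. p n x * u x) x) \<le> \<bar>h x\<bar> * (M * \<bar>zero_ext S u x\<bar>)" for n
      using ce by (intro AE_I2) (auto simp: abs_mult intro!: mult_left_mono)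
    show "(\<lambda>x. h x * zero_ext S (\<lambda>x. m x * u x) x) \<in> borel_measurable lborel"
      by (intro borel_measurable_times square_integrable_measurable[OF h] cm)
    show "(\<lambda>x. h x * zero_ext S (\<lambda>x. p n x * u x) x) \<in> borel_measurable lborel" for n
      by (intro borel_measurable_times square_integrable_measurable[OF h] square_integrable_measurable[OF pL(1)])
  qed
  show "(\<lambda>n. L2_inner S g (\<lambda>x. p n x * u x)) \<longlonglongrightarrow> L2_inner S g (\<lambda>x. m x * u x)"
    unfolding L2_inner_zero_ext using g by (intro L2_lim) (simp add: L2_iff)
  have "square_integrable lborel (\<lambda>x. W x * zero_ext S f x)"
  proof -
    obtain B where B: "0 < B" "\<And>x. x \<in> S \<Longrightarrow> W x \<le> B" using W_bound by blast
    show ?thesis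
    proof (rule square_integrable_dominated[OF square_integrable_cmult[OF fL(1), of B]])
      have "W \<in> borel_measurable borel" using W_cont by (rule borel_measurable_continuous_onI)
      then show "(\<lambda>x. W x * zero_ext S f x) \<in> borel_measurable lborel"
        using square_integrable_lborelD[OF fL(1)] by (simp add: borel_measurable_times)
      show "\<bar>W x * zero_ext S f x\<bar> \<le> \<bar>B * zero_ext S f x\<bar>" for x
        using B W_nonneg[of x] by (auto simp: zero_ext_def abs_mult indicator_def intro!: mult_right_mono)
    qed
  qed
  from L2_lim[OF this] have wl: "(\<lambda>n. LINT x|lborel. weighted_ext f x * weighted_ext (\<lambda>x. p n x * u x) x) \<longlonglongrightarrow>
      (LINT x|lborel. weighted_ext f x * weighted_ext (\<lambda>x. m x * u x) x)"
  proof -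
    have "weighted_ext f x * weighted_ext v x = W x * zero_ext S f x * zero_ext S v x" for v x
      using W_nonneg[of x] by (simp add: weighted_ext_def mult_ac flip: real_sqrt_mult)
    then show ?thesis using L2_lim[OF \<open>square_integrable lborel (\<lambda>x. W x * zero_ext S f x)\<close>] by simp
  qed
  have "(\<lambda>n. LINT q|J. jump S f q * jump S (\<lambda>x. p n x * u x) q) \<longlonglongrightarrow> (LINT q|J. jump S f q * jump S (\<lambda>x. m x * u x) q)"
  proof (rule integral_dominated_convergence[where w="\<lambda>q. \<bar>jump S f q\<bar> * (M * \<bar>jump S u q\<bar> + L * \<bar>step u q\<bar>)"])
    show "integrable J (\<lambda>q. \<bar>jump S f q\<bar> * (M * \<bar>jump S u q\<bar> + L * \<bar>step u q\<bar>))"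
      by (intro square_integrable_mult square_integrable_add square_integrable_cmult square_integrable_abs
          fL uL square_integrable_step)
    show "AE q in J. (\<lambda>n. jump S f q * jump S (\<lambda>x. p n x * u x) q) \<longlonglongrightarrow> jump S f q * jump S (\<lambda>x. m x * u x) q"
      by (intro AE_I2 tendsto_intros jl)
    show "AE q in J. norm (jump S f q * jump S (\<lambda>x. p n x * u x) q) \<le> \<bar>jump S f q\<bar> * (M * \<bar>jump S u q\<bar> + L * \<bar>step u q\<bar>)" for n
      using jump_mult_le[OF p(1)[of n] p(2)[of _ n], of u]
      by (intro AE_I2) (auto simp: abs_mult intro!: mult_left_mono)
    show "(\<lambda>q. jump S f q * jump S (\<lambda>x. m x * u x) q) \<in> borel_measurable J"
      by (intro borel_measurable_times square_integrable_measurable[OF fL(2)] jm)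
    show "(\<lambda>q. jump S f q * jump S (\<lambda>x. p n x * u x) q) \<in> borel_measurable J" for n
      by (intro borel_measurable_times square_integrable_measurable[OF fL(2)] square_integrable_measurable[OF pL(2)])
  qed
  then show "(\<lambda>n. Q f (\<lambda>x. p n x * u x)) \<longlonglongrightarrow> Q f (\<lambda>x. m x * u x)"
    unfolding Q_def by (intro tendsto_intros wl)
qed

text \<open>A smooth multiplier preserves \<open>C0_infty S\<close>, so it maps approximating
  sequences of u to approximating sequences of p u.\<close>

lemma smooth_mult_dirichlet_domain:
  assumes p: "\<And>k. Ck_on k UNIV p" "L-lipschitz_on S p" "\<And>x. x \<in> S \<Longrightarrow> \<bar>p x\<bar> \<le> M"
    and u: "u \<in> fst (dirichlet_form \<epsilon> k W S)"
  shows "(\<lambda>x. p x * u x) \<in> fst (dirichlet_form \<epsilon> k W S)"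
proof -
  let ?F = "form_restrict (neumann_form \<epsilon> k W S) (C0_infty S)"
  have uL: "u \<in> L2 S" using u by (auto simp: dirichlet_form_def form_closure_def)
  obtain w where w: "form_approx S ?F u w"
    using u by (auto simp: dirichlet_form_def form_closure_def)
  note a = form_approx_limit[OF w uL]
  let ?w = "\<lambda>n x. p x * w n x"
  have N: "?w n \<in> N" for n by (rule mult_N(1)[OF p(2,3) a(1)])
  have diff: "(\<lambda>x. p x * f x - p x * g x) = (\<lambda>x. p x * (f x - g x))" for f g :: "'a \<Rightarrow> real"
    by (simp add: algebra_simps)
  have "form_approx S ?F (\<lambda>x. p x * u x) ?w"
    unfolding form_approx_def
  proof (intro conjI allI impI)
    fix n
    have w0: "\<And>k. Ck_on k UNIV (w n)" "bounded {x. w n x \<noteq> 0}" "closure {x. w n x \<noteq> 0} \<subseteq> S"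
      using a(2)[of n] by (auto simp: C0_infty_def)
    have sub: "{x. p x * w n x \<noteq> 0} \<subseteq> {x. w n x \<noteq> 0}" by auto
    have "\<forall>k. Ck_on k UNIV (?w n)" using p(1) w0(1) by (intro allI Ck_on_mult)
    moreover have "compact (closure {x. ?w n x \<noteq> 0})"
      using bounded_subset[OF w0(2) sub] by simp
    moreover have "closure {x. ?w n x \<noteq> 0} \<subseteq> S"
      using closure_mono[OF sub] w0(3) by (rule subset_trans)
    ultimately have "?w n \<in> C0_infty S" by (simp add: C0_infty_def)
    then show "?w n \<in> fst ?F" using N by (simp add: form_restrict_def)
  next
    have lim: "(\<lambda>n. M\<^sup>2 * (LINT x|lborel. (zero_ext S (w n) x - zero_ext S u x)\<^sup>2)) \<longlonglongrightarrow> 0"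
      by (rule tendsto_mult_right_zero[OF a(4)])
    have "norm (LINT x|lborel. (zero_ext S (\<lambda>x. p x * w n x - p x * u x) x)\<^sup>2) \<le>
        M\<^sup>2 * (LINT x|lborel. (zero_ext S (w n) x - zero_ext S u x)\<^sup>2)" for n
      using mult_N(3)[OF p(2,3) N_diff[OF a(1)[of n] a(3)]] by (simp add: diff zero_ext_diff)
    then have "(\<lambda>n. LINT x|lborel. (zero_ext S (\<lambda>x. p x * w n x - p x * u x) x)\<^sup>2) \<longlonglongrightarrow> 0"
      by (rule Lim_null_comparison[OF always_eventually[OF allI] lim])
    from tendsto_real_sqrt[OF this]
    show "(\<lambda>n. L2_norm S (\<lambda>x. p x * w n x - p x * u x)) \<longlonglongrightarrow> 0"
      by (simp add: L2_norm_zero_ext)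
  next
    fix e :: real assume "0 < e"
    have pL: "square_integrable lborel (zero_ext S (?w n))" "square_integrable lborel (zero_ext S (\<lambda>x. p x * u x))" for n
      using N mult_N(1)[OF p(2,3) a(3)] by (auto simp: N_iff)
    have "(\<lambda>n. LINT p'|J. (jump S (?w n) p' - jump S (\<lambda>x. p x * u x) p')\<^sup>2) \<longlonglongrightarrow> 0" (is "?j \<longlonglongrightarrow> 0")
    proof (rule Lim_null_comparison[OF always_eventually[OF allI]])
      show "norm (?j n) \<le> 2 * M\<^sup>2 * (LINT p|J. (jump S (w n) p - jump S u p)\<^sup>2)
          + 2 * L\<^sup>2 * (\<epsilon>\<^sup>2 * C * (LINT x|lborel. (zero_ext S (w n) x - zero_ext S u x)\<^sup>2))" for n
        using mult_N(2)[OF p(2,3) N_diff[OF a(1)[of n] a(3)]]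
        by (simp add: diff[symmetric] zero_ext_diff jump_diff)
      show "(\<lambda>n. 2 * M\<^sup>2 * (LINT p|J. (jump S (w n) p - jump S u p)\<^sup>2)
          + 2 * L\<^sup>2 * (\<epsilon>\<^sup>2 * C * (LINT x|lborel. (zero_ext S (w n) x - zero_ext S u x)\<^sup>2))) \<longlonglongrightarrow> 0"
        by (intro tendsto_add_zero tendsto_mult_right_zero a)
    qed
    moreover have "(\<lambda>n. LINT x|lborel. (zero_ext S (?w n) x - zero_ext S (\<lambda>x. p x * u x) x)\<^sup>2) \<longlonglongrightarrow> 0" (is "?c \<longlonglongrightarrow> 0")
    proof (rule Lim_null_comparison[OF always_eventually[OF allI]])
      show "norm (?c n) \<le> M\<^sup>2 * (LINT x|lborel. (zero_ext S (w n) x - zero_ext S u x)\<^sup>2)" for n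
        using mult_N(3)[OF p(2,3) N_diff[OF a(1)[of n] a(3)]]
        by (simp add: diff[symmetric] zero_ext_diff)
      show "(\<lambda>n. M\<^sup>2 * (LINT x|lborel. (zero_ext S (w n) x - zero_ext S u x)\<^sup>2)) \<longlonglongrightarrow> 0"
        by (intro tendsto_mult_right_zero a)
    qed
    then have "(\<lambda>n. LINT x|lborel. (weighted_ext (?w n) x - weighted_ext (\<lambda>x. p x * u x) x)\<^sup>2) \<longlonglongrightarrow> 0" (is "?v \<longlonglongrightarrow> 0")
      by (rule weighted_ext_tendsto[OF pL])
    \<comment> \<open>The weights 1 and 2 are what (a - b)^2 \<le> 2 a^2 + 2 b^2 makes of the
      factors 1/2 and 1 in \<open>Q\<close>, when \<open>?w m\<close> and \<open>?w n\<close> are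
      both compared with the limit.\<close>
    ultimately have "(\<lambda>n. ?j n + 2 * ?v n) \<longlonglongrightarrow> 0"
      by (intro tendsto_add_zero tendsto_mult_right_zero)
    then have "\<forall>\<^sub>F n in sequentially. ?j n + 2 * ?v n < e / 2"
      using \<open>0 < e\<close> by (intro order_tendstoD) auto
    then obtain K where K: "\<And>n. n \<ge> K \<Longrightarrow> ?j n + 2 * ?v n < e / 2"
      by (auto simp: eventually_sequentially)
    have "snd ?F (\<lambda>x. ?w m x - ?w n x) (\<lambda>x. ?w m x - ?w n x) < e" if "m \<ge> K" "n \<ge> K" for m n
    proof -
      let ?d = "\<lambda>n x. ?w n x - p x * u x"
      have dN: "?d n \<in> N" for n by (intro N_diff N mult_N(1)[OF p(2,3)] a)
      then have dL: "square_integrable J (jump S (?d n))" "square_integrable lborel (weighted_ext (?d n))" for n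
        by (auto simp: N_iff intro: square_integrable_weighted_ext)
      have "snd ?F (\<lambda>x. ?w m x - ?w n x) (\<lambda>x. ?w m x - ?w n x) = Q (\<lambda>x. ?w m x - ?w n x) (\<lambda>x. ?w m x - ?w n x)"
        using N_diff[OF N N] by (simp add: form_restrict_def neumann_form_eq)
      also have "\<dots> = 1/2 * (LINT q|J. (jump S (?d m) q - jump S (?d n) q)\<^sup>2)
          + (LINT x|lborel. (weighted_ext (?d m) x - weighted_ext (?d n) x)\<^sup>2)"
        by (simp add: Q_def jump_diff weighted_ext_diff power2_eq_square)
      also have "\<dots> \<le> 1/2 * (2 * (LINT q|J. (jump S (?d m) q)\<^sup>2) + 2 * (LINT q|J. (jump S (?d n) q)\<^sup>2))
          + (2 * (LINT x|lborel. (weighted_ext (?d m) x)\<^sup>2) + 2 * (LINT x|lborel. (weighted_ext (?d n) x)\<^sup>2))"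
        by (intro add_mono mult_left_mono integral_diff_square_le dL) simp
      also have "\<dots> = (?j m + 2 * ?v m) + (?j n + 2 * ?v n)"
        by (simp add: jump_diff weighted_ext_diff)
      also have "\<dots> < e" using K[OF that(1)] K[OF that(2)] by simp
      finally show ?thesis .
    qed
    then show "\<exists>N. \<forall>m\<ge>N. \<forall>n\<ge>N. snd ?F (\<lambda>x. ?w m x - ?w n x) (\<lambda>x. ?w m x - ?w n x) < e" by blast
  qed
  moreover have "(\<lambda>x. p x * u x) \<in> L2 S"
    using mult_N(1)[OF p(2,3) a(3)] by (simp add: N_iff L2_iff)
  ultimately show ?thesis by (auto simp: dirichlet_form_def form_closure_def)
qed

section \<open>Testing the operator equation with multiples of u\<close>

lemma neumann_operator_mult:
  assumes H: "(u, f) \<in> H_neumann \<epsilon> k W S"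
    and m: "L-lipschitz_on S m" "\<And>x. x \<in> S \<Longrightarrow> \<bar>m x\<bar> \<le> M"
  shows "u \<in> N" "f \<in> L2 S" "Q u (\<lambda>x. m x * u x) = L2_inner S f (\<lambda>x. m x * u x)"
  using H mult_N(1)[OF m] by (auto simp: H_neumann_def form_operator_def neumann_form_eq)

text \<open>For a Lipschitz m the product m u is not directly seen to be in the Dirichlet domain.
  The identity holds for smooth approximants with the same Lipschitz constant and survives the
  limit, since both sides make sense on the larger Neumann domain.\<close>

lemma dirichlet_operator_mult:
  assumes H: "(u, f) \<in> H_dirichlet \<epsilon> k W S"
    and m: "L-lipschitz_on S m" "\<And>x. x \<in> S \<Longrightarrow> \<bar>m x\<bar> \<le> M"
  shows "u \<in> N" "f \<in> L2 S" "Q u (\<lambda>x. m x * u x) = L2_inner S f (\<lambda>x. m x * u x)"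
proof -
  let ?D = "fst (dirichlet_form \<epsilon> k W S)"
  have uD: "u \<in> ?D" and f: "f \<in> L2 S"
    and form: "\<And>v. v \<in> ?D \<Longrightarrow> snd (dirichlet_form \<epsilon> k W S) u v = L2_inner S f v"
    using H by (auto simp: H_dirichlet_def form_operator_def)
  show u: "u \<in> N" "f \<in> L2 S" using uD f by (auto intro: dirichlet_domain_subset)
  have "\<exists>p. (\<forall>k. Ck_on k UNIV p) \<and> L-lipschitz_on S p \<and> (\<forall>x\<in>S. \<bar>p x - m x\<bar> \<le> 1 / real (Suc n))" for n
    using lipschitz_smooth_approximation[OF bounded_S m(1)] by simp
  then obtain p where p: "\<And>n k. Ck_on k UNIV (p n)" "\<And>n. L-lipschitz_on S (p n)"
    "\<And>n x. x \<in> S \<Longrightarrow> \<bar>p n x - m x\<bar> \<le> 1 / real (Suc n)" by metis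
  have pM: "\<bar>p n x\<bar> \<le> M + 1" if "x \<in> S" for n x
  proof -
    have "1 / real (Suc n) \<le> 1" by simp
    then show ?thesis using p(3)[OF that, of n] m(2)[OF that] by linarith
  qed
  have lim: "(\<lambda>n. p n x) \<longlonglongrightarrow> m x" if "x \<in> S" for x
  proof -
    have "(\<lambda>n. p n x - m x) \<longlonglongrightarrow> 0"
    proof (rule Lim_null_comparison[OF always_eventually[OF allI]])
      show "norm (p n x - m x) \<le> 1 / real (Suc n)" for n using p(3)[OF that] by simp
      show "(\<lambda>n. 1 / real (Suc n)) \<longlonglongrightarrow> 0" using LIMSEQ_inverse_real_of_nat by (simp add: inverse_eq_divide)
    qed
    then show ?thesis by (rule LIM_zero_cancel)
  qed
  have "Q u (\<lambda>x. p n x * u x) = L2_inner S f (\<lambda>x. p n x * u x)" for n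
  proof -
    have "(\<lambda>x. p n x * u x) \<in> ?D" by (rule smooth_mult_dirichlet_domain[OF p(1,2) pM uD])
    then show ?thesis using form uD by (simp add: dirichlet_form_eq[symmetric])
  qed
  then show "Q u (\<lambda>x. m x * u x) = L2_inner S f (\<lambda>x. m x * u x)"
    using mult_tendsto[OF p(2) pM lim u(1) u(1) f] LIMSEQ_unique by auto
qed

end

section \<open>The weighted form estimate\<close>

context jump_form
begin

text \<open>With a and b the values of \<open>exp \<Phi> u\<close> at the two endpoints and h the
  cosh factor, the integrand a^2 + b^2 - 2 a b h differs from -(a^2 + b^2)(h - 1) by h (a - b)^2
  \<ge> 0. The two resulting terms each cost at most the integral of g z^2, and the factor 1/2 of
  the form makes their sum one such integral.\<close>

lemma agmon_form_lower_bound: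
  assumes u: "u \<in> N"
    and \<Phi>: "L-lipschitz_on S \<Phi>" "\<And>x. x \<in> S \<Longrightarrow> \<bar>\<Phi> x\<bar> \<le> M"
    and g: "continuous_on S g" "\<And>x. x \<in> S \<Longrightarrow> 0 \<le> g x" "\<And>x. x \<in> S \<Longrightarrow> g x \<le> G"
    and bound: "\<And>x. x \<in> S \<Longrightarrow> (\<integral>\<^sup>+\<gamma>. indicator S (x + \<epsilon> *\<^sub>R \<gamma>) *
        ennreal (cosh (\<Phi> x - \<Phi> (x + \<epsilon> *\<^sub>R \<gamma>)) - 1) \<partial>k x) \<le> ennreal (g x)"
  defines "z \<equiv> zero_ext S (\<lambda>x. exp (\<Phi> x) * u x)"
  shows "square_integrable lborel z" "integrable lborel (\<lambda>x. W x * (z x)\<^sup>2)"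
    "integrable lborel (\<lambda>x. g x * (z x)\<^sup>2)"
    "(LINT x|lborel. W x * (z x)\<^sup>2) - (LINT x|lborel. g x * (z x)\<^sup>2) \<le> Q u (\<lambda>x. exp (2 * \<Phi> x) * u x)"
proof -
  have e1: "(exp M * L)-lipschitz_on S (\<lambda>x. exp (\<Phi> x))" "\<And>x. x \<in> S \<Longrightarrow> \<bar>exp (\<Phi> x)\<bar> \<le> exp M"
    using \<Phi> by (auto intro!: lipschitz_on_exp simp: abs_le_iff)
  have "(2 * L)-lipschitz_on S (\<lambda>x. 2 * \<Phi> x)"
    using lipschitz_on_cmult_real[OF \<Phi>(1), of 2] by simp
  then have e2: "(exp (2 * M) * (2 * L))-lipschitz_on S (\<lambda>x. exp (2 * \<Phi> x))"
    "\<And>x. x \<in> S \<Longrightarrow> \<bar>exp (2 * \<Phi> x)\<bar> \<le> exp (2 * M)"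
    using \<Phi> by (auto intro!: lipschitz_on_exp simp: abs_le_iff)
  let ?v = "\<lambda>x. exp (2 * \<Phi> x) * u x"
  have wN: "(\<lambda>x. exp (\<Phi> x) * u x) \<in> N" by (rule mult_N(1)[OF e1 u])
  have vN: "?v \<in> N" by (rule mult_N(1)[OF e2 u])
  show z: "square_integrable lborel z" using wN by (simp add: z_def N_iff)
  have zm: "z \<in> borel_measurable borel" by (rule square_integrable_lborelD[OF z])
  have gm: "zero_ext S g \<in> borel_measurable borel" by (rule borel_measurable_zero_ext_continuous[OF open_S g(1)])
  have \<Phi>m: "zero_ext S \<Phi> \<in> borel_measurable borel"
    by (rule borel_measurable_zero_ext_continuous[OF open_S lipschitz_on_continuous_on[OF \<Phi>(1)]])
  have W_eq: "weighted_ext (\<lambda>x. exp (\<Phi> x) * u x) x * weighted_ext (\<lambda>x. exp (\<Phi> x) * u x) x = W x * (z x)\<^sup>2"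
    "weighted_ext u x * weighted_ext ?v x = W x * (z x)\<^sup>2" for x
  proof -
    have "exp (2 * \<Phi> x) = exp (\<Phi> x) * exp (\<Phi> x)" by (simp flip: exp_add)
    then show "weighted_ext (\<lambda>x. exp (\<Phi> x) * u x) x * weighted_ext (\<lambda>x. exp (\<Phi> x) * u x) x = W x * (z x)\<^sup>2"
      "weighted_ext u x * weighted_ext ?v x = W x * (z x)\<^sup>2"
      using W_nonneg[of x]
      by (auto simp: weighted_ext_def z_def zero_ext_def power2_eq_square indicator_def)
  qed
  have "square_integrable lborel (weighted_ext (\<lambda>x. exp (\<Phi> x) * u x))"
    using wN by (intro square_integrable_weighted_ext) (simp add: N_iff)
  from square_integrable_mult[OF this this] show Wint: "integrable lborel (\<lambda>x. W x * (z x)\<^sup>2)"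
    by (simp add: W_eq)
  have g_eq: "g x * (z x)\<^sup>2 = zero_ext S g x * (z x)\<^sup>2" for x
    by (simp add: z_def zero_ext_def indicator_def)
  show gint: "integrable lborel (\<lambda>x. g x * (z x)\<^sup>2)"
  proof (rule Bochner_Integration.integrable_bound)
    show "integrable lborel (\<lambda>x. G * (z x)\<^sup>2)" using z by auto
    show "(\<lambda>x. g x * (z x)\<^sup>2) \<in> borel_measurable lborel"
      unfolding g_eq using gm zm by simp
    show "AE x in lborel. norm (g x * (z x)\<^sup>2) \<le> norm (G * (z x)\<^sup>2)"
    proof (rule AE_I2)
      fix x
      show "norm (g x * (z x)\<^sup>2) \<le> norm (G * (z x)\<^sup>2)"
      proof (cases "x \<in> S")
        case True
        then have "\<bar>g x\<bar> \<le> \<bar>G\<bar>" using g(2,3)[of x] by auto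
        then show ?thesis by (simp add: abs_mult mult_right_mono)
      qed (simp add: z_def zero_ext_def)
    qed
  qed
  define H where "H p = indicator (S \<times> S) p * (cosh (\<Phi> (fst p) - \<Phi> (snd p)) - 1)" for p
  have H_eq: "H p = indicator (S \<times> S) p * (cosh (zero_ext S \<Phi> (fst p) - zero_ext S \<Phi> (snd p)) - 1)" for p
    by (auto simp: H_def zero_ext_def indicator_def mem_Times_iff)
  have H0: "0 \<le> H p" for p using cosh_real_ge_1 by (simp add: H_def)
  have "S \<times> S \<in> sets (borel \<Otimes>\<^sub>M borel)" using S_borel by simp
  then have Hm: "H \<in> borel_measurable borel"
    unfolding H_eq[abs_def] cosh_field_def borel_prod[symmetric] using \<Phi>m by measurable
  have z1m: "(\<lambda>p. (z (fst p))\<^sup>2 * H p) \<in> borel_measurable borel"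
    "(\<lambda>p. (z (snd p))\<^sup>2 * H p) \<in> borel_measurable borel"
    using zm Hm unfolding borel_prod[symmetric] by measurable
  have le1: "(\<integral>\<^sup>+p. ennreal ((z (fst p))\<^sup>2 * H p) \<partial>J) \<le> ennreal (LINT x|lborel. g x * (z x)\<^sup>2)"
  proof -
    have "(\<integral>\<^sup>+p. ennreal ((z (fst p))\<^sup>2 * H p) \<partial>J) =
        (\<integral>\<^sup>+x. (\<integral>\<^sup>+\<gamma>. ennreal ((z x)\<^sup>2 * H (x, x + \<epsilon> *\<^sub>R \<gamma>)) \<partial>k x) \<partial>lborel)"
      using z1m by (subst nn_integral_J) auto
    also have "\<dots> \<le> (\<integral>\<^sup>+x. ennreal (g x * (z x)\<^sup>2) \<partial>lborel)"
    proof (rule nn_integral_mono)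
      fix x
      show "(\<integral>\<^sup>+\<gamma>. ennreal ((z x)\<^sup>2 * H (x, x + \<epsilon> *\<^sub>R \<gamma>)) \<partial>k x) \<le> ennreal (g x * (z x)\<^sup>2)"
      proof (cases "x \<in> S")
        case True
        have "(\<integral>\<^sup>+\<gamma>. ennreal ((z x)\<^sup>2 * H (x, x + \<epsilon> *\<^sub>R \<gamma>)) \<partial>k x) =
            (\<integral>\<^sup>+\<gamma>. ennreal ((z x)\<^sup>2) * ennreal (H (x, x + \<epsilon> *\<^sub>R \<gamma>)) \<partial>k x)"
          using H0 by (simp add: ennreal_mult)
        also have "\<dots> = ennreal ((z x)\<^sup>2) * (\<integral>\<^sup>+\<gamma>. ennreal (H (x, x + \<epsilon> *\<^sub>R \<gamma>)) \<partial>k x)"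
          using Hm by (intro nn_integral_cmult measurable_k_jump[of "\<lambda>p. ennreal (H p)"]) simp
        also have "(\<integral>\<^sup>+\<gamma>. ennreal (H (x, x + \<epsilon> *\<^sub>R \<gamma>)) \<partial>k x) =
            (\<integral>\<^sup>+\<gamma>. indicator S (x + \<epsilon> *\<^sub>R \<gamma>) * ennreal (cosh (\<Phi> x - \<Phi> (x + \<epsilon> *\<^sub>R \<gamma>)) - 1) \<partial>k x)"
          using True by (intro nn_integral_cong) (auto simp: H_def indicator_def)
        also have "ennreal ((z x)\<^sup>2) * \<dots> \<le> ennreal ((z x)\<^sup>2) * ennreal (g x)"
          using bound[OF True] by (intro mult_left_mono) auto
        also have "\<dots> = ennreal (g x * (z x)\<^sup>2)"
          using g(2)[OF True] by (simp add: ennreal_mult mult.commute)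
        finally show ?thesis .
      qed (simp add: z_def zero_ext_def)
    qed
    also have "\<dots> = ennreal (LINT x|lborel. g x * (z x)\<^sup>2)"
    proof (rule nn_integral_eq_integral[OF gint])
      show "AE x in lborel. 0 \<le> g x * (z x)\<^sup>2"
        using g(2) by (intro AE_I2) (auto simp: z_def zero_ext_def indicator_def)
    qed
    finally show ?thesis .
  qed
  \<comment> \<open>\<open>H\<close> is even under exchange of the endpoints, so symmetry of
    \<open>J\<close> carries the bound from the starting point to the target.\<close>
  have le2: "(\<integral>\<^sup>+p. ennreal ((z (snd p))\<^sup>2 * H p) \<partial>J) \<le> ennreal (LINT x|lborel. g x * (z x)\<^sup>2)"
  proof -
    have "H (prod.swap p) = H p" for p
      using cosh_minus[of "\<Phi> (fst p) - \<Phi> (snd p)"] by (auto simp: H_def indicator_def mem_Times_iff)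
    then have "(\<integral>\<^sup>+p. ennreal ((z (snd p))\<^sup>2 * H p) \<partial>J) = (\<integral>\<^sup>+p. ennreal ((z (fst p))\<^sup>2 * H p) \<partial>J)"
      using nn_integral_J_swap[of "\<lambda>p. ennreal ((z (fst p))\<^sup>2 * H p)"] z1m by simp
    then show ?thesis using le1 by simp
  qed
  have I0: "0 \<le> (LINT x|lborel. g x * (z x)\<^sup>2)"
    using g(2) by (intro Bochner_Integration.integral_nonneg) (auto simp: z_def zero_ext_def indicator_def)
  have int: "integrable J (\<lambda>p. h p * H p) \<and> (LINT p|J. h p * H p) \<le> (LINT x|lborel. g x * (z x)\<^sup>2)"
    if h: "(\<lambda>p. h p * H p) \<in> borel_measurable borel" "\<And>p. 0 \<le> h p"
      "(\<integral>\<^sup>+p. ennreal (h p * H p) \<partial>J) \<le> ennreal (LINT x|lborel. g x * (z x)\<^sup>2)" for h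
  proof -
    have "(\<integral>\<^sup>+p. ennreal (h p * H p) \<partial>J) < \<infinity>"
      using h(3) by (metis ennreal_less_top infinity_ennreal_def le_less_trans)
    then have "integrable J (\<lambda>p. h p * H p)"
      using h H0 by (intro integrableI_nonneg) (auto simp: measurable_J)
    moreover from this have "ennreal (LINT p|J. h p * H p) \<le> ennreal (LINT x|lborel. g x * (z x)\<^sup>2)"
      using h(2,3) H0 by (subst nn_integral_eq_integral[symmetric]) auto
    ultimately show ?thesis using I0 by simp
  qed
  have i1: "integrable J (\<lambda>p. (z (fst p))\<^sup>2 * H p)" "(LINT p|J. (z (fst p))\<^sup>2 * H p) \<le> (LINT x|lborel. g x * (z x)\<^sup>2)"
    and i2: "integrable J (\<lambda>p. (z (snd p))\<^sup>2 * H p)" "(LINT p|J. (z (snd p))\<^sup>2 * H p) \<le> (LINT x|lborel. g x * (z x)\<^sup>2)"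
    using int[of "\<lambda>p. (z (fst p))\<^sup>2"] int[of "\<lambda>p. (z (snd p))\<^sup>2"] z1m le1 le2 by auto
  have "- (LINT x|lborel. g x * (z x)\<^sup>2) - (LINT x|lborel. g x * (z x)\<^sup>2) \<le>
      - (LINT p|J. (z (fst p))\<^sup>2 * H p) - (LINT p|J. (z (snd p))\<^sup>2 * H p)"
    using i1(2) i2(2) by simp
  also have "\<dots> = (LINT p|J. - ((z (fst p))\<^sup>2 * H p) - (z (snd p))\<^sup>2 * H p)"
    using i1(1) i2(1) by simp
  also have "\<dots> \<le> (LINT p|J. jump S u p * jump S ?v p)"
  proof (rule integral_mono)
    show "integrable J (\<lambda>p. - ((z (fst p))\<^sup>2 * H p) - (z (snd p))\<^sup>2 * H p)" using i1(1) i2(1) by simp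
    show "integrable J (\<lambda>p. jump S u p * jump S ?v p)"
      using u vN by (intro square_integrable_mult) (auto simp: N_iff)
    fix p :: "'a \<times> 'a"
    show "- ((z (fst p))\<^sup>2 * H p) - (z (snd p))\<^sup>2 * H p \<le> jump S u p * jump S ?v p"
    proof (cases "p \<in> S \<times> S")
      case True
      then obtain x y where p: "p = (x, y)" "x \<in> S" "y \<in> S" by auto
      define a where "a = exp (\<Phi> x) * u x"
      define b where "b = exp (\<Phi> y) * u y"
      define h where "h = cosh (\<Phi> x - \<Phi> y)"
      have "jump S u p * jump S ?v p = (u x - u y) * (exp (2 * \<Phi> x) * u x - exp (2 * \<Phi> y) * u y)"
        using p by (simp add: jump_def)
      also have "\<dots> = a\<^sup>2 + b\<^sup>2 - 2 * (a * b) * h"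
        unfolding a_def b_def h_def cosh_field_def power2_eq_square
        by (simp add: algebra_simps exp_diff mult_exp_exp exp_minus)
          (simp add: field_simps flip: exp_add exp_double)
      also have "a\<^sup>2 + b\<^sup>2 - 2 * (a * b) * h \<ge> - (a\<^sup>2 * (h - 1)) - b\<^sup>2 * (h - 1)"
      proof -
        have "1 \<le> h" by (simp add: h_def cosh_real_ge_1)
        then have "0 \<le> h * (a - b)\<^sup>2" by simp
        then show ?thesis by (simp add: power2_eq_square algebra_simps)
      qed
      finally show ?thesis
        using p by (simp add: z_def zero_ext_def H_def a_def b_def h_def)
    qed (simp add: H_def jump_def)
  qed
  finally show "(LINT x|lborel. W x * (z x)\<^sup>2) - (LINT x|lborel. g x * (z x)\<^sup>2) \<le> Q u ?v"
    by (simp add: Q_def W_eq)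
qed

text \<open>Where the gap fails, the loss K \<epsilon> z^2 is at most K \<epsilon> T^2 u^2 because
  the weight is bounded there. With a, b, c the three norms this leaves \<epsilon> a^2 - K
  \<epsilon> T^2 c^2 \<le> b a, a quadratic inequality that forces a \<le> b / \<epsilon> + (sqrt K)
  T c.\<close>

lemma agmon_estimate:
  assumes u: "u \<in> N" and f: "f \<in> L2 S"
    and eq: "Q u (\<lambda>x. exp (2 * \<Phi> x) * u x) = L2_inner S f (\<lambda>x. exp (2 * \<Phi> x) * u x)"
    and \<Phi>: "L-lipschitz_on S \<Phi>" "\<And>x. x \<in> S \<Longrightarrow> \<bar>\<Phi> x\<bar> \<le> M"
    and g: "continuous_on S g" "\<And>x. x \<in> S \<Longrightarrow> 0 \<le> g x" "\<And>x. x \<in> S \<Longrightarrow> g x \<le> G"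
    and bound: "\<And>x. x \<in> S \<Longrightarrow> (\<integral>\<^sup>+\<gamma>. indicator S (x + \<epsilon> *\<^sub>R \<gamma>) *
        ennreal (cosh (\<Phi> x - \<Phi> (x + \<epsilon> *\<^sub>R \<gamma>)) - 1) \<partial>k x) \<le> ennreal (g x)"
    and E: "\<And>x. x \<in> S \<Longrightarrow> \<epsilon> \<le> W x - g x - E \<or> (\<epsilon> - K * \<epsilon> \<le> W x - g x - E \<and> exp (\<Phi> x) \<le> T)"
    and KT: "0 \<le> K" "0 \<le> T"
  shows "L2_norm S (\<lambda>x. exp (\<Phi> x) * u x) \<le>
    inverse \<epsilon> * L2_norm S (\<lambda>x. exp (\<Phi> x) * (f x - E * u x)) + sqrt K * T * L2_norm S u"
proof -
  define z where "z = zero_ext S (\<lambda>x. exp (\<Phi> x) * u x)"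
  define y where "y = zero_ext S (\<lambda>x. exp (\<Phi> x) * (f x - E * u x))"
  note lb = agmon_form_lower_bound[OF u \<Phi> g bound, folded z_def]
  have uL: "square_integrable lborel (zero_ext S u)" using u by (simp add: N_iff)
  have fL: "square_integrable lborel (zero_ext S f)" using f by (simp add: L2_iff)
  have yL: "square_integrable lborel y"
  proof (rule square_integrable_dominated)
    show "square_integrable lborel (\<lambda>x. exp M * (zero_ext S f x - E * zero_ext S u x))"
      by (intro square_integrable_cmult square_integrable_diff fL uL)
    have "(\<lambda>x. exp (zero_ext S \<Phi> x) * (zero_ext S f x - E * zero_ext S u x)) \<in> borel_measurable borel"
      using square_integrable_lborelD[OF fL] square_integrable_lborelD[OF uL]
        borel_measurable_zero_ext_continuous[OF open_S lipschitz_on_continuous_on[OF \<Phi>(1)]]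
      by measurable
    moreover have "y x = exp (zero_ext S \<Phi> x) * (zero_ext S f x - E * zero_ext S u x)" for x
      by (simp add: y_def zero_ext_def indicator_def)
    ultimately show "y \<in> borel_measurable lborel" by (simp add: fun_eq_iff[symmetric] cong: measurable_cong)
    show "\<bar>y x\<bar> \<le> \<bar>exp M * (zero_ext S f x - E * zero_ext S u x)\<bar>" for x
      using \<Phi>(2)[of x] by (auto simp: y_def zero_ext_def indicator_def abs_mult intro!: mult_right_mono)
  qed
  define a where "a = L2_norm S (\<lambda>x. exp (\<Phi> x) * u x)"
  define b where "b = L2_norm S (\<lambda>x. exp (\<Phi> x) * (f x - E * u x))"
  define c where "c = L2_norm S u"
  have nonneg: "0 \<le> a" "0 \<le> b" "0 \<le> c"
    by (simp_all add: a_def b_def c_def L2_norm_zero_ext Bochner_Integration.integral_nonneg)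
  have a2: "a\<^sup>2 = (LINT x|lborel. (z x)\<^sup>2)" and c2: "c\<^sup>2 = (LINT x|lborel. (zero_ext S u x)\<^sup>2)"
    by (simp_all add: a_def c_def z_def L2_norm_zero_ext Bochner_Integration.integral_nonneg)
  have zL: "integrable lborel (\<lambda>x. (z x)\<^sup>2)" using lb(1) by auto
  have yz: "integrable lborel (\<lambda>x. y x * z x)" by (rule square_integrable_mult[OF yL lb(1)])
  have "\<epsilon> * a\<^sup>2 - K * \<epsilon> * T\<^sup>2 * c\<^sup>2 = (LINT x|lborel. \<epsilon> * (z x)\<^sup>2 - K * \<epsilon> * T\<^sup>2 * (zero_ext S u x)\<^sup>2)"
    unfolding a2 c2 using zL square_integrable_integrable[OF uL]
    by (subst Bochner_Integration.integral_diff) auto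
  also have "\<dots> \<le> (LINT x|lborel. W x * (z x)\<^sup>2 - g x * (z x)\<^sup>2 - E * (z x)\<^sup>2)"
  proof (rule integral_mono)
    show "integrable lborel (\<lambda>x. \<epsilon> * (z x)\<^sup>2 - K * \<epsilon> * T\<^sup>2 * (zero_ext S u x)\<^sup>2)"
      using zL square_integrable_integrable[OF uL] by auto
    show "integrable lborel (\<lambda>x. W x * (z x)\<^sup>2 - g x * (z x)\<^sup>2 - E * (z x)\<^sup>2)"
      using lb zL by auto
    fix x
    show "\<epsilon> * (z x)\<^sup>2 - K * \<epsilon> * T\<^sup>2 * (zero_ext S u x)\<^sup>2 \<le> W x * (z x)\<^sup>2 - g x * (z x)\<^sup>2 - E * (z x)\<^sup>2"
    proof (cases "x \<in> S")
      case True
      have K\<epsilon>: "0 \<le> K * \<epsilon>" using KT eps by simp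
      from E[OF True] show ?thesis
      proof
        assume "\<epsilon> \<le> W x - g x - E"
        then have "\<epsilon> * (z x)\<^sup>2 \<le> (W x - g x - E) * (z x)\<^sup>2" by (intro mult_right_mono) auto
        moreover have "0 \<le> K * \<epsilon> * T\<^sup>2 * (zero_ext S u x)\<^sup>2" using K\<epsilon> by simp
        ultimately show ?thesis by (simp add: algebra_simps)
      next
        assume *: "\<epsilon> - K * \<epsilon> \<le> W x - g x - E \<and> exp (\<Phi> x) \<le> T"
        then have "(\<epsilon> - K * \<epsilon>) * (z x)\<^sup>2 \<le> (W x - g x - E) * (z x)\<^sup>2" by (intro mult_right_mono) auto
        moreover have "K * \<epsilon> * (z x)\<^sup>2 \<le> K * \<epsilon> * (T\<^sup>2 * (zero_ext S u x)\<^sup>2)"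
          using * K\<epsilon> True
          by (intro mult_left_mono) (auto simp: z_def zero_ext_def power_mult_distrib intro!: mult_right_mono power_mono)
        ultimately show ?thesis by (simp add: algebra_simps)
      qed
    qed (simp add: z_def zero_ext_def)
  qed
  also have "\<dots> = (LINT x|lborel. W x * (z x)\<^sup>2) - (LINT x|lborel. g x * (z x)\<^sup>2) - E * (LINT x|lborel. (z x)\<^sup>2)"
    using lb zL by simp
  also have "\<dots> \<le> L2_inner S f (\<lambda>x. exp (2 * \<Phi> x) * u x) - E * (LINT x|lborel. (z x)\<^sup>2)"
    using lb(4) eq by simp
  also have "\<dots> = (LINT x|lborel. y x * z x)"
  proof -
    have *: "zero_ext S f x * zero_ext S (\<lambda>x. exp (2 * \<Phi> x) * u x) x = y x * z x + E * (z x)\<^sup>2" for x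
    proof -
      have "exp (2 * \<Phi> x) = exp (\<Phi> x) * exp (\<Phi> x)" by (simp flip: exp_add)
      then show ?thesis
        by (simp add: z_def y_def zero_ext_def indicator_def power2_eq_square algebra_simps)
    qed
    show ?thesis unfolding L2_inner_zero_ext * using yz zL by simp
  qed
  also have "\<dots> \<le> (LINT x|lborel. \<bar>y x * z x\<bar>)"
    using yz by (intro integral_mono) auto
  also have "\<dots> \<le> b * a"
    using integral_Cauchy_Schwarz[OF yL lb(1)] by (simp add: a_def b_def L2_norm_zero_ext y_def z_def)
  finally have main: "\<epsilon> * a\<^sup>2 - K * \<epsilon> * T\<^sup>2 * c\<^sup>2 \<le> b * a" .
  define s where "s = sqrt K * T * c"
  have s: "0 \<le> s" "s\<^sup>2 = K * T\<^sup>2 * c\<^sup>2" using KT nonneg by (auto simp: s_def power_mult_distrib)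
  have "a \<le> inverse \<epsilon> * b + s"
  proof (rule ccontr)
    \<comment> \<open>Then \<epsilon> a exceeds b + \<epsilon> s and a exceeds s, so \<epsilon> a^2
      > a b + \<epsilon> s^2, against \<open>main\<close>.\<close>
    assume "\<not> a \<le> inverse \<epsilon> * b + s"
    then have "\<epsilon> * (inverse \<epsilon> * b + s) < \<epsilon> * a" using eps by simp
    moreover have "\<epsilon> * (inverse \<epsilon> * b + s) = b + \<epsilon> * s"
      using eps by (simp add: distrib_left mult.assoc[symmetric])
    ultimately have lt: "b + \<epsilon> * s < \<epsilon> * a" by simp
    have "s \<le> a" "0 < a"
      using \<open>\<not> a \<le> inverse \<epsilon> * b + s\<close> nonneg s eps
      by (smt (verit) mult_nonneg_nonneg inverse_nonnegative_iff_nonnegative)+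
    then have "(b + \<epsilon> * s) * a < \<epsilon> * a * a" using lt by simp
    moreover have "\<epsilon> * s * s \<le> \<epsilon> * s * a" using \<open>s \<le> a\<close> s eps by (intro mult_left_mono) auto
    ultimately show False using main s(2) by (simp add: algebra_simps power2_eq_square)
  qed
  then show ?thesis by (simp add: a_def b_def s_def c_def)
qed

end

section \<open>Second order expansions\<close>

lemma linear_sum_Basis:
  fixes f :: "'a::euclidean_space \<Rightarrow> real"
  assumes "linear f"
  shows "f v = (\<Sum>b\<in>Basis. (v \<bullet> b) * f b)"
proof -
  have "f v = f (\<Sum>b\<in>Basis. (v \<bullet> b) *\<^sub>R b)" by (simp add: euclidean_representation)
  also have "\<dots> = (\<Sum>b\<in>Basis. (v \<bullet> b) * f b)"
    by (simp add: linear_sum[OF assms] linear_scale[OF assms] o_def)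
  finally show ?thesis .
qed

lemma abs_linear_le_sum_Basis:
  fixes f :: "'a::euclidean_space \<Rightarrow> real"
  assumes "linear f"
  shows "\<bar>f v\<bar> \<le> (\<Sum>b\<in>Basis. \<bar>f b\<bar>) * norm v"
proof -
  have "\<bar>f v\<bar> \<le> (\<Sum>b\<in>Basis. \<bar>(v \<bullet> b) * f b\<bar>)"
    unfolding linear_sum_Basis[OF assms, of v] by (rule sum_abs)
  also have "\<dots> \<le> (\<Sum>b\<in>Basis. norm v * \<bar>f b\<bar>)"
    by (intro sum_mono) (simp add: abs_mult Basis_le_norm mult_right_mono)
  finally show ?thesis by (simp add: sum_distrib_left mult.commute)
qed

lemma has_derivative_grad:
  fixes f :: "'a::euclidean_space \<Rightarrow> real"
  assumes "(f has_derivative f') (at x)"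
  shows "grad f x = (\<Sum>b\<in>Basis. f' b *\<^sub>R b)" and "f' h = grad f x \<bullet> h"
proof -
  let ?g = "\<Sum>b\<in>Basis. f' b *\<^sub>R b"
  have lin: "linear f'" using assms by (simp add: has_derivative_linear)
  have eq: "f' h = ?g \<bullet> h" for h
    by (subst linear_sum_Basis[OF lin]) (simp add: inner_sum_left inner_commute[of h] mult.commute)
  have G: "GDERIV f x :> ?g"
  proof -
    have "f' = (\<lambda>h. h \<bullet> ?g)" by (rule ext) (metis eq inner_commute)
    then show ?thesis using assms unfolding gderiv_def by simp
  qed
  have "g = ?g" if "GDERIV f x :> g" for g
  proof -
    have "(\<lambda>h. h \<bullet> g) = (\<lambda>h. h \<bullet> ?g)"
      using that G unfolding gderiv_def by (rule has_derivative_unique)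
    then show ?thesis by (metis vector_eq_ldot)
  qed
  then show *: "grad f x = ?g"
    unfolding grad_def by (rule the_equality[where P="\<lambda>g. GDERIV f x :> g", OF G])
  show "f' h = grad f x \<bullet> h" unfolding * by (rule eq)
qed

lemma continuous_on_compact_bound:
  fixes f :: "'a::metric_space \<Rightarrow> real"
  assumes "compact S" "continuous_on S f"
  obtains M where "0 < M" "\<And>x. x \<in> S \<Longrightarrow> \<bar>f x\<bar> \<le> M"
proof -
  have "bounded (f ` S)" using assms by (intro compact_imp_bounded compact_continuous_image)
  then obtain M where "0 < M" "\<And>y. y \<in> f ` S \<Longrightarrow> norm y \<le> M"
    using bounded_pos by metis
  then show ?thesis by (intro that[of M]) auto
qed

text \<open>S need not be convex, so the segment from x to y may leave it. For short segments the C2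
  extension on a neighbourhood of the closure is used; when |y - x| > \<delta> the Lipschitz and
  gradient bounds are linear in |y - x|, hence quadratic at the price of 1/\<delta>.\<close>

lemma C2_second_order_expansion:
  fixes d :: "'a::euclidean_space \<Rightarrow> real"
  assumes S: "open S" "bounded S" and C2: "C2_on (closure S) d" and lip: "L-lipschitz_on (closure S) d"
  obtains T G where "0 < T" "0 < G"
    "\<And>x. x \<in> S \<Longrightarrow> d differentiable (at x)"
    "\<And>x. x \<in> S \<Longrightarrow> norm (grad d x) \<le> G"
    "\<And>x y. x \<in> S \<Longrightarrow> y \<in> S \<Longrightarrow> \<bar>d y - d x - grad d x \<bullet> (y - x)\<bar> \<le> T * (norm (y - x))\<^sup>2"
proof -
  obtain U g where U: "open U" "closure S \<subseteq> U" and g: "Ck_on 2 U g" "\<And>x. x \<in> closure S \<Longrightarrow> g x = d x"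
    using C2 by (auto simp: C2_on_def)
  define D where "D x v = frechet_derivative g (at x) v" for x v
  define DD where "DD x b w = frechet_derivative (\<lambda>y. D y b) (at x) w" for x b w
  have gD: "(g has_derivative D x) (at x)" if "x \<in> U" for x
    using g(1) that unfolding D_def by (simp add: numeral_2_eq_2 frechet_derivative_works[symmetric] eta_contract_eq)
  have DDx: "((\<lambda>y. D y b) has_derivative DD x b) (at x)" if "x \<in> U" for x b
    using g(1) that unfolding D_def DD_def
    by (simp add: numeral_2_eq_2 frechet_derivative_works[symmetric] eta_contract_eq)
  have DDc: "continuous_on U (\<lambda>x. DD x b w)" for b w
    using g(1) unfolding D_def DD_def by (simp add: numeral_2_eq_2)
  have cS: "compact (closure S)" using S by simp
  obtain \<delta> where \<delta>: "0 < \<delta>" "(\<Union>x\<in>closure S. cball x \<delta>) \<subseteq> U"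
    using compact_subset_open_imp_cball_epsilon_subset[OF cS U] by blast
  \<comment> \<open>The closed \<delta>-neighbourhood of \<open>closure S\<close>: compact as a sum
    of compact sets, so the second derivatives of the extension are bounded on it.\<close>
  define V where "V = (\<Union>x\<in>closure S. \<Union>y\<in>cball 0 \<delta>. {x + y})"
  have V: "compact V" unfolding V_def by (intro compact_sums' cS compact_cball)
  have V_cball: "cball x \<delta> \<subseteq> V" if "x \<in> closure S" for x
  proof
    fix y assume "y \<in> cball x \<delta>"
    then have "y - x \<in> cball 0 \<delta>" by (simp add: dist_norm norm_minus_commute)
    then show "y \<in> V" using that by (force simp: V_def)
  qed
  have VU: "V \<subseteq> U" using \<delta>(2) by (force simp: V_def dist_norm)
  have "continuous_on V (\<lambda>x. \<Sum>b\<in>Basis. \<Sum>c\<in>Basis. \<bar>DD x b c\<bar>)"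
    using continuous_on_subset[OF DDc VU] by (intro continuous_intros)
  then obtain M where M: "0 < M" "\<And>x. x \<in> V \<Longrightarrow> \<bar>\<Sum>b\<in>Basis. \<Sum>c\<in>Basis. \<bar>DD x b c\<bar>\<bar> \<le> M"
    using continuous_on_compact_bound[OF V] by blast
  have DDb: "onorm (DD x b) \<le> M" if "x \<in> V" "b \<in> Basis" for x b
  proof (rule onorm_le)
    fix w
    have "linear (DD x b)" using DDx that VU by (auto intro: has_derivative_linear)
    then have "\<bar>DD x b w\<bar> \<le> (\<Sum>c\<in>Basis. \<bar>DD x b c\<bar>) * norm w" by (rule abs_linear_le_sum_Basis)
    also have "\<dots> \<le> M * norm w"
    proof (rule mult_right_mono)
      have "(\<Sum>c\<in>Basis. \<bar>DD x b c\<bar>) \<le> (\<Sum>b\<in>Basis. \<Sum>c\<in>Basis. \<bar>DD x b c\<bar>)"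
        using that(2) by (intro member_le_sum[of b Basis "\<lambda>b. \<Sum>c\<in>Basis. \<bar>DD x b c\<bar>"]) (auto intro: sum_nonneg)
      then show "(\<Sum>c\<in>Basis. \<bar>DD x b c\<bar>) \<le> M" using M(2)[OF that(1)] by linarith
    qed simp
    finally show "norm (DD x b w) \<le> M * norm w" by simp
  qed
  define n where "n = real DIM('a)"
  have n: "1 \<le> n" using DIM_positive[where 'a='a] by (simp add: n_def Suc_leI)
  have DL: "onorm (\<lambda>v. D y v - D x v) \<le> n * M * norm (y - x)" if x: "x \<in> closure S" and y: "y \<in> cball x \<delta>" for x y
  proof (rule onorm_le)
    fix v
    have inV: "z \<in> V" if "z \<in> cball x \<delta>" for z using V_cball[OF x] that by (rule subsetD)
    have inU: "z \<in> U" if "z \<in> cball x \<delta>" for z using VU inV[OF that] by (rule subsetD)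
    have xU: "x \<in> U" "y \<in> U" using inU y \<delta>(1) by simp_all
    have "linear (\<lambda>v. D y v - D x v)"
      by (intro linear_compose_sub has_derivative_linear[OF gD] xU)
    then have "\<bar>D y v - D x v\<bar> \<le> (\<Sum>b\<in>Basis. \<bar>D y b - D x b\<bar>) * norm v" by (rule abs_linear_le_sum_Basis)
    also have "\<dots> \<le> (\<Sum>b\<in>(Basis::'a set). M * norm (y - x)) * norm v"
    proof (intro mult_right_mono sum_mono)
      fix b :: 'a assume b: "b \<in> Basis"
      have "norm (D y b - D x b) \<le> M * norm (y - x)"
      proof (rule differentiable_bound[of "cball x \<delta>"])
        show "((\<lambda>y. D y b) has_derivative DD z b) (at z within cball x \<delta>)" if "z \<in> cball x \<delta>" for z
          by (rule has_derivative_at_withinI[OF DDx[OF inU[OF that]]])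
        show "onorm (DD z b) \<le> M" if "z \<in> cball x \<delta>" for z
          by (rule DDb[OF inV[OF that] b])
      qed (use y \<delta> in auto)
      then show "\<bar>D y b - D x b\<bar> \<le> M * norm (y - x)" by simp
    qed simp
    also have "\<dots> = n * M * norm (y - x) * norm v" by (simp add: n_def)
    finally show "norm (D y v - D x v) \<le> n * M * norm (y - x) * norm v" by simp
  qed
  have near: "\<bar>g y - g x - D x (y - x)\<bar> \<le> n * M * (norm (y - x))\<^sup>2"
    if x: "x \<in> closure S" and y: "norm (y - x) \<le> \<delta>" for x y
  proof -
    let ?r = "norm (y - x)"
    have sub: "cball x ?r \<subseteq> cball x \<delta>" using y by (simp add: subset_cball)
    have "norm (g y - g x - D x (y - x)) \<le> norm (y - x) * (n * M * ?r)"
    proof (rule differentiable_bound_linearization[of x y "cball x ?r" g D x])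
      show "x + t *\<^sub>R (y - x) \<in> cball x ?r" if "t \<in> {0..1}" for t
        using that by (simp add: dist_norm mult_left_le_one_le)
      show "(g has_derivative D z) (at z within cball x ?r)" if "z \<in> cball x ?r" for z
        by (rule has_derivative_at_withinI[OF gD]) (use that V_cball[OF x] VU sub in blast)
      show "onorm (D z - D x) \<le> n * M * ?r" if z: "z \<in> cball x ?r" for z
      proof -
        have "onorm (\<lambda>v. D z v - D x v) \<le> n * M * norm (z - x)" using z sub by (intro DL x) auto
        also have "\<dots> \<le> n * M * ?r"
          using z n M by (intro mult_left_mono) (auto simp: dist_norm norm_minus_commute)
        finally show ?thesis by (simp add: fun_diff_def)
      qed
    qed simp
    then show ?thesis by (simp add: power2_eq_square mult_ac)
  qed
  have dD: "(d has_derivative D x) (at x)" if "x \<in> S" for x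
    using has_derivative_transform_within_open[OF gD[of x] S(1) that] g(2) that U closure_subset[of S] by blast
  have "continuous_on (closure S) (\<lambda>x. \<Sum>b\<in>Basis. \<bar>D x b\<bar>)"
  proof (intro continuous_intros)
    show "continuous_on (closure S) (\<lambda>x. D x b)" for b
      by (intro continuous_at_imp_continuous_on ballI has_derivative_continuous[OF DDx]) (use U in auto)
  qed
  then obtain G where G: "0 < G" "\<And>x. x \<in> closure S \<Longrightarrow> \<bar>\<Sum>b\<in>Basis. \<bar>D x b\<bar>\<bar> \<le> G"
    using continuous_on_compact_bound[OF cS] by blast
  have gradG: "norm (grad d x) \<le> G" if "x \<in> S" for x
  proof -
    have "norm (grad d x) \<le> (\<Sum>b\<in>Basis. norm (D x b *\<^sub>R b))"
      unfolding has_derivative_grad(1)[OF dD[OF that]] by (rule norm_sum)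
    also have "\<dots> = (\<Sum>b\<in>Basis. \<bar>D x b\<bar>)" by simp
    also have "\<dots> \<le> G" using G(2)[of x] that closure_subset[of S] by auto
    finally show ?thesis .
  qed
  have L: "0 \<le> L" using lip by (rule lipschitz_on_nonneg)
  have exp: "\<bar>d y - d x - grad d x \<bullet> (y - x)\<bar> \<le> (n * M + (L + G) / \<delta>) * (norm (y - x))\<^sup>2"
    if xy: "x \<in> S" "y \<in> S" for x y
  proof (cases "norm (y - x) \<le> \<delta>")
    case True
    have c: "x \<in> closure S" "y \<in> closure S" using xy closure_subset by auto
    have "\<bar>d y - d x - grad d x \<bullet> (y - x)\<bar> \<le> n * M * (norm (y - x))\<^sup>2"
      using near[OF c(1) True] g(2) c has_derivative_grad(2)[OF dD[OF xy(1)]] by simp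
    also have "\<dots> \<le> (n * M + (L + G) / \<delta>) * (norm (y - x))\<^sup>2"
      using L G \<delta> by (intro mult_right_mono) auto
    finally show ?thesis .
  next
    case False
    have "\<bar>d y - d x\<bar> \<le> L * norm (y - x)"
      using lipschitz_onD[OF lip, of y x] xy closure_subset[of S] by (auto simp: dist_real_def dist_norm)
    moreover have "\<bar>grad d x \<bullet> (y - x)\<bar> \<le> G * norm (y - x)"
      using Cauchy_Schwarz_ineq2[of "grad d x" "y - x"] gradG[OF xy(1)]
      by (meson mult_right_mono norm_ge_zero order_trans)
    ultimately have "\<bar>d y - d x - grad d x \<bullet> (y - x)\<bar> \<le> (L + G) * norm (y - x)"
      by (simp add: algebra_simps abs_le_iff)
    also have "\<dots> \<le> (L + G) * (norm (y - x) * (norm (y - x) / \<delta>))"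
    proof -
      have "1 \<le> norm (y - x) / \<delta>" using False \<delta> by simp
      from mult_left_mono[OF this norm_ge_zero[of "y - x"]]
      show ?thesis using L G by (intro mult_left_mono) auto
    qed
    also have "\<dots> = (L + G) / \<delta> * (norm (y - x))\<^sup>2" by (simp add: power2_eq_square)
    also have "\<dots> \<le> (n * M + (L + G) / \<delta>) * (norm (y - x))\<^sup>2"
      using n M by (intro mult_right_mono) auto
    finally show ?thesis .
  qed
  show ?thesis
  proof (rule that)
    show "0 < n * M + (L + G) / \<delta>" using n M L G \<delta> by (intro add_pos_nonneg mult_pos_pos) auto
    show "d differentiable (at x)" if "x \<in> S" for x using dD[OF that] by (auto simp: differentiable_def)
  qed (use G gradG exp in auto)
qed

text \<open>For nonnegative \<open>d\<close>, a gradient step \<open>x - t \<nabla>d(x)\<close> that stays inside the domain cannot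
  make \<open>d\<close> negative, which bounds \<open>\<bar>\<nabla>d\<bar>\<^sup>2\<close> by \<open>d\<close>.\<close>

lemma grad_square_le:
  fixes d :: "'a::euclidean_space \<Rightarrow> real"
  assumes S: "open S" "bounded S" and z: "z \<in> S" and cont: "continuous_on (closure S) d"
    and d0: "\<And>x. x \<in> closure S \<Longrightarrow> 0 \<le> d x" "\<And>x. x \<in> closure S \<Longrightarrow> x \<noteq> z \<Longrightarrow> d x \<noteq> 0"
    and T: "0 < T" and G: "0 < G" "\<And>x. x \<in> S \<Longrightarrow> norm (grad d x) \<le> G"
    and exp: "\<And>x y. x \<in> S \<Longrightarrow> y \<in> S \<Longrightarrow> \<bar>d y - d x - grad d x \<bullet> (y - x)\<bar> \<le> T * (norm (y - x))\<^sup>2"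
  obtains P where "0 < P" "\<And>x. x \<in> S \<Longrightarrow> (norm (grad d x))\<^sup>2 \<le> P * d x"
proof -
  obtain \<rho> where \<rho>: "0 < \<rho>" "ball z \<rho> \<subseteq> S" using S z open_contains_ball by blast
  \<comment> \<open>The first bound keeps the gradient step inside the ball around z, the second
    lets the quadratic remainder use up at most half of the decrease.\<close>
  define t where "t = min (\<rho> / (4 * G)) (1 / (2 * T))"
  have t: "0 < t" "t * G \<le> \<rho> / 4" "t * T \<le> 1 / 2"
    using \<rho> G T by (auto simp: t_def min_def field_simps)
  have near: "(norm (grad d x))\<^sup>2 \<le> 2 / t * d x" if x: "x \<in> ball z (\<rho> / 2)" for x
  proof -
    let ?g = "grad d x"
    let ?y = "x - t *\<^sub>R ?g"
    have xS: "x \<in> S" using x \<rho> by auto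
    have "norm (t *\<^sub>R ?g) \<le> t * G" using G(2)[OF xS] t by simp
    then have "norm (t *\<^sub>R ?g) \<le> \<rho> / 4" using t(2) by (rule order_trans)
    then have "dist z ?y < \<rho>"
      using x \<rho>(1) norm_triangle_ineq[of "z - x" "t *\<^sub>R ?g"] by (simp add: dist_norm algebra_simps)
    then have yS: "?y \<in> S" using \<rho> by auto
    have "0 \<le> d ?y" using d0(1) yS closure_subset by blast
    also have "d ?y \<le> d x + ?g \<bullet> (?y - x) + T * (norm (?y - x))\<^sup>2" using exp[OF xS yS] by linarith
    also have "\<dots> = d x - t * (norm ?g)\<^sup>2 + t * T * t * (norm ?g)\<^sup>2"
    proof -
      have "norm (?y - x) = t * norm ?g" "?g \<bullet> (?y - x) = - (t * (norm ?g)\<^sup>2)"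
        using t by (simp_all add: power2_norm_eq_inner)
      then show ?thesis by (simp only: power_mult_distrib) (simp add: power2_eq_square)
    qed
    also have "\<dots> \<le> d x - t * (norm ?g)\<^sup>2 + 1 / 2 * t * (norm ?g)\<^sup>2"
      using t by (intro add_left_mono mult_right_mono) auto
    finally show ?thesis using t by (simp add: field_simps)
  qed
  \<comment> \<open>Away from z the reciprocal of d is bounded by compactness, and the crude bound
    of the gradient by G is enough.\<close>
  have "compact (closure S - ball z (\<rho> / 2))" using S by (intro compact_diff) auto
  moreover have "continuous_on (closure S - ball z (\<rho> / 2)) (\<lambda>x. inverse (d x))"
  proof (intro continuous_on_inverse ballI)
    show "continuous_on (closure S - ball z (\<rho> / 2)) d" using cont by (rule continuous_on_subset) auto
    show "d x \<noteq> 0" if "x \<in> closure S - ball z (\<rho> / 2)" for x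
      using that \<rho>(1) by (intro d0(2)) auto
  qed
  ultimately obtain m where m: "0 < m" "\<And>x. x \<in> closure S - ball z (\<rho> / 2) \<Longrightarrow> \<bar>inverse (d x)\<bar> \<le> m"
    using continuous_on_compact_bound by blast
  show ?thesis
  proof (rule that)
    show "0 < 2 / t + G\<^sup>2 * m" using t m by (intro add_pos_nonneg) auto
    fix x assume x: "x \<in> S"
    have dx: "0 \<le> d x" using x d0 closure_subset by blast
    show "(norm (grad d x))\<^sup>2 \<le> (2 / t + G\<^sup>2 * m) * d x"
    proof (cases "x \<in> ball z (\<rho> / 2)")
      case True
      have "(norm (grad d x))\<^sup>2 \<le> 2 / t * d x" by (rule near[OF True])
      also have "\<dots> \<le> (2 / t + G\<^sup>2 * m) * d x" using m dx by (intro mult_right_mono) auto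
      finally show ?thesis .
    next
      case False
      then have xz: "x \<in> closure S - ball z (\<rho> / 2)" "x \<noteq> z" using x closure_subset \<rho> by auto
      then have "0 < d x" using dx d0(2) by force
      then have "1 \<le> m * d x" using m(2)[OF xz(1)] by (simp add: field_simps)
      have "(norm (grad d x))\<^sup>2 \<le> G\<^sup>2 * 1" using G(2)[OF x] by (simp add: power_mono)
      also have "\<dots> \<le> G\<^sup>2 * (m * d x)" using \<open>1 \<le> m * d x\<close> by (intro mult_left_mono) auto
      also have "\<dots> \<le> (2 / t + G\<^sup>2 * m) * d x" using t dx by (simp add: distrib_right)
      finally show ?thesis .
    qed
  qed
qed

text \<open>Linearising the first derivatives at z makes the radial derivative at z + v at least
  (m/2)|v|^2, with m the least value of the Hessian on the unit sphere; integration along rays from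
  z then gives the growth.\<close>

lemma nondegenerate_minimum_quadratic_growth:
  fixes f :: "'a::euclidean_space \<Rightarrow> real"
  assumes f: "C2_on UNIV f" and min: "\<And>x. 0 \<le> f x" "f z = 0"
    and pos: "\<And>v. v \<noteq> 0 \<Longrightarrow> 0 < second_deriv f z v v"
  obtains m \<rho> where "0 < m" "0 < \<rho>" "\<And>x. norm (x - z) < \<rho> \<Longrightarrow> m * (norm (x - z))\<^sup>2 \<le> f x"
proof -
  have "Ck_on 2 UNIV f"
  proof -
    obtain U g where "UNIV \<subseteq> U" "Ck_on 2 U g" "\<And>x. g x = f x" using f by (auto simp: C2_on_def)
    moreover from this have "g = f" "U = UNIV" by auto
    ultimately show ?thesis by simp
  qed
  then have Ck: "\<And>x. f differentiable at x" "\<And>x v. (\<lambda>y. frechet_derivative f (at y) v) differentiable at x"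
    by (simp_all add: numeral_2_eq_2)
  define D where "D x v = frechet_derivative f (at x) v" for x v
  define H where "H v w = second_deriv f z v w" for v w
  have fD: "(f has_derivative D x) (at x)" for x
    using Ck(1) unfolding D_def by (simp add: frechet_derivative_works[symmetric] eta_contract_eq)
  have DH: "((\<lambda>y. D y v) has_derivative H v) (at z)" for v
    using Ck(2) unfolding D_def H_def second_deriv_def
    by (simp add: frechet_derivative_works[symmetric] eta_contract_eq)
  have Dlin: "linear (D x)" for x using fD by (rule has_derivative_linear)
  have Hlin: "linear (H v)" for v using DH by (rule has_derivative_linear)
  have D0: "D z = (\<lambda>v. 0)"
    using differential_zero_maxmin[OF _ _ fD[of z], of UNIV] min by auto
  \<comment> \<open>Linearity in the second slot of \<open>second_deriv\<close> is immediate; in the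
    first it follows by expanding the first derivative in the basis and using uniqueness of
    derivatives.\<close>
  have H_left: "H v w = (\<Sum>b\<in>Basis. (v \<bullet> b) * H b w)" for v w
  proof -
    have "((\<lambda>y. \<Sum>b\<in>Basis. (v \<bullet> b) * D y b) has_derivative (\<lambda>w. \<Sum>b\<in>Basis. (v \<bullet> b) * H b w)) (at z)"
      by (intro has_derivative_sum has_derivative_mult_right DH)
    moreover have "(\<lambda>y. \<Sum>b\<in>Basis. (v \<bullet> b) * D y b) = (\<lambda>y. D y v)"
      by (rule ext) (rule linear_sum_Basis[OF Dlin, symmetric])
    ultimately have "((\<lambda>y. D y v) has_derivative (\<lambda>w. \<Sum>b\<in>Basis. (v \<bullet> b) * H b w)) (at z)" by simp
    from has_derivative_unique[OF DH this] show ?thesis by metis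
  qed
  have Hsum: "H v v = (\<Sum>b\<in>Basis. \<Sum>c\<in>Basis. (v \<bullet> b) * (v \<bullet> c) * H b c)" for v
    by (subst H_left, subst linear_sum_Basis[OF Hlin, of _ v]) (simp add: sum_distrib_left mult.assoc)
  have "continuous_on (sphere 0 1) (\<lambda>v. H v v)" unfolding Hsum by (intro continuous_intros)
  moreover have "sphere (0::'a) 1 \<noteq> {}"
    using nonempty_Basis[where 'a='a] norm_Basis by (metis all_not_in_conv mem_sphere_0)
  ultimately obtain e where e: "e \<in> sphere 0 1" "\<And>v. v \<in> sphere 0 1 \<Longrightarrow> H e e \<le> H v v"
    using continuous_attains_inf[OF compact_sphere] by meson
  define m where "m = H e e"
  have "e \<noteq> 0" using e(1) by auto
  then have m: "0 < m" using pos by (simp add: m_def H_def)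
  have Hm: "m * (norm v)\<^sup>2 \<le> H v v" for v
  proof (cases "v = 0")
    case False
    let ?e = "v /\<^sub>R norm v"
    have "H v v = (norm v)\<^sup>2 * H ?e ?e"
      unfolding Hsum sum_distrib_left using False
      by (intro sum.cong refl) (simp add: power2_eq_square field_simps)
    moreover have "m \<le> H ?e ?e" using e(2)[of ?e] False by (simp add: m_def)
    ultimately show ?thesis
      using mult_left_mono[of m "H ?e ?e" "(norm v)\<^sup>2"] by (simp add: mult.commute)
  qed (simp add: Hsum)
  define n where "n = real DIM('a)"
  have n: "1 \<le> n" using DIM_positive[where 'a='a] by (simp add: n_def Suc_leI)
  \<comment> \<open>The linearisation error is counted once per coordinate direction; dividing by 2n
    leaves half of the Hessian bound.\<close>
  define \<eta> where "\<eta> = m / (2 * n)"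
  have \<eta>: "0 < \<eta>" using m n by (simp add: \<eta>_def)
  have "\<forall>b\<in>Basis. \<forall>\<^sub>F x in at z. norm (D x b - H b (x - z)) \<le> \<eta> * norm (x - z)"
  proof
    fix b :: 'a
    have "\<exists>\<rho>>0. \<forall>x. norm (x - z) < \<rho> \<longrightarrow> norm (D x b - D z b - H b (x - z)) \<le> \<eta> * norm (x - z)"
      using DH[of b] \<eta> unfolding has_derivative_at_alt by blast
    then show "\<forall>\<^sub>F x in at z. norm (D x b - H b (x - z)) \<le> \<eta> * norm (x - z)"
      by (auto simp: eventually_at D0 dist_norm)
  qed
  then have "\<forall>\<^sub>F x in at z. \<forall>b\<in>Basis. norm (D x b - H b (x - z)) \<le> \<eta> * norm (x - z)"
    by (intro eventually_ball_finite) auto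
  then obtain \<rho> where \<rho>: "0 < \<rho>"
    "\<And>x b. x \<noteq> z \<Longrightarrow> norm (x - z) < \<rho> \<Longrightarrow> b \<in> Basis \<Longrightarrow> \<bar>D x b - H b (x - z)\<bar> \<le> \<eta> * norm (x - z)"
    by (auto simp: eventually_at dist_norm)
  have Dm: "m / 2 * (norm v)\<^sup>2 \<le> D (z + v) v" if "norm v < \<rho>" for v
  proof (cases "v = 0")
    case False
    have "H v v - D (z + v) v = (\<Sum>b\<in>Basis. (v \<bullet> b) * (H b v - D (z + v) b))"
      by (subst H_left, subst linear_sum_Basis[OF Dlin, of _ v]) (simp add: sum_subtractf right_diff_distrib)
    also have "\<dots> \<le> (\<Sum>b\<in>(Basis::'a set). norm v * (\<eta> * norm v))"
    proof (rule sum_mono)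
      fix b :: 'a assume b: "b \<in> Basis"
      have "\<bar>(v \<bullet> b) * (H b v - D (z + v) b)\<bar> \<le> norm v * (\<eta> * norm v)"
        unfolding abs_mult using \<rho>(2)[of "z + v" b] that False b
        by (intro mult_mono) (auto simp: Basis_le_norm abs_minus_commute)
      then show "(v \<bullet> b) * (H b v - D (z + v) b) \<le> norm v * (\<eta> * norm v)" by linarith
    qed
    also have "\<dots> = m / 2 * (norm v)\<^sup>2" using n by (simp add: \<eta>_def n_def power2_eq_square)
    finally have "H v v - D (z + v) v \<le> m / 2 * (norm v)\<^sup>2" .
    then show ?thesis using Hm[of v] by (simp add: field_simps)
  qed (use D0 in simp)
  show ?thesis
  proof (rule that[of "m / 4" \<rho>])
    fix x assume x: "norm (x - z) < \<rho>"
    define v where "v = x - z"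
    \<comment> \<open>The comparison parabola is chosen so that the derivative of \<open>h\<close>
      is exactly what \<open>Dm\<close> shows to be nonnegative after division by t.\<close>
    define h where "h t = f (z + t *\<^sub>R v) - m / 4 * (norm v)\<^sup>2 * t\<^sup>2" for t
    have "h 0 \<le> h 1"
    proof (rule DERIV_nonneg_imp_nondecreasing[of 0 1 h])
      fix t :: real assume t: "0 \<le> t" "t \<le> 1"
      have "((\<lambda>t. f (z + t *\<^sub>R v)) has_derivative (\<lambda>s. D (z + t *\<^sub>R v) (s *\<^sub>R v))) (at t)"
        by (rule has_derivative_compose[OF _ fD]) (auto intro!: derivative_eq_intros)
      then have "((\<lambda>t. f (z + t *\<^sub>R v)) has_real_derivative D (z + t *\<^sub>R v) v) (at t)"
        unfolding has_field_derivative_def using linear_scale[OF Dlin] by (simp add: mult_commute_abs)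
      then have "(h has_real_derivative (D (z + t *\<^sub>R v) v - m / 2 * (norm v)\<^sup>2 * t)) (at t)"
        unfolding h_def[abs_def] by (auto intro!: derivative_eq_intros)
      moreover have "0 \<le> D (z + t *\<^sub>R v) v - m / 2 * (norm v)\<^sup>2 * t"
      proof (cases "t = 0")
        case False
        have "norm (t *\<^sub>R v) < \<rho>"
          using t x by (simp add: v_def) (metis mult_left_le_one_le norm_ge_zero le_less_trans)
        from Dm[OF this] have "m / 2 * (norm v)\<^sup>2 * t * t \<le> D (z + t *\<^sub>R v) v * t"
          using linear_scale[OF Dlin] by (simp add: power_mult_distrib power2_eq_square mult_ac)
        then have "m / 2 * (norm v)\<^sup>2 * t \<le> D (z + t *\<^sub>R v) v"
          using t False by (metis less_eq_real_def mult_le_cancel_right not_less)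
        then show ?thesis by simp
      qed (simp add: D0)
      ultimately show "\<exists>y. (h has_real_derivative y) (at t) \<and> 0 \<le> y" by blast
    qed simp
    then show "m / 4 * (norm (x - z))\<^sup>2 \<le> f x" using min(2) by (simp add: h_def v_def)
  qed (use m \<rho> in auto)
qed

text \<open>Near z both functions are compared with |x - z|^2, f from below and d from above.
  Outside a ball the compactness bounds A on d and B on 1/f give f \<ge> 1/B \<ge> c A \<ge> c
  d.\<close>

lemma potential_dominates:
  fixes d f :: "'a::euclidean_space \<Rightarrow> real"
  assumes S: "bounded S" "z \<in> S"
    and f: "continuous_on (closure S) f" "\<And>x. x \<in> closure S \<Longrightarrow> x \<noteq> z \<Longrightarrow> 0 < f x"
    and growth: "0 < m" "0 < \<rho>" "\<And>x. norm (x - z) < \<rho> \<Longrightarrow> m * (norm (x - z))\<^sup>2 \<le> f x"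
    and d: "continuous_on (closure S) d" "0 < T" "\<And>x. x \<in> S \<Longrightarrow> d x \<le> T * (norm (x - z))\<^sup>2"
  obtains c where "0 < c" "\<And>x. x \<in> S \<Longrightarrow> c * d x \<le> f x"
proof -
  have K: "compact (closure S)" "compact (closure S - ball z \<rho>)" using S by (auto intro: compact_diff)
  obtain A where A: "0 < A" "\<And>x. x \<in> closure S \<Longrightarrow> \<bar>d x\<bar> \<le> A"
    using continuous_on_compact_bound[OF K(1) d(1)] by blast
  have "continuous_on (closure S - ball z \<rho>) (\<lambda>x. inverse (f x))"
    using f growth(2) by (intro continuous_on_inverse) (force intro: continuous_on_subset)+
  then obtain B where B: "0 < B" "\<And>x. x \<in> closure S - ball z \<rho> \<Longrightarrow> \<bar>inverse (f x)\<bar> \<le> B"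
    using continuous_on_compact_bound[OF K(2)] by blast
  define c where "c = min (m / T) (1 / (A * B))"
  have c: "0 < c" "c * T \<le> m" "c * A \<le> 1 / B"
    using growth(1) d(2) A(1) B(1) by (auto simp: c_def min_def field_simps)
  show ?thesis
  proof (rule that[OF c(1)])
    fix x assume x: "x \<in> S"
    then have xc: "x \<in> closure S" using closure_subset by auto
    show "c * d x \<le> f x"
    proof (cases "norm (x - z) < \<rho>")
      case True
      have "c * d x \<le> c * (T * (norm (x - z))\<^sup>2)" using d(3)[OF x] c by (intro mult_left_mono) auto
      also have "\<dots> \<le> m * (norm (x - z))\<^sup>2" using c by (simp add: mult.assoc[symmetric] mult_right_mono)
      also have "\<dots> \<le> f x" by (rule growth(3)[OF True])
      finally show ?thesis .
    next
      case False
      then have fx: "0 < f x" using f(2)[OF xc] growth(2) by force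
      have "x \<in> closure S - ball z \<rho>" using False xc by (simp add: dist_norm norm_minus_commute)
      then have "1 / B \<le> f x" using B fx by (force simp: field_simps)
      moreover have "c * d x \<le> c * A" using A(2)[OF xc] c by (intro mult_left_mono) auto
      ultimately show ?thesis using c by linarith
    qed
  qed
qed

section \<open>Exponential moments of the jump kernel\<close>

lemma abs_cosh_diff_le:
  fixes a b :: real
  assumes "\<bar>a\<bar> \<le> r" "\<bar>b\<bar> \<le> r"
  shows "\<bar>cosh a - cosh b\<bar> \<le> exp r * \<bar>a - b\<bar>"
proof -
  have "\<bar>exp a - exp b\<bar> \<le> exp r * \<bar>a - b\<bar>" "\<bar>exp (- a) - exp (- b)\<bar> \<le> exp r * \<bar>a - b\<bar>"
    using abs_exp_diff_le[of a r b] abs_exp_diff_le[of "- a" r "- b"] assms by (auto simp: abs_minus_commute)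
  moreover have "\<bar>(x + y) / 2 - (z + w) / 2\<bar> \<le> c" if "\<bar>x - z\<bar> \<le> c" "\<bar>y - w\<bar> \<le> c" for x y z w c :: real
  proof -
    have *: "(x + y) / 2 - (z + w) / 2 = ((x - z) + (y - w)) / 2" by (simp add: field_simps)
    show ?thesis unfolding * abs_divide using abs_triangle_ineq[of "x - z" "y - w"] that by simp
  qed
  ultimately show ?thesis unfolding cosh_field_def by blast
qed

text \<open>From cosh a - 1 = 2 sinh(a/2)^2. The quadratic factor makes the expression integrable
  against kernels singular at 0, the exponential one is covered by the exponential moments.\<close>

lemma cosh_minus_one_le:
  fixes a :: real
  assumes "\<bar>a\<bar> \<le> r"
  shows "cosh a - 1 \<le> a\<^sup>2 * exp r"
proof -
  have *: "\<bar>exp (a / 2) - exp (- (a / 2))\<bar> \<le> exp (r / 2) * \<bar>a\<bar>"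
    using abs_exp_diff_le[of "a / 2" "r / 2" "- (a / 2)"] assms by auto
  have "cosh a - 1 = (exp (a / 2) - exp (- (a / 2)))\<^sup>2 / 2"
  proof -
    have "exp (a / 2) * exp (- (a / 2)) = 1" "(exp (a / 2))\<^sup>2 = exp a" "(exp (- (a / 2)))\<^sup>2 = exp (- a)"
      by (simp_all flip: exp_add exp_double)
    then show ?thesis by (simp add: cosh_field_def power2_diff mult.assoc diff_divide_distrib add_divide_distrib)
  qed
  also have "\<dots> \<le> (exp (r / 2) * \<bar>a\<bar>)\<^sup>2 / 2"
    using power_mono[OF *, of 2] by simp
  also have "\<dots> = a\<^sup>2 * exp r / 2"
    by (simp add: power_mult_distrib flip: exp_double)
  also have "\<dots> \<le> a\<^sup>2 * exp r" by simp
  finally show ?thesis .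
qed

lemma cosh_scale_le:
  fixes s l :: real
  assumes "0 \<le> l" "l \<le> 1"
  shows "cosh (l * s) - 1 \<le> l * (cosh s - 1)"
proof -
  have "exp (l * s) \<le> l * exp s + (1 - l)" for s :: real
    using convex_onD[OF exp_convex, of l 0 s] assms by (simp add: algebra_simps)
  from this[of s] this[of "- s"] show ?thesis by (simp add: cosh_field_def field_simps)
qed

text \<open>The measures can be infinite near 0, so the comparison is kept additive, and it passes
  from sets to integrands by the standard induction.\<close>

lemma nn_integral_le_add_measure:
  fixes f :: "'b \<Rightarrow> ennreal"
  assumes sets: "sets M = sets P" "sets N = sets P"
    and le: "\<And>E. E \<in> sets P \<Longrightarrow> emeasure M E \<le> emeasure N E + emeasure P E"
    and f: "f \<in> borel_measurable P"
  shows "(\<integral>\<^sup>+x. f x \<partial>M) \<le> (\<integral>\<^sup>+x. f x \<partial>N) + (\<integral>\<^sup>+x. f x \<partial>P)"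
  using f
proof (induction f rule: borel_measurable_induct)
  case (cong f g)
  have "(\<integral>\<^sup>+x. f x \<partial>R) = (\<integral>\<^sup>+x. g x \<partial>R)" if "sets R = sets P" for R
    using cong(3) sets_eq_imp_space_eq[OF that] by (intro nn_integral_cong) auto
  then show ?case using cong(4) sets by simp
next
  case (set A)
  then show ?case using le sets by simp
next
  case (mult u c)
  have "u \<in> borel_measurable M" "u \<in> borel_measurable N"
    using mult(2) sets by (simp_all cong: measurable_cong_sets)
  then show ?case using mult by (simp add: nn_integral_cmult flip: distrib_left) (rule mult_left_mono, auto)
next
  case (add u v)
  have "u \<in> borel_measurable M" "u \<in> borel_measurable N" "v \<in> borel_measurable M" "v \<in> borel_measurable N"
    using add sets by (simp_all cong: measurable_cong_sets)
  moreover have "(\<integral>\<^sup>+x. u x \<partial>M) \<le> (\<integral>\<^sup>+x. u x \<partial>N) + (\<integral>\<^sup>+x. u x \<partial>P)"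
    "(\<integral>\<^sup>+x. v x \<partial>M) \<le> (\<integral>\<^sup>+x. v x \<partial>N) + (\<integral>\<^sup>+x. v x \<partial>P)" by fact+
  note add_mono[OF this]
  ultimately show ?case using add by (simp add: nn_integral_add ac_simps)
next
  case (seq U)
  have m: "U i \<in> borel_measurable M" for i
    using seq(1) sets by (simp cong: measurable_cong_sets)
  have "(\<integral>\<^sup>+x. (SUP i. U i) x \<partial>M) = (SUP i. \<integral>\<^sup>+x. U i x \<partial>M)"
    unfolding SUP_apply using seq m by (intro nn_integral_monotone_convergence_SUP) auto
  also have "\<dots> \<le> (\<integral>\<^sup>+x. (SUP i. U i) x \<partial>N) + (\<integral>\<^sup>+x. (SUP i. U i) x \<partial>P)"
  proof (rule SUP_least)
    fix i
    have "(\<integral>\<^sup>+x. U i x \<partial>M) \<le> (\<integral>\<^sup>+x. U i x \<partial>N) + (\<integral>\<^sup>+x. U i x \<partial>P)" by (rule seq)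
    also have "\<dots> \<le> (\<integral>\<^sup>+x. (SUP i. U i) x \<partial>N) + (\<integral>\<^sup>+x. (SUP i. U i) x \<partial>P)"
      by (intro add_mono nn_integral_mono) (auto intro: SUP_upper)
    finally show "(\<integral>\<^sup>+x. U i x \<partial>M) \<le> (\<integral>\<^sup>+x. (SUP i. U i) x \<partial>N) + (\<integral>\<^sup>+x. (SUP i. U i) x \<partial>P)" .
  qed
  finally show ?case by simp
qed

section \<open>Moments of the kernel, uniform in x\<close>

lemma measurable_punctured:
  "sets M = sets punctured \<Longrightarrow> f \<in> measurable borel N \<Longrightarrow> f \<in> measurable M N"
  by (simp add: measurable_restrict_space1 cong: measurable_cong_sets)

text \<open>Near 0 the exponential is at most e^L; for |\<gamma>| > 1 the bound |\<gamma>|^2 \<le> 2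
  e^|\<gamma>| absorbs the square into the exponent L + 1. The factor 2 + e^L covers both
  cases.\<close>

lemma exp_moment_pointwise:
  fixes \<gamma> :: "'a::real_normed_vector"
  assumes "0 \<le> L"
  shows "ennreal ((norm \<gamma>)\<^sup>2 * exp (L * norm \<gamma>)) \<le>
    ennreal (2 + exp L) * (ennreal ((norm \<gamma>)\<^sup>2) * indicator {\<gamma>. norm \<gamma> \<le> 1} \<gamma>) +
    ennreal (2 + exp L) * (ennreal (exp ((L + 1) * norm \<gamma>)) * indicator {\<gamma>. 1 \<le> norm \<gamma>} \<gamma>)"
proof (cases "norm \<gamma> \<le> 1")
  case True
  have "L * norm \<gamma> \<le> L" using True assms by (simp add: mult_left_le)
  then have "(norm \<gamma>)\<^sup>2 * exp (L * norm \<gamma>) \<le> (2 + exp L) * (norm \<gamma>)\<^sup>2"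
    by (subst mult.commute) (intro mult_right_mono, auto intro: order_trans[of _ "exp L"])
  then have "ennreal ((norm \<gamma>)\<^sup>2 * exp (L * norm \<gamma>)) \<le> ennreal (2 + exp L) * ennreal ((norm \<gamma>)\<^sup>2)"
    by (simp add: ennreal_mult[symmetric] add_nonneg_nonneg ennreal_leI del: ennreal_plus)
  then show ?thesis using True by (simp add: add_increasing2 del: ennreal_plus)
next
  case False
  have "(norm \<gamma>)\<^sup>2 \<le> 2 * exp (norm \<gamma>)"
    using exp_lower_Taylor_quadratic[of "norm \<gamma>"] norm_ge_zero[of \<gamma>] by linarith
  then have "(norm \<gamma>)\<^sup>2 * exp (L * norm \<gamma>) \<le> 2 * exp (norm \<gamma>) * exp (L * norm \<gamma>)"
    by (intro mult_right_mono) auto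
  also have "\<dots> = 2 * exp ((L + 1) * norm \<gamma>)" by (simp add: mult.assoc distrib_right add.commute flip: exp_add)
  also have "\<dots> \<le> (2 + exp L) * exp ((L + 1) * norm \<gamma>)" by (intro mult_right_mono) auto
  finally have "ennreal ((norm \<gamma>)\<^sup>2 * exp (L * norm \<gamma>)) \<le> ennreal (2 + exp L) * ennreal (exp ((L + 1) * norm \<gamma>))"
    by (simp add: ennreal_mult[symmetric] add_nonneg_nonneg ennreal_leI del: ennreal_plus)
  then show ?thesis using False by (simp del: ennreal_plus)
qed

lemma kernel_moments:
  fixes K :: "real \<Rightarrow> 'a::euclidean_space \<Rightarrow> 'a measure"
  assumes B: "assumption_B_kernel \<epsilon>\<^sub>0 K K\<^sub>0 R\<^sub>p R\<^sub>m" and \<epsilon>\<^sub>0: "0 < \<epsilon>\<^sub>0" and "0 \<le> L"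
  obtains C where "0 < C"
    "\<And>x. (\<integral>\<^sup>+\<gamma>. ennreal ((norm \<gamma>)\<^sup>2 * exp (L * norm \<gamma>)) \<partial>K\<^sub>0 x) \<le> ennreal C"
    "\<And>x \<epsilon>. \<epsilon> \<in> {0<..\<epsilon>\<^sub>0} \<Longrightarrow> (\<integral>\<^sup>+\<gamma>. ennreal ((norm \<gamma>)\<^sup>2 * exp (L * norm \<gamma>)) \<partial>R\<^sub>p \<epsilon> x) \<le> ennreal (C * \<epsilon>)"
proof -
  \<comment> \<open>(B) provides exponential moments for positive exponents; L + 1 qualifies even
    when L = 0.\<close>
  have "0 < L + 1" using \<open>0 \<le> L\<close> by simp
  then obtain C where C: "0 < C" "\<And>x \<epsilon>. \<epsilon> \<in> {0<..\<epsilon>\<^sub>0} \<Longrightarrow>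
        (\<integral>\<^sup>+\<gamma>\<in>{\<gamma>. 1 \<le> norm \<gamma>}. ennreal (exp ((L + 1) * norm \<gamma>)) \<partial>K\<^sub>0 x) \<le> ennreal C \<and>
        variation_integral (R\<^sub>p \<epsilon> x) (R\<^sub>m \<epsilon> x)
          (\<lambda>\<gamma>. ennreal (exp ((L + 1) * norm \<gamma>)) * indicator {\<gamma>. 1 \<le> norm \<gamma>} \<gamma>) \<le> ennreal (C * \<epsilon>) \<and>
        (\<integral>\<^sup>+\<gamma>\<in>{\<gamma>. norm \<gamma> \<le> 1}. ennreal ((norm \<gamma>)\<^sup>2) \<partial>K\<^sub>0 x) \<le> ennreal C \<and>
        variation_integral (R\<^sub>p \<epsilon> x) (R\<^sub>m \<epsilon> x)
          (\<lambda>\<gamma>. ennreal ((norm \<gamma>)\<^sup>2) * indicator {\<gamma>. norm \<gamma> \<le> 1} \<gamma>) \<le> ennreal (C * \<epsilon>)"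
    using B[unfolded assumption_B_kernel_def, THEN conjunct2, THEN conjunct2, THEN conjunct1,
      THEN spec[of _ "L + 1"], THEN mp, OF \<open>0 < L + 1\<close>] by blast
  define A where "A = 2 + exp L"
  have A: "0 < A" by (simp add: A_def add_pos_pos)
  have le: "(\<integral>\<^sup>+\<gamma>. ennreal ((norm \<gamma>)\<^sup>2 * exp (L * norm \<gamma>)) \<partial>M) \<le> ennreal (2 * A * c)"
    if M: "sets M = sets punctured" and c: "0 \<le> c"
      and 1: "(\<integral>\<^sup>+\<gamma>\<in>{\<gamma>. 1 \<le> norm \<gamma>}. ennreal (exp ((L + 1) * norm \<gamma>)) \<partial>M) \<le> ennreal c"
      and 2: "(\<integral>\<^sup>+\<gamma>\<in>{\<gamma>. norm \<gamma> \<le> 1}. ennreal ((norm \<gamma>)\<^sup>2) \<partial>M) \<le> ennreal c"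
    for M :: "'a measure" and c
  proof -
    have m: "(\<lambda>\<gamma>. ennreal ((norm \<gamma>)\<^sup>2) * indicator {\<gamma>. norm \<gamma> \<le> 1} \<gamma>) \<in> borel_measurable M"
      "(\<lambda>\<gamma>. ennreal (exp ((L + 1) * norm \<gamma>)) * indicator {\<gamma>. 1 \<le> norm \<gamma>} \<gamma>) \<in> borel_measurable M"
      by (intro measurable_punctured[OF M]; measurable)+
    have "(\<integral>\<^sup>+\<gamma>. ennreal ((norm \<gamma>)\<^sup>2 * exp (L * norm \<gamma>)) \<partial>M) \<le>
      (\<integral>\<^sup>+\<gamma>. ennreal A * (ennreal ((norm \<gamma>)\<^sup>2) * indicator {\<gamma>. norm \<gamma> \<le> 1} \<gamma>) +
        ennreal A * (ennreal (exp ((L + 1) * norm \<gamma>)) * indicator {\<gamma>. 1 \<le> norm \<gamma>} \<gamma>) \<partial>M)"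
      unfolding A_def by (intro nn_integral_mono exp_moment_pointwise \<open>0 \<le> L\<close>)
    also have "\<dots> = ennreal A * (\<integral>\<^sup>+\<gamma>\<in>{\<gamma>. norm \<gamma> \<le> 1}. ennreal ((norm \<gamma>)\<^sup>2) \<partial>M) +
        ennreal A * (\<integral>\<^sup>+\<gamma>\<in>{\<gamma>. 1 \<le> norm \<gamma>}. ennreal (exp ((L + 1) * norm \<gamma>)) \<partial>M)"
      using m by (simp add: nn_integral_add nn_integral_cmult)
    also have "\<dots> \<le> ennreal A * ennreal c + ennreal A * ennreal c"
      by (intro add_mono mult_left_mono 1 2) auto
    also have "\<dots> = ennreal (2 * A * c)"
      using A c by (simp add: ennreal_mult[symmetric] ennreal_plus[symmetric] del: ennreal_plus)
    finally show ?thesis .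
  qed
  have sets: "sets (K\<^sub>0 x) = sets punctured" "\<epsilon> \<in> {0<..\<epsilon>\<^sub>0} \<Longrightarrow> sets (R\<^sub>p \<epsilon> x) = sets punctured" for x \<epsilon>
    using B by (auto simp: assumption_B_kernel_def signed_difference_def)
  have var: "(\<integral>\<^sup>+\<gamma>. f \<gamma> \<partial>P) \<le> c" if "variation_integral P R f \<le> c" for P R :: "'a measure" and f c
    using that unfolding variation_integral_def by (meson add_increasing2 order_refl order_trans zero_le)
  show ?thesis
  proof (rule that)
    show "0 < 2 * A * C" using A C by simp
    \<comment> \<open>The bound on the limiting kernel is stated under a quantifier over \<epsilon>,
      so an admissible value must be supplied, here \<open>\<epsilon>\<^sub>0\<close>
      itself.\<close>
    show "(\<integral>\<^sup>+\<gamma>. ennreal ((norm \<gamma>)\<^sup>2 * exp (L * norm \<gamma>)) \<partial>K\<^sub>0 x) \<le> ennreal (2 * A * C)" for x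
      using C(1) C(2)[of \<epsilon>\<^sub>0 x] \<epsilon>\<^sub>0 by (intro le sets) auto
    fix x \<epsilon> assume \<epsilon>: "\<epsilon> \<in> {0<..\<epsilon>\<^sub>0}"
    have "(\<integral>\<^sup>+\<gamma>. ennreal ((norm \<gamma>)\<^sup>2 * exp (L * norm \<gamma>)) \<partial>R\<^sub>p \<epsilon> x) \<le> ennreal (2 * A * (C * \<epsilon>))"
      using C(1) C(2)[OF \<epsilon>, of x] \<epsilon> by (intro le sets) (auto dest: var)
    then show "(\<integral>\<^sup>+\<gamma>. ennreal ((norm \<gamma>)\<^sup>2 * exp (L * norm \<gamma>)) \<partial>R\<^sub>p \<epsilon> x) \<le> ennreal (2 * A * C * \<epsilon>)"
      by (simp add: mult.assoc)
  qed
qed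

lemma nn_integral_kernel_le:
  fixes f :: "'a::euclidean_space \<Rightarrow> ennreal"
  assumes B: "assumption_B_kernel \<epsilon>\<^sub>0 K K\<^sub>0 R\<^sub>p R\<^sub>m" and \<epsilon>: "\<epsilon> \<in> {0<..\<epsilon>\<^sub>0}"
    and K: "sets (K \<epsilon> x) = sets punctured" and f: "f \<in> borel_measurable borel"
  shows "(\<integral>\<^sup>+\<gamma>. f \<gamma> \<partial>K \<epsilon> x) \<le> (\<integral>\<^sup>+\<gamma>. f \<gamma> \<partial>K\<^sub>0 x) + (\<integral>\<^sup>+\<gamma>. f \<gamma> \<partial>R\<^sub>p \<epsilon> x)"
proof (rule nn_integral_le_add_measure)
  have sd: "signed_difference (K \<epsilon> x) (K\<^sub>0 x) (R\<^sub>p \<epsilon> x) (R\<^sub>m \<epsilon> x)"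
    and K0: "sets (K\<^sub>0 x) = sets punctured" using B \<epsilon> by (auto simp: assumption_B_kernel_def)
  then have R: "sets (R\<^sub>p \<epsilon> x) = sets punctured" by (simp add: signed_difference_def)
  show "sets (K \<epsilon> x) = sets (R\<^sub>p \<epsilon> x)" "sets (K\<^sub>0 x) = sets (R\<^sub>p \<epsilon> x)"
    using R K K0 by simp_all
  show "f \<in> borel_measurable (R\<^sub>p \<epsilon> x)" by (rule measurable_punctured[OF R f])
  fix E assume "E \<in> sets (R\<^sub>p \<epsilon> x)"
  then have "emeasure (K \<epsilon> x) E + emeasure (R\<^sub>m \<epsilon> x) E = emeasure (K\<^sub>0 x) E + emeasure (R\<^sub>p \<epsilon> x) E"
    using sd R by (simp add: signed_difference_def)
  then show "emeasure (K \<epsilon> x) E \<le> emeasure (K\<^sub>0 x) E + emeasure (R\<^sub>p \<epsilon> x) E"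
    by (metis add_increasing2 order_refl zero_le)
qed

lemma kernel_second_moment:
  fixes K :: "real \<Rightarrow> 'a::euclidean_space \<Rightarrow> 'a measure"
  assumes B: "assumption_B_kernel \<epsilon>\<^sub>0 K K\<^sub>0 R\<^sub>p R\<^sub>m" and \<epsilon>\<^sub>0: "0 < \<epsilon>\<^sub>0"
    and K: "\<And>\<epsilon> x. \<epsilon> \<in> {0<..\<epsilon>\<^sub>0} \<Longrightarrow> sets (K \<epsilon> x) = sets punctured"
  obtains C where "0 < C" "\<And>\<epsilon> x. \<epsilon> \<in> {0<..\<epsilon>\<^sub>0} \<Longrightarrow> (\<integral>\<^sup>+\<gamma>. ennreal ((norm \<gamma>)\<^sup>2) \<partial>K \<epsilon> x) \<le> ennreal C"
proof -
  obtain C where C: "0 < C"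
    "\<And>x. (\<integral>\<^sup>+\<gamma>. ennreal ((norm \<gamma>)\<^sup>2) \<partial>K\<^sub>0 x) \<le> ennreal C"
    "\<And>x \<epsilon>. \<epsilon> \<in> {0<..\<epsilon>\<^sub>0} \<Longrightarrow> (\<integral>\<^sup>+\<gamma>. ennreal ((norm \<gamma>)\<^sup>2) \<partial>R\<^sub>p \<epsilon> x) \<le> ennreal (C * \<epsilon>)"
    using kernel_moments[OF B \<epsilon>\<^sub>0 order_refl] by auto
  show ?thesis
  proof (rule that)
    show "0 < C + C * \<bar>\<epsilon>\<^sub>0\<bar>" using C by (simp add: add_pos_nonneg)
    fix \<epsilon> x assume \<epsilon>: "\<epsilon> \<in> {0<..\<epsilon>\<^sub>0}"
    have "(\<integral>\<^sup>+\<gamma>. ennreal ((norm \<gamma>)\<^sup>2) \<partial>K \<epsilon> x) \<le>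
        (\<integral>\<^sup>+\<gamma>. ennreal ((norm \<gamma>)\<^sup>2) \<partial>K\<^sub>0 x) + (\<integral>\<^sup>+\<gamma>. ennreal ((norm \<gamma>)\<^sup>2) \<partial>R\<^sub>p \<epsilon> x)"
      by (rule nn_integral_kernel_le[where K=K, OF B \<epsilon> K[OF \<epsilon>]]) measurable
    also have "\<dots> \<le> ennreal C + ennreal (C * \<epsilon>)" by (intro add_mono C(2,3) \<epsilon>)
    also have "\<dots> = ennreal (C + C * \<epsilon>)" using C \<epsilon> by simp
    also have "\<dots> \<le> ennreal (C + C * \<bar>\<epsilon>\<^sub>0\<bar>)"
      using C \<epsilon> by (intro ennreal_leI add_left_mono mult_left_mono) auto
    finally show "(\<integral>\<^sup>+\<gamma>. ennreal ((norm \<gamma>)\<^sup>2) \<partial>K \<epsilon> x) \<le> ennreal (C + C * \<bar>\<epsilon>\<^sub>0\<bar>)" .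
  qed
qed

text \<open>Kernel comparisons are made between nonnegative integrals. The second claim translates
  the Bochner integral that defines \<open>t0_tilde\<close> into one of these.\<close>

lemma t0_tilde_integrable:
  fixes \<xi> :: "'a::euclidean_space"
  assumes B: "assumption_B_kernel \<epsilon>\<^sub>0 K K\<^sub>0 R\<^sub>p R\<^sub>m" and \<epsilon>\<^sub>0: "0 < \<epsilon>\<^sub>0"
  shows "integrable (K\<^sub>0 x) (\<lambda>\<gamma>. cosh (\<gamma> \<bullet> \<xi>) - 1)"
    and "(\<integral>\<^sup>+\<gamma>. ennreal (cosh (\<gamma> \<bullet> \<xi>) - 1) \<partial>K\<^sub>0 x) = ennreal (t0_tilde K\<^sub>0 x \<xi>)"
proof -
  have sets: "sets (K\<^sub>0 x) = sets punctured" using B by (simp add: assumption_B_kernel_def)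
  have m: "(\<lambda>\<gamma>. cosh (\<gamma> \<bullet> \<xi>) - 1) \<in> borel_measurable (K\<^sub>0 x)"
    unfolding cosh_field_def by (rule measurable_punctured[OF sets]) measurable
  obtain C where C: "(\<integral>\<^sup>+\<gamma>. ennreal ((norm \<gamma>)\<^sup>2 * exp (norm \<xi> * norm \<gamma>)) \<partial>K\<^sub>0 x) \<le> ennreal C"
    using kernel_moments[OF B \<epsilon>\<^sub>0 norm_ge_zero[of \<xi>]] by metis
  have "(\<integral>\<^sup>+\<gamma>. ennreal (cosh (\<gamma> \<bullet> \<xi>) - 1) \<partial>K\<^sub>0 x) \<le>
      (\<integral>\<^sup>+\<gamma>. ennreal ((norm \<xi>)\<^sup>2) * ennreal ((norm \<gamma>)\<^sup>2 * exp (norm \<xi> * norm \<gamma>)) \<partial>K\<^sub>0 x)"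
  proof (rule nn_integral_mono)
    fix \<gamma>
    have cs: "\<bar>\<gamma> \<bullet> \<xi>\<bar> \<le> norm \<xi> * norm \<gamma>" using Cauchy_Schwarz_ineq2[of \<gamma> \<xi>] by (simp add: mult.commute)
    have "cosh (\<gamma> \<bullet> \<xi>) - 1 \<le> (\<gamma> \<bullet> \<xi>)\<^sup>2 * exp (norm \<xi> * norm \<gamma>)" by (rule cosh_minus_one_le[OF cs])
    also have "\<dots> \<le> (norm \<xi> * norm \<gamma>)\<^sup>2 * exp (norm \<xi> * norm \<gamma>)"
      using power_mono[OF cs, of 2] by (intro mult_right_mono) auto
    finally show "ennreal (cosh (\<gamma> \<bullet> \<xi>) - 1) \<le> ennreal ((norm \<xi>)\<^sup>2) * ennreal ((norm \<gamma>)\<^sup>2 * exp (norm \<xi> * norm \<gamma>))"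
      by (simp add: ennreal_mult[symmetric] power_mult_distrib mult.assoc ennreal_leI)
  qed
  also have "\<dots> = ennreal ((norm \<xi>)\<^sup>2) * (\<integral>\<^sup>+\<gamma>. ennreal ((norm \<gamma>)\<^sup>2 * exp (norm \<xi> * norm \<gamma>)) \<partial>K\<^sub>0 x)"
    by (intro nn_integral_cmult measurable_punctured[OF sets]) measurable
  also have "\<dots> \<le> ennreal ((norm \<xi>)\<^sup>2) * ennreal C" by (intro mult_left_mono C) simp
  also have "\<dots> < \<infinity>" by (simp add: ennreal_mult_less_top)
  finally show int: "integrable (K\<^sub>0 x) (\<lambda>\<gamma>. cosh (\<gamma> \<bullet> \<xi>) - 1)"
    using m by (intro integrableI_nonneg) (auto simp: cosh_real_ge_1)
  show "(\<integral>\<^sup>+\<gamma>. ennreal (cosh (\<gamma> \<bullet> \<xi>) - 1) \<partial>K\<^sub>0 x) = ennreal (t0_tilde K\<^sub>0 x \<xi>)"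
    unfolding t0_tilde_def using int by (intro nn_integral_eq_integral) (auto simp: cosh_real_ge_1)
qed

lemma t0_tilde_nonneg: "0 \<le> t0_tilde K\<^sub>0 x \<xi>"
  unfolding t0_tilde_def by (intro Bochner_Integration.integral_nonneg) (simp add: cosh_real_ge_1)

text \<open>Convexity in \<xi> together with the value 0 at \<xi> = 0. It pulls the factor
  \<open>\<psi>'(d / \<epsilon>)\<close> out of the Hamiltonian, after which the eikonal inequality
  applies to the gradient of d itself.\<close>

lemma t0_tilde_scale:
  assumes B: "assumption_B_kernel \<epsilon>\<^sub>0 K K\<^sub>0 R\<^sub>p R\<^sub>m" "0 < \<epsilon>\<^sub>0" and l: "0 \<le> l" "l \<le> 1"
  shows "t0_tilde K\<^sub>0 x (l *\<^sub>R \<xi>) \<le> l * t0_tilde K\<^sub>0 x \<xi>"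
proof -
  have "t0_tilde K\<^sub>0 x (l *\<^sub>R \<xi>) \<le> (LINT \<gamma>|K\<^sub>0 x. l * (cosh (\<gamma> \<bullet> \<xi>) - 1))"
    unfolding t0_tilde_def
    using cosh_scale_le[OF l] t0_tilde_integrable(1)[OF B, of x "l *\<^sub>R \<xi>"] t0_tilde_integrable(1)[OF B, of x \<xi>]
    by (intro integral_mono) auto
  then show ?thesis by (simp add: t0_tilde_def)
qed

text \<open>Against the limiting kernel, replacing a \<gamma> by its linear part costs T \<epsilon>
  |\<gamma>|^2 e^(L|\<gamma>|). The perturbation already has size \<epsilon>, so there a crude
  quadratic bound on cosh - 1 suffices. The constant depends on the phase only through L and
  T.\<close>

lemma jump_cosh_integral_le:
  fixes K :: "real \<Rightarrow> 'a::euclidean_space \<Rightarrow> 'a measure"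
  assumes B: "assumption_B_kernel \<epsilon>\<^sub>0 K K\<^sub>0 R\<^sub>p R\<^sub>m" and \<epsilon>\<^sub>0: "0 < \<epsilon>\<^sub>0"
    and K: "\<And>\<epsilon> x. \<epsilon> \<in> {0<..\<epsilon>\<^sub>0} \<Longrightarrow> sets (K \<epsilon> x) = sets punctured"
    and LT: "0 \<le> L" "0 \<le> T"
  obtains C where "0 < C"
    "\<And>\<epsilon> x a \<xi>. \<epsilon> \<in> {0<..\<epsilon>\<^sub>0} \<Longrightarrow> a \<in> borel_measurable borel \<Longrightarrow> norm \<xi> \<le> L \<Longrightarrow>
      (\<And>\<gamma>. \<bar>a \<gamma>\<bar> \<le> L * norm \<gamma>) \<Longrightarrow> (\<And>\<gamma>. \<bar>a \<gamma> - \<gamma> \<bullet> \<xi>\<bar> \<le> T * \<epsilon> * (norm \<gamma>)\<^sup>2) \<Longrightarrow>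
      (\<integral>\<^sup>+\<gamma>. ennreal (cosh (a \<gamma>) - 1) \<partial>K \<epsilon> x) \<le> ennreal (t0_tilde K\<^sub>0 x \<xi> + C * \<epsilon>)"
proof -
  obtain C where C: "0 < C"
    "\<And>x. (\<integral>\<^sup>+\<gamma>. ennreal ((norm \<gamma>)\<^sup>2 * exp (L * norm \<gamma>)) \<partial>K\<^sub>0 x) \<le> ennreal C"
    "\<And>x \<epsilon>. \<epsilon> \<in> {0<..\<epsilon>\<^sub>0} \<Longrightarrow> (\<integral>\<^sup>+\<gamma>. ennreal ((norm \<gamma>)\<^sup>2 * exp (L * norm \<gamma>)) \<partial>R\<^sub>p \<epsilon> x) \<le> ennreal (C * \<epsilon>)"
    using kernel_moments[OF B \<epsilon>\<^sub>0 LT(1)] by blast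
  show ?thesis
  proof (rule that)
    \<comment> \<open>T comes from the linearisation error, \<open>L\<^sup>2\<close> from the
      perturbation, and 1 ensures positivity.\<close>
    show "0 < (T + L\<^sup>2 + 1) * C" using C LT by (simp add: add_nonneg_pos)
    fix \<epsilon> x a and \<xi> :: 'a
    assume \<epsilon>: "\<epsilon> \<in> {0<..\<epsilon>\<^sub>0}" and a: "a \<in> borel_measurable borel" and \<xi>: "norm \<xi> \<le> L"
      and aL: "\<And>\<gamma>. \<bar>a \<gamma>\<bar> \<le> L * norm \<gamma>" and aT: "\<And>\<gamma>. \<bar>a \<gamma> - \<gamma> \<bullet> \<xi>\<bar> \<le> T * \<epsilon> * (norm \<gamma>)\<^sup>2"
    let ?w = "\<lambda>\<gamma>::'a. (norm \<gamma>)\<^sup>2 * exp (L * norm \<gamma>)"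
    have sets: "sets (K\<^sub>0 x) = sets punctured" "sets (R\<^sub>p \<epsilon> x) = sets punctured"
      using B \<epsilon> by (auto simp: assumption_B_kernel_def signed_difference_def)
    have wm: "(\<lambda>\<gamma>. ennreal (?w \<gamma>)) \<in> borel_measurable borel" by measurable
    have bL: "\<bar>\<gamma> \<bullet> \<xi>\<bar> \<le> L * norm \<gamma>" for \<gamma>
      using Cauchy_Schwarz_ineq2[of \<gamma> \<xi>] mult_left_mono[OF \<xi> norm_ge_zero[of \<gamma>]] by (simp add: mult.commute)
    have "(\<integral>\<^sup>+\<gamma>. ennreal (cosh (a \<gamma>) - 1) \<partial>K\<^sub>0 x) \<le>
        (\<integral>\<^sup>+\<gamma>. ennreal (cosh (\<gamma> \<bullet> \<xi>) - 1) + ennreal (T * \<epsilon>) * ennreal (?w \<gamma>) \<partial>K\<^sub>0 x)"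
    proof (rule nn_integral_mono)
      fix \<gamma>
      have "cosh (a \<gamma>) - cosh (\<gamma> \<bullet> \<xi>) \<le> exp (L * norm \<gamma>) * \<bar>a \<gamma> - \<gamma> \<bullet> \<xi>\<bar>"
        using abs_cosh_diff_le[OF aL bL] by (simp add: abs_le_iff)
      also have "\<dots> \<le> exp (L * norm \<gamma>) * (T * \<epsilon> * (norm \<gamma>)\<^sup>2)" by (intro mult_left_mono aT) simp
      finally have "cosh (a \<gamma>) - 1 \<le> (cosh (\<gamma> \<bullet> \<xi>) - 1) + T * \<epsilon> * ?w \<gamma>" by (simp add: mult_ac)
      then show "ennreal (cosh (a \<gamma>) - 1) \<le> ennreal (cosh (\<gamma> \<bullet> \<xi>) - 1) + ennreal (T * \<epsilon>) * ennreal (?w \<gamma>)"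
        using LT \<epsilon> by (simp add: ennreal_mult[symmetric] ennreal_plus[symmetric] cosh_real_ge_1 ennreal_leI del: ennreal_plus)
    qed
    also have "\<dots> = (\<integral>\<^sup>+\<gamma>. ennreal (cosh (\<gamma> \<bullet> \<xi>) - 1) \<partial>K\<^sub>0 x) + ennreal (T * \<epsilon>) * (\<integral>\<^sup>+\<gamma>. ennreal (?w \<gamma>) \<partial>K\<^sub>0 x)"
    proof (subst nn_integral_add)
      show "(\<lambda>\<gamma>. ennreal (cosh (\<gamma> \<bullet> \<xi>) - 1)) \<in> borel_measurable (K\<^sub>0 x)"
        unfolding cosh_field_def by (rule measurable_punctured[OF sets(1)]) measurable
      show "(\<lambda>\<gamma>. ennreal (T * \<epsilon>) * ennreal (?w \<gamma>)) \<in> borel_measurable (K\<^sub>0 x)"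
        by (rule measurable_punctured[OF sets(1)]) measurable
    qed (simp add: nn_integral_cmult[OF measurable_punctured[OF sets(1) wm]])
    also have "\<dots> \<le> ennreal (t0_tilde K\<^sub>0 x \<xi>) + ennreal (T * \<epsilon>) * ennreal C"
      unfolding t0_tilde_integrable(2)[OF B \<epsilon>\<^sub>0] by (intro add_left_mono mult_left_mono C(2)) simp
    also have "\<dots> = ennreal (t0_tilde K\<^sub>0 x \<xi> + T * C * \<epsilon>)"
      using LT \<epsilon> C(1) t0_tilde_nonneg[of K\<^sub>0 x \<xi>]
      by (simp add: ennreal_mult[symmetric] ennreal_plus[symmetric] mult_ac del: ennreal_plus)
    finally have 1: "(\<integral>\<^sup>+\<gamma>. ennreal (cosh (a \<gamma>) - 1) \<partial>K\<^sub>0 x) \<le> ennreal (t0_tilde K\<^sub>0 x \<xi> + T * C * \<epsilon>)" .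
    have "(\<integral>\<^sup>+\<gamma>. ennreal (cosh (a \<gamma>) - 1) \<partial>R\<^sub>p \<epsilon> x) \<le> (\<integral>\<^sup>+\<gamma>. ennreal (L\<^sup>2) * ennreal (?w \<gamma>) \<partial>R\<^sub>p \<epsilon> x)"
    proof (rule nn_integral_mono)
      fix \<gamma>
      have "cosh (a \<gamma>) - 1 \<le> (a \<gamma>)\<^sup>2 * exp (L * norm \<gamma>)" by (rule cosh_minus_one_le[OF aL])
      also have "\<dots> \<le> (L * norm \<gamma>)\<^sup>2 * exp (L * norm \<gamma>)"
        using power_mono[OF aL, of \<gamma> 2] by (intro mult_right_mono) auto
      finally show "ennreal (cosh (a \<gamma>) - 1) \<le> ennreal (L\<^sup>2) * ennreal (?w \<gamma>)"
        by (simp add: ennreal_mult[symmetric] power_mult_distrib mult.assoc ennreal_leI)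
    qed
    also have "\<dots> = ennreal (L\<^sup>2) * (\<integral>\<^sup>+\<gamma>. ennreal (?w \<gamma>) \<partial>R\<^sub>p \<epsilon> x)"
      by (rule nn_integral_cmult[OF measurable_punctured[OF sets(2) wm]])
    also have "\<dots> \<le> ennreal (L\<^sup>2) * ennreal (C * \<epsilon>)" by (intro mult_left_mono C(3) \<epsilon>) simp
    also have "\<dots> = ennreal (L\<^sup>2 * C * \<epsilon>)" using C(1) \<epsilon> by (simp add: ennreal_mult[symmetric] mult.assoc)
    finally have 2: "(\<integral>\<^sup>+\<gamma>. ennreal (cosh (a \<gamma>) - 1) \<partial>R\<^sub>p \<epsilon> x) \<le> ennreal (L\<^sup>2 * C * \<epsilon>)" .
    have "(\<integral>\<^sup>+\<gamma>. ennreal (cosh (a \<gamma>) - 1) \<partial>K \<epsilon> x) \<le>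
        (\<integral>\<^sup>+\<gamma>. ennreal (cosh (a \<gamma>) - 1) \<partial>K\<^sub>0 x) + (\<integral>\<^sup>+\<gamma>. ennreal (cosh (a \<gamma>) - 1) \<partial>R\<^sub>p \<epsilon> x)"
      unfolding cosh_field_def
      by (rule nn_integral_kernel_le[where K=K, OF B \<epsilon> K[OF \<epsilon>]]) (use a in measurable)
    also have "\<dots> \<le> ennreal (t0_tilde K\<^sub>0 x \<xi> + T * C * \<epsilon>) + ennreal (L\<^sup>2 * C * \<epsilon>)"
      by (rule add_mono[OF 1 2])
    also have "\<dots> = ennreal (t0_tilde K\<^sub>0 x \<xi> + T * C * \<epsilon> + L\<^sup>2 * C * \<epsilon>)"
      using LT \<epsilon> C(1) t0_tilde_nonneg[of K\<^sub>0 x \<xi>] by (intro ennreal_plus[symmetric]) auto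
    also have "\<dots> \<le> ennreal (t0_tilde K\<^sub>0 x \<xi> + (T + L\<^sup>2 + 1) * C * \<epsilon>)"
      using \<epsilon> C(1) by (intro ennreal_leI) (simp add: algebra_simps)
    finally show "(\<integral>\<^sup>+\<gamma>. ennreal (cosh (a \<gamma>) - 1) \<partial>K \<epsilon> x) \<le> ennreal (t0_tilde K\<^sub>0 x \<xi> + (T + L\<^sup>2 + 1) * C * \<epsilon>)" .
  qed
qed

section \<open>The Agmon weight\<close>

text \<open>The shift by B matters: with ln (1 + s) the derivative 1 - B / (1 + s) would be negative
  for s < B - 1, while s / (B + s) lies in [0, 1) and can serve as a convexity parameter.\<close>

definition agmon_profile :: "real \<Rightarrow> real \<Rightarrow> real" where
  "agmon_profile B s = s - B * ln (B + s)"

lemma agmon_profile_lipschitz: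
  assumes B: "0 < B" and s: "0 \<le> s" "0 \<le> s'"
  shows "\<bar>agmon_profile B s' - agmon_profile B s\<bar> \<le> \<bar>s' - s\<bar>"
proof -
  have le: "0 \<le> agmon_profile B s' - agmon_profile B s \<and> agmon_profile B s' - agmon_profile B s \<le> s' - s"
    if "s \<le> s'" "0 \<le> s" for s s'
  proof -
    have "ln (B + s) \<le> ln (B + s')" using that B by simp
    then have 1: "0 \<le> B * (ln (B + s') - ln (B + s))" using B by simp
    have "ln (B + s') - ln (B + s) \<le> (s' - s) / (B + s)"
      using ln_diff_le[of "B + s'" "B + s"] that B by simp
    then have "B * (ln (B + s') - ln (B + s)) \<le> B * ((s' - s) / (B + s))"
      using B by (intro mult_left_mono) auto
    also have "\<dots> = B / (B + s) * (s' - s)" by simp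
    also have "\<dots> \<le> 1 * (s' - s)" using that B by (intro mult_right_mono) auto
    finally show ?thesis using 1 by (simp add: agmon_profile_def right_diff_distrib)
  qed
  show ?thesis using le[of s s'] le[of s' s] s by (cases "s \<le> s'") auto
qed

text \<open>r is the convexity remainder of the profile. With A = B + s and A' = B + s', the bound
  ln t \<le> t - 1 used in both directions gives 0 \<le> r \<le> B (A' - A)^2 / (A A'); both upper
  estimates, neither with a constant that grows with B, are read off from this.\<close>

lemma agmon_profile_expansion:
  assumes B: "0 < B" and s: "0 \<le> s" "0 \<le> s'"
  defines "r \<equiv> agmon_profile B s' - agmon_profile B s - s / (B + s) * (s' - s)"
  shows "0 \<le> r" "r \<le> (s' - s)\<^sup>2 / (B + s)" "r \<le> \<bar>s' - s\<bar>"
proof -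
  define A where "A = B + s"
  define A' where "A' = B + s'"
  have A: "0 < A" "0 < A'" "B \<le> A" "B \<le> A'" using B s by (auto simp: A_def A'_def)
  have sA: "s / (B + s) = 1 - B / A" using A by (simp add: A_def field_simps)
  have ss: "s' - s = A' - A" by (simp add: A_def A'_def)
  have r: "r = B * ((A' - A) / A - (ln A' - ln A))"
    unfolding r_def agmon_profile_def sA ss by (simp add: A_def A'_def algebra_simps)
  show "0 \<le> r"
    using ln_diff_le[of A' A] A B unfolding r by simp
  have "ln A - ln A' \<le> (A - A') / A'" using ln_diff_le[of A A'] A by simp
  then have "r \<le> B * ((A' - A) / A + (A - A') / A')"
    unfolding r using B by (intro mult_left_mono) auto
  also have "\<dots> = B / A' * ((A' - A)\<^sup>2 / A)" using A by (simp add: field_simps power2_eq_square)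
  finally have le: "r \<le> B / A' * ((A' - A)\<^sup>2 / A)" .
  also have "\<dots> \<le> 1 * ((A' - A)\<^sup>2 / A)" using A B by (intro mult_right_mono) auto
  finally show "r \<le> (s' - s)\<^sup>2 / (B + s)" by (simp add: ss A_def)
  \<comment> \<open>B is at most the smaller of A and A', and their distance is at most the
    larger.\<close>
  have "B * \<bar>A' - A\<bar> \<le> A * A'"
  proof (cases "A \<le> A'")
    case True
    then have "B * \<bar>A' - A\<bar> \<le> A * A'" using A B by (intro mult_mono) auto
    then show ?thesis .
  next
    case False
    then have "B * \<bar>A' - A\<bar> \<le> A' * A" using A B by (intro mult_mono) auto
    then show ?thesis by (simp add: mult.commute)
  qed
  then have "B * \<bar>A' - A\<bar> / (A * A') \<le> 1" using A by simp
  have "B / A' * ((A' - A)\<^sup>2 / A) = B * \<bar>A' - A\<bar> / (A * A') * \<bar>A' - A\<bar>"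
  proof -
    have sq: "(A' - A)\<^sup>2 = \<bar>A' - A\<bar> * \<bar>A' - A\<bar>" by (simp add: power2_eq_square)
    have "B / A' * (X * X / A) = B * X / (A * A') * X" for X by (simp add: mult_ac)
    then show ?thesis unfolding sq .
  qed
  also have "\<dots> \<le> 1 * \<bar>A' - A\<bar>" by (intro mult_right_mono abs_ge_zero) fact
  finally show "r \<le> \<bar>s' - s\<bar>" using le by (simp add: ss)
qed

text \<open>The two regimes \<open>\<bar>y - x\<bar>\<^sup>2 \<le> d x\<close> and \<open>d x < \<bar>y - x\<bar>\<^sup>2\<close> use the two bounds of the
  previous lemma; the resulting constant depends neither on \<open>B\<close> nor on \<open>\<epsilon>\<close>.\<close>

lemma agmon_phase_expansion:
  fixes d :: "'a::euclidean_space \<Rightarrow> real"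
  assumes B: "0 < B" and \<epsilon>: "0 < \<epsilon>" and d: "0 \<le> d x" "0 \<le> d y" and TP: "0 < T" "0 < P"
    and P: "(norm \<xi>)\<^sup>2 \<le> P * d x"
    and exp: "\<bar>d y - d x - \<xi> \<bullet> (y - x)\<bar> \<le> T * (norm (y - x))\<^sup>2"
  defines "q \<equiv> sqrt P + T" and "l \<equiv> (d x / \<epsilon>) / (B + d x / \<epsilon>)"
  shows "\<bar>agmon_profile B (d y / \<epsilon>) - agmon_profile B (d x / \<epsilon>) - (l *\<^sub>R \<xi>) \<bullet> (y - x) / \<epsilon>\<bar>
    \<le> (T + q\<^sup>2 + q) * (norm (y - x))\<^sup>2 / \<epsilon>"
proof -
  let ?h = "norm (y - x)"
  define s where "s = d x / \<epsilon>"
  define s' where "s' = d y / \<epsilon>"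
  have s: "0 \<le> s" "0 \<le> s'" using d \<epsilon> by (auto simp: s_def s'_def)
  define r where "r = agmon_profile B s' - agmon_profile B s - s / (B + s) * (s' - s)"
  note re = agmon_profile_expansion[OF B s, folded r_def]
  have q: "0 < q" using TP by (simp add: q_def add_pos_pos)
  have l: "0 \<le> l" "l \<le> 1" using s B by (auto simp: l_def s_def[symmetric])
  have "norm \<xi> \<le> sqrt P * sqrt (d x)"
    using P by (simp add: real_le_rsqrt flip: real_sqrt_mult)
  then have "\<bar>\<xi> \<bullet> (y - x)\<bar> \<le> sqrt P * sqrt (d x) * ?h"
    using Cauchy_Schwarz_ineq2[of \<xi> "y - x"] by (meson mult_right_mono norm_ge_zero order_trans)
  then have dd: "\<bar>d y - d x\<bar> \<le> sqrt P * sqrt (d x) * ?h + T * ?h\<^sup>2" using exp by linarith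
  have ss: "s' - s = (d y - d x) / \<epsilon>" by (simp add: s_def s'_def diff_divide_distrib)
  have "r \<le> (q\<^sup>2 + q) * ?h\<^sup>2 / \<epsilon>"
  proof (cases "?h\<^sup>2 \<le> d x")
    case True
    show ?thesis
    proof (cases "d x = 0")
      case True
      \<comment> \<open>At the zero of d this regime forces y = x; it is separated because the main
        estimate divides by s.\<close>
      then have "?h = 0" "s = 0" using \<open>?h\<^sup>2 \<le> d x\<close> by (auto simp: s_def)
      moreover from this have "s' = 0" by (simp add: s'_def) (use True in simp)
      ultimately show ?thesis using re(3) q \<epsilon> by simp
    next
      case False
      then have dx: "0 < d x" using d by simp
      have h: "?h \<le> sqrt (d x)" using True by (simp add: real_le_rsqrt)
      then have "?h\<^sup>2 \<le> sqrt (d x) * ?h" by (simp add: power2_eq_square mult_right_mono)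
      then have "T * ?h\<^sup>2 \<le> T * (sqrt (d x) * ?h)" using TP by (intro mult_left_mono) auto
      then have "\<bar>d y - d x\<bar> \<le> q * (sqrt (d x) * ?h)"
        using dd by (simp add: q_def distrib_right mult.assoc)
      then have "(d y - d x)\<^sup>2 \<le> (q * (sqrt (d x) * ?h))\<^sup>2"
        using power_mono[of "\<bar>d y - d x\<bar>" _ 2] by simp
      then have sq: "(d y - d x)\<^sup>2 \<le> q\<^sup>2 * d x * ?h\<^sup>2" using dx by (simp add: power_mult_distrib mult.assoc)
      have "r \<le> (s' - s)\<^sup>2 / (B + s)" by (rule re(2))
      \<comment> \<open>Dropping B from the denominator removes the dependence on B; the factor d x
        gained from the gradient bound then cancels against s.\<close>
      also have "\<dots> \<le> (s' - s)\<^sup>2 / s"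
      proof -
        have "0 < s" using dx \<epsilon> by (simp add: s_def)
        then show ?thesis using B by (intro divide_left_mono mult_pos_pos) auto
      qed
      also have "\<dots> = (d y - d x)\<^sup>2 / (d x * \<epsilon>)"
        using dx \<epsilon> unfolding ss by (simp add: s_def power_divide power2_eq_square field_simps)
      also have "\<dots> \<le> q\<^sup>2 * d x * ?h\<^sup>2 / (d x * \<epsilon>)" using sq dx \<epsilon> by (intro divide_right_mono) auto
      also have "\<dots> = q\<^sup>2 * ?h\<^sup>2 / \<epsilon>" using dx by simp
      also have "\<dots> \<le> (q\<^sup>2 + q) * ?h\<^sup>2 / \<epsilon>" using q \<epsilon> by (intro divide_right_mono mult_right_mono) auto
      finally show ?thesis .
    qed
  next
    case False
    then have "sqrt (d x) \<le> ?h" by (simp add: real_le_lsqrt d)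
    then have "sqrt P * sqrt (d x) * ?h \<le> sqrt P * ?h\<^sup>2"
      using TP by (simp add: power2_eq_square mult.assoc mult_left_mono mult_right_mono)
    then have "\<bar>d y - d x\<bar> \<le> q * ?h\<^sup>2" using dd by (simp add: q_def algebra_simps)
    have "r \<le> \<bar>d y - d x\<bar> / \<epsilon>" using re(3) \<epsilon> by (simp add: ss)
    also have "\<dots> \<le> q * ?h\<^sup>2 / \<epsilon>" by (intro divide_right_mono) (use \<open>\<bar>d y - d x\<bar> \<le> q * ?h\<^sup>2\<close> \<epsilon> in auto)
    also have "\<dots> \<le> (q\<^sup>2 + q) * ?h\<^sup>2 / \<epsilon>" using q \<epsilon> by (intro divide_right_mono mult_right_mono) auto
    finally show ?thesis .
  qed
  then have r: "\<bar>r\<bar> \<le> (q\<^sup>2 + q) * ?h\<^sup>2 / \<epsilon>" using re(1) by simp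
  \<comment> \<open>The remainder splits into the convexity remainder r of the profile and the
    Taylor remainder of d, scaled by the slope l \<le> 1.\<close>
  let ?m = "l * ((d y - d x - \<xi> \<bullet> (y - x)) / \<epsilon>)"
  have m: "\<bar>?m\<bar> \<le> T * ?h\<^sup>2 / \<epsilon>"
  proof -
    have "\<bar>?m\<bar> \<le> 1 * (T * ?h\<^sup>2 / \<epsilon>)"
      unfolding abs_mult abs_divide using l exp \<epsilon> by (intro mult_mono divide_mono) auto
    then show ?thesis by simp
  qed
  have eq: "agmon_profile B (d y / \<epsilon>) - agmon_profile B (d x / \<epsilon>) - (l *\<^sub>R \<xi>) \<bullet> (y - x) / \<epsilon> = r + ?m"
    unfolding r_def ss by (simp add: l_def s_def s'_def diff_divide_distrib right_diff_distrib)
  have "\<bar>r + ?m\<bar> \<le> \<bar>r\<bar> + \<bar>?m\<bar>" by (rule abs_triangle_ineq)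
  also have "\<dots> \<le> (q\<^sup>2 + q) * ?h\<^sup>2 / \<epsilon> + T * ?h\<^sup>2 / \<epsilon>" by (rule add_mono[OF r m])
  also have "\<dots> = (T + q\<^sup>2 + q) * ?h\<^sup>2 / \<epsilon>" by (simp add: distrib_right add_divide_distrib)
  finally show ?thesis unfolding eq .
qed

text \<open>For B \<ge> 1 one has 1 + s \<le> B + s \<le> B (1 + s), so replacing 1 + s by B + s in
  the power costs at most the factor B^B = \<open>exp (B * ln B)\<close>.\<close>

lemma exp_agmon_profile_weight:
  assumes B: "1 \<le> B" and s: "0 \<le> d x / \<epsilon>"
  shows "exp (agmon_profile B (d x / \<epsilon>)) \<le> weight B \<epsilon> d x"
    and "weight B \<epsilon> d x \<le> exp (B * ln B) * exp (agmon_profile B (d x / \<epsilon>))"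
proof -
  let ?s = "d x / \<epsilon>"
  have w: "weight B \<epsilon> d x = exp (?s - B * ln (1 + ?s))"
    using s by (simp add: weight_def powr_def exp_diff exp_minus field_simps)
  have "ln (1 + ?s) \<le> ln (B + ?s)" using B s by simp
  then show "exp (agmon_profile B ?s) \<le> weight B \<epsilon> d x"
    using B unfolding w agmon_profile_def by (simp add: mult_left_mono)
  have "B + ?s \<le> B * (1 + ?s)" using mult_right_mono[OF B s] by (simp add: distrib_left)
  then have "ln (B + ?s) \<le> ln (B * (1 + ?s))" using B s by (subst ln_le_cancel_iff) auto
  also have "\<dots> = ln B + ln (1 + ?s)" using B s by (subst ln_mult) auto
  finally have "B * ln (B + ?s) \<le> B * (ln B + ln (1 + ?s))" using B by (intro mult_left_mono) auto
  then show "weight B \<epsilon> d x \<le> exp (B * ln B) * exp (agmon_profile B ?s)"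
    unfolding w agmon_profile_def mult_exp_exp by (simp add: distrib_left)
qed

lemma L2_norm_le:
  assumes v: "square_integrable lborel (zero_ext S v)" and le: "\<And>x. x \<in> S \<Longrightarrow> \<bar>u x\<bar> \<le> c * \<bar>v x\<bar>" and c: "0 \<le> c"
  shows "L2_norm S u \<le> c * L2_norm S v"
proof -
  have pw: "(zero_ext S u x)\<^sup>2 \<le> c\<^sup>2 * (zero_ext S v x)\<^sup>2" for x
    using power_mono[OF le, of x 2] by (auto simp: zero_ext_def power_mult_distrib indicator_def)
  have "(LINT x|lborel. (zero_ext S u x)\<^sup>2) \<le> (LINT x|lborel. c\<^sup>2 * (zero_ext S v x)\<^sup>2)"
  proof (cases "integrable lborel (\<lambda>x. (zero_ext S u x)\<^sup>2)")
    case True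
    then show ?thesis using v pw by (intro integral_mono) auto
  next
    \<comment> \<open>A divergent integral is 0 by convention, so the inequality still holds on this
      side; for v integrability is assumed.\<close>
    case False
    then show ?thesis
      by (simp add: not_integrable_integral_eq Bochner_Integration.integral_nonneg)
  qed
  then have "sqrt (LINT x|lborel. (zero_ext S u x)\<^sup>2) \<le> sqrt (c\<^sup>2 * (LINT x|lborel. (zero_ext S v x)\<^sup>2))"
    by simp
  then show ?thesis using c by (simp add: L2_norm_zero_ext real_sqrt_mult)
qed

lemma C2_on_imp_continuous_on: "C2_on S f \<Longrightarrow> continuous_on S f"
proof -
  assume "C2_on S f"
  then obtain U g where "S \<subseteq> U" "Ck_on 2 U g" "\<forall>x\<in>S. g x = f x" by (auto simp: C2_on_def)
  then have "continuous_on S g"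
    by (intro continuous_at_imp_continuous_on)
      (auto simp: numeral_2_eq_2 intro!: differentiable_imp_continuous_within)
  then show ?thesis using \<open>\<forall>x\<in>S. g x = f x\<close> by (simp cong: continuous_on_cong_simp)
qed

text \<open>(A) makes the potential nonnegative only almost everywhere; for a continuous function
  the open set of negative values, being null, is empty.\<close>

lemma continuous_AE_nonneg:
  fixes W :: "'a::euclidean_space \<Rightarrow> real"
  assumes W: "continuous_on UNIV W" and AE: "AE x in lborel. 0 \<le> W x"
  shows "0 \<le> W x"
proof (rule ccontr)
  assume "\<not> 0 \<le> W x"
  then have "x \<in> {x. W x < 0}" by simp
  then have ne: "{x. W x < 0} \<noteq> {}" by blast
  have op: "open {x. W x < 0}" using W by (intro open_Collect_less continuous_on_const)
  then have "{x. W x < 0} \<in> null_sets lborel"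
    using AE by (intro AE_iff_null_sets[THEN iffD2]) (auto simp: not_less)
  then have "negligible {x. W x < 0}" by (simp add: negligible_iff_null_sets null_sets_completionI)
  then show False using open_not_negligible[OF op ne] by simp
qed

section \<open>Choice of constants and the estimate uniform in the small parameter\<close>

lemma agmon_uniform_estimate:
  fixes \<epsilon>\<^sub>0 R\<^sub>0 :: real
    and K :: "real \<Rightarrow> 'a::euclidean_space \<Rightarrow> 'a measure"
    and K\<^sub>0 :: "'a \<Rightarrow> 'a measure"
    and R\<^sub>p R\<^sub>m :: "real \<Rightarrow> 'a \<Rightarrow> 'a measure"
    and V :: "real \<Rightarrow> 'a \<Rightarrow> real" and V\<^sub>0 :: "'a \<Rightarrow> real" and R\<^sub>1 :: "'a \<Rightarrow> real \<Rightarrow> real"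
    and r j :: nat and z :: "nat \<Rightarrow> 'a"
    and \<Sigma> \<Omega> U :: "'a set" and d :: "'a \<Rightarrow> real"
  assumes \<epsilon>\<^sub>0: "\<epsilon>\<^sub>0 > 0"
    and A: "assumption_A \<epsilon>\<^sub>0 K V"
    and Bk: "assumption_B_kernel \<epsilon>\<^sub>0 K K\<^sub>0 R\<^sub>p R\<^sub>m"
    and Bp: "assumption_B_potential \<epsilon>\<^sub>0 V V\<^sub>0 R\<^sub>1 r z"
    and C: "assumption_C K\<^sub>0 V\<^sub>0 r z j \<Sigma> \<Omega> U d"
    and \<Sigma>\<Omega>: "\<Sigma> = \<Omega>"
    and R\<^sub>0: "R\<^sub>0 > 0"
  shows "\<exists>B C. 0 < B \<and> 0 < C \<and> (\<forall>\<epsilon>\<in>{0<..\<epsilon>\<^sub>0}. \<forall>E\<in>{0..\<epsilon> * R\<^sub>0}.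
    \<forall>(u, f)\<in>H_dirichlet \<epsilon> (K \<epsilon>) (V \<epsilon>) \<Sigma> \<union> H_neumann \<epsilon> (K \<epsilon>) (V \<epsilon>) \<Sigma>.
      L2_norm \<Sigma> (\<lambda>x. weight B \<epsilon> d x * u x)
      \<le> C * (inverse \<epsilon> * L2_norm \<Sigma> (\<lambda>x. weight B \<epsilon> d x * (f x - E * u x)) + L2_norm \<Sigma> u))"
proof -
  have \<Sigma>: "open \<Sigma>" "bounded \<Sigma>" "z j \<in> \<Sigma>" "j \<in> {1..r}"
    and zk: "\<And>k. k \<in> {1..r} \<Longrightarrow> k \<noteq> j \<Longrightarrow> z k \<notin> closure \<Sigma>"
    and d0: "\<And>x. x \<in> closure \<Sigma> \<Longrightarrow> 0 \<le> d x" "d (z j) = 0"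
      "\<And>x. x \<in> closure \<Sigma> \<Longrightarrow> x \<noteq> z j \<Longrightarrow> d x \<noteq> 0"
    and dC2: "C2_on (closure \<Sigma>) d"
    and eik: "\<And>x. x \<in> \<Sigma> \<Longrightarrow> d differentiable (at x) \<Longrightarrow> t0_tilde K\<^sub>0 x (grad d x) \<le> V\<^sub>0 x"
    using C \<Sigma>\<Omega> unfolding assumption_C_def by auto
  obtain L where lip: "L-lipschitz_on (closure \<Sigma>) d" using C by (auto simp: assumption_C_def)
  have L: "0 \<le> L" using lip by (rule lipschitz_on_nonneg)
  have sub: "x \<in> closure \<Sigma>" if "x \<in> \<Sigma>" for x using that closure_subset by auto
  have cS: "compact (closure \<Sigma>)" using \<Sigma> by simp
  have d_cont: "continuous_on (closure \<Sigma>) d" by (rule lipschitz_on_continuous_on[OF lip])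
  obtain T G where TG: "0 < T" "0 < G"
    "\<And>x. x \<in> \<Sigma> \<Longrightarrow> d differentiable (at x)"
    "\<And>x. x \<in> \<Sigma> \<Longrightarrow> norm (grad d x) \<le> G"
    "\<And>x y. x \<in> \<Sigma> \<Longrightarrow> y \<in> \<Sigma> \<Longrightarrow> \<bar>d y - d x - grad d x \<bullet> (y - x)\<bar> \<le> T * (norm (y - x))\<^sup>2"
    using C2_second_order_expansion[OF \<Sigma>(1,2) dC2 lip] by metis
  obtain P where P: "0 < P" "\<And>x. x \<in> \<Sigma> \<Longrightarrow> (norm (grad d x))\<^sup>2 \<le> P * d x"
    using grad_square_le[OF \<Sigma>(1,2,3) d_cont d0(1,3) TG(1,2,4,5)] by metis
  \<comment> \<open>The gradient bound evaluated at the zero of d; the expansion around this point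
    then makes d at most quadratic there.\<close>
  have "grad d (z j) = 0" using P(2)[OF \<Sigma>(3)] d0(2) by simp
  then have d_quad: "d x \<le> T * (norm (x - z j))\<^sup>2" if "x \<in> \<Sigma>" for x
    using TG(5)[OF \<Sigma>(3) that] d0(2) by simp
  have V0C2: "C2_on UNIV V\<^sub>0" and V0: "\<And>x. 0 \<le> V\<^sub>0 x" "{x. V\<^sub>0 x = 0} = z ` {1..r}"
    and V0pos: "\<And>v. v \<noteq> 0 \<Longrightarrow> 0 < second_deriv V\<^sub>0 (z j) v v"
    and VC2: "\<And>\<epsilon>. \<epsilon> \<in> {0<..\<epsilon>\<^sub>0} \<Longrightarrow> C2_on UNIV (V \<epsilon>)"
    and VR: "\<And>\<epsilon> x. \<epsilon> \<in> {0<..\<epsilon>\<^sub>0} \<Longrightarrow> V \<epsilon> x = V\<^sub>0 x + R\<^sub>1 x \<epsilon>"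
    and R1: "\<exists>C. \<forall>\<epsilon>\<in>{0<..\<epsilon>\<^sub>0}. \<forall>x\<in>closure \<Sigma>. \<bar>R\<^sub>1 x \<epsilon>\<bar> \<le> C * \<epsilon>"
    using Bp cS \<Sigma>(4) unfolding assumption_B_potential_def by auto
  have V0_cont: "continuous_on (closure \<Sigma>) V\<^sub>0"
    using C2_on_imp_continuous_on[OF V0C2] by (rule continuous_on_subset) simp
  have "V\<^sub>0 (z j) = 0" using V0(2) \<Sigma>(4) by blast
  then obtain m \<rho> where growth: "0 < m" "0 < \<rho>" "\<And>x. norm (x - z j) < \<rho> \<Longrightarrow> m * (norm (x - z j))\<^sup>2 \<le> V\<^sub>0 x"
    using nondegenerate_minimum_quadratic_growth[OF V0C2 V0(1) _ V0pos] by metis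
  have V0_pos: "0 < V\<^sub>0 x" if "x \<in> closure \<Sigma>" "x \<noteq> z j" for x
  proof -
    have "V\<^sub>0 x \<noteq> 0"
    proof
      assume "V\<^sub>0 x = 0"
      then obtain k where "k \<in> {1..r}" "x = z k" using V0(2) by blast
      then show False using zk[of k] that by auto
    qed
    then show ?thesis using V0(1)[of x] by simp
  qed
  obtain c where c: "0 < c" "\<And>x. x \<in> \<Sigma> \<Longrightarrow> c * d x \<le> V\<^sub>0 x"
    using potential_dominates[OF \<Sigma>(2,3) V0_cont V0_pos growth d_cont TG(1) d_quad] by metis
  obtain CR where CR: "0 \<le> CR" "\<And>\<epsilon> x. \<epsilon> \<in> {0<..\<epsilon>\<^sub>0} \<Longrightarrow> x \<in> \<Sigma> \<Longrightarrow> \<bar>R\<^sub>1 x \<epsilon>\<bar> \<le> CR * \<epsilon>"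
  proof -
    obtain C where C: "\<And>\<epsilon> x. \<epsilon> \<in> {0<..\<epsilon>\<^sub>0} \<Longrightarrow> x \<in> closure \<Sigma> \<Longrightarrow> \<bar>R\<^sub>1 x \<epsilon>\<bar> \<le> C * \<epsilon>" using R1 by blast
    have "\<bar>R\<^sub>1 x \<epsilon>\<bar> \<le> \<bar>C\<bar> * \<epsilon>" if "\<epsilon> \<in> {0<..\<epsilon>\<^sub>0}" "x \<in> \<Sigma>" for \<epsilon> x
      using C[OF that(1) sub[OF that(2)]] that(1) by (auto intro: order_trans mult_right_mono)
    then show ?thesis by (intro that[of "\<bar>C\<bar>"]) auto
  qed
  have Ks: "sets (K \<epsilon> x) = sets punctured" if "\<epsilon> \<in> {0<..\<epsilon>\<^sub>0}" for \<epsilon> x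
    using A that by (auto simp: assumption_A_def radon_measure_on_def)
  \<comment> \<open>q and \<open>T'\<close> are the constants of
    \<open>agmon_phase_expansion\<close>. They involve neither B nor \<epsilon>, so
    \<open>C\<^sub>1\<close> is available before B is chosen.\<close>
  define q where "q = sqrt P + T"
  define T' where "T' = T + q\<^sup>2 + q"
  have T': "0 \<le> T'" using TG(1) P(1) by (simp add: T'_def q_def)
  \<comment> \<open>One constant that bounds both the slope of the phase along jumps and the norm of
    the scaled gradient.\<close>
  define L' where "L' = L + G"
  have L': "0 \<le> L'" "L \<le> L'" "G \<le> L'" using L TG(2) by (auto simp: L'_def)
  obtain C\<^sub>1 where C1: "0 < C\<^sub>1"
    "\<And>\<epsilon> x a \<xi>. \<epsilon> \<in> {0<..\<epsilon>\<^sub>0} \<Longrightarrow> a \<in> borel_measurable borel \<Longrightarrow> norm \<xi> \<le> L' \<Longrightarrow>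
      (\<And>\<gamma>. \<bar>a \<gamma>\<bar> \<le> L' * norm \<gamma>) \<Longrightarrow> (\<And>\<gamma>. \<bar>a \<gamma> - \<gamma> \<bullet> \<xi>\<bar> \<le> T' * \<epsilon> * (norm \<gamma>)\<^sup>2) \<Longrightarrow>
      (\<integral>\<^sup>+\<gamma>. ennreal (cosh (a \<gamma>) - 1) \<partial>K \<epsilon> x) \<le> ennreal (t0_tilde K\<^sub>0 x \<xi> + C\<^sub>1 * \<epsilon>)"
    using jump_cosh_integral_le[OF Bk \<epsilon>\<^sub>0 Ks L'(1) T'] by metis
  obtain M where M: "0 < M" "\<And>\<epsilon> x. \<epsilon> \<in> {0<..\<epsilon>\<^sub>0} \<Longrightarrow> (\<integral>\<^sup>+\<gamma>. ennreal ((norm \<gamma>)\<^sup>2) \<partial>K \<epsilon> x) \<le> ennreal M"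
    using kernel_second_moment[OF Bk \<epsilon>\<^sub>0 Ks] by metis
  obtain D where D: "0 < D" "\<And>x. x \<in> closure \<Sigma> \<Longrightarrow> \<bar>d x\<bar> \<le> D"
    using continuous_on_compact_bound[OF cS d_cont] by metis
  obtain VM where VM: "0 < VM" "\<And>x. x \<in> closure \<Sigma> \<Longrightarrow> \<bar>V\<^sub>0 x\<bar> \<le> VM"
    using continuous_on_compact_bound[OF cS V0_cont] by metis
  \<comment> \<open>All losses of order \<epsilon>: the kernel (\<open>C\<^sub>1\<close>), the
    potential perturbation (CR), the energy (\<open>R\<^sub>0\<close>), and 1 for the surplus
    \<epsilon> that the form estimate demands.\<close>
  define \<kappa> where "\<kappa> = C\<^sub>1 + CR + R\<^sub>0 + 1"
  have \<kappa>: "0 < \<kappa>" using C1(1) CR(1) R\<^sub>0 by (simp add: \<kappa>_def)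
  \<comment> \<open>Makes the gain B c / 2 outweigh \<open>\<kappa>\<close>, while B \<ge> 1 is
    needed to compare the profile with the weight.\<close>
  define B where "B = 1 + 2 * \<kappa> / c"
  have B: "1 \<le> B" "\<kappa> \<le> B * c / 2" using \<kappa> c(1) by (auto simp: B_def field_simps)
  define \<beta> where "\<beta> = exp (B * ln B)"
  have \<beta>: "1 \<le> \<beta>" using B by (simp add: \<beta>_def)
  \<comment> \<open>\<open>\<beta>\<close> passes from \<open>exp \<Phi>\<close> to the weight; the
    bracket dominates the coefficients 1 and \<open>sqrt \<kappa> * exp B\<close> delivered by
    \<open>agmon_estimate\<close>.\<close>
  define C' where "C' = \<beta> * (1 + sqrt \<kappa> * exp B)"
  have C'_pos: "0 < C'" using \<beta> \<kappa> by (simp add: C'_def add_pos_nonneg)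
  have est: "L2_norm \<Sigma> (\<lambda>x. weight B \<epsilon> d x * u x)
      \<le> C' * (inverse \<epsilon> * L2_norm \<Sigma> (\<lambda>x. weight B \<epsilon> d x * (f x - E * u x)) + L2_norm \<Sigma> u)"
    if \<epsilon>: "\<epsilon> \<in> {0<..\<epsilon>\<^sub>0}" and E: "E \<in> {0..\<epsilon> * R\<^sub>0}"
      and uf: "(u, f) \<in> H_dirichlet \<epsilon> (K \<epsilon>) (V \<epsilon>) \<Sigma> \<union> H_neumann \<epsilon> (K \<epsilon>) (V \<epsilon>) \<Sigma>" for \<epsilon> E u f
  proof -
    have eps0: "0 < \<epsilon>" using \<epsilon> by simp
    have Vc: "continuous_on UNIV (V \<epsilon>)" by (rule C2_on_imp_continuous_on[OF VC2[OF \<epsilon>]])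
    have Vn: "0 \<le> V \<epsilon> x" for x
      using A \<epsilon> by (intro continuous_AE_nonneg[OF Vc]) (auto simp: assumption_A_def)
    interpret jump_form \<epsilon> "K \<epsilon>" M "V \<epsilon>" \<Sigma>
    proof
      show "(\<lambda>x. emeasure (K \<epsilon> x) E) \<in> borel_measurable borel" if "E \<in> sets punctured" for E
        using A \<epsilon> that by (auto simp: assumption_A_def)
      show "(\<integral>\<^sup>+x. (\<integral>\<^sup>+\<gamma>. ennreal (\<phi> (x + \<epsilon> *\<^sub>R \<gamma>) * \<psi> x) \<partial>K \<epsilon> x) \<partial>lborel) =
          (\<integral>\<^sup>+x. (\<integral>\<^sup>+\<gamma>. ennreal (\<phi> x * \<psi> (x + \<epsilon> *\<^sub>R \<gamma>)) \<partial>K \<epsilon> x) \<partial>lborel)"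
        if "\<phi> \<in> C0_nonneg" "\<psi> \<in> C0_nonneg" for \<phi> \<psi>
        using A \<epsilon> that by (auto simp: assumption_A_def)
    qed (fact eps0 M(1) Ks[OF \<epsilon>] M(2)[OF \<epsilon>] \<Sigma>(1,2) Vc Vn)+
    define \<Phi> where "\<Phi> x = agmon_profile B (d x / \<epsilon>)" for x
    define l where "l x = (d x / \<epsilon>) / (B + d x / \<epsilon>)" for x
    have \<sigma>: "0 \<le> d x / \<epsilon>" if "x \<in> \<Sigma>" for x using d0(1)[OF sub[OF that]] eps0 by simp
    have "0 \<le> s / (B + s)" "s / (B + s) \<le> 1" if "0 \<le> s" for s using that B by simp_all
    then have l: "0 \<le> l x" "l x \<le> 1" if "x \<in> \<Sigma>" for x
      unfolding l_def using \<sigma>[OF that] by blast+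
    have \<Phi>_diff: "\<bar>\<Phi> y - \<Phi> x\<bar> \<le> L / \<epsilon> * norm (y - x)" if "x \<in> \<Sigma>" "y \<in> \<Sigma>" for x y
    proof -
      have "\<bar>\<Phi> y - \<Phi> x\<bar> \<le> \<bar>d y / \<epsilon> - d x / \<epsilon>\<bar>"
        unfolding \<Phi>_def using B that by (intro agmon_profile_lipschitz \<sigma>) auto
      also have "\<dots> = \<bar>d y - d x\<bar> / \<epsilon>" using eps0 by (simp flip: diff_divide_distrib)
      also have "\<dots> \<le> L * norm (y - x) / \<epsilon>"
        using lipschitz_onD[OF lip sub[OF that(2)] sub[OF that(1)]] eps0
        by (intro divide_right_mono) (auto simp: dist_real_def dist_norm)
      finally show ?thesis by simp
    qed
    have \<Phi>_lip: "(L / \<epsilon>)-lipschitz_on \<Sigma> \<Phi>"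
      using \<Phi>_diff L eps0 by (intro lipschitz_onI) (auto simp: dist_real_def dist_norm)
    \<comment> \<open>This bound depends on \<epsilon>; it serves only to show that functions are
      bounded or square integrable and does not enter the final constant.\<close>
    define M\<Phi> where "M\<Phi> = \<bar>agmon_profile B 0\<bar> + D / \<epsilon>"
    have \<Phi>_bound: "\<bar>\<Phi> x\<bar> \<le> M\<Phi>" if "x \<in> \<Sigma>" for x
    proof -
      have "\<bar>\<Phi> x - agmon_profile B 0\<bar> \<le> d x / \<epsilon>"
        using agmon_profile_lipschitz[of B 0 "d x / \<epsilon>"] B \<sigma>[OF that] by (simp add: \<Phi>_def)
      moreover have "d x / \<epsilon> \<le> D / \<epsilon>"
        using D(2)[OF sub[OF that]] eps0 by (intro divide_right_mono) auto
      ultimately show ?thesis unfolding M\<Phi>_def by linarith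
    qed
    have "(2 * (L / \<epsilon>))-lipschitz_on \<Sigma> (\<lambda>x. 2 * \<Phi> x)"
      using lipschitz_on_cmult_real[OF \<Phi>_lip, of 2] by simp
    then have m1: "(exp (2 * M\<Phi>) * (2 * (L / \<epsilon>)))-lipschitz_on \<Sigma> (\<lambda>x. exp (2 * \<Phi> x))"
      by (rule lipschitz_on_exp) (use \<Phi>_bound in \<open>simp add: abs_le_iff\<close>)
    have m2: "\<bar>exp (2 * \<Phi> x)\<bar> \<le> exp (2 * M\<Phi>)" if "x \<in> \<Sigma>" for x
      using \<Phi>_bound[OF that] by (simp add: abs_le_iff)
    note m = m1 m2
    have u: "u \<in> N" "f \<in> L2 \<Sigma>" "Q u (\<lambda>x. exp (2 * \<Phi> x) * u x) = L2_inner \<Sigma> f (\<lambda>x. exp (2 * \<Phi> x) * u x)"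
      using uf neumann_operator_mult[OF _ m] dirichlet_operator_mult[OF _ m] by blast+
    \<comment> \<open>The first term is what convexity and the eikonal inequality leave of the
      Hamiltonian at the scaled gradient.\<close>
    define g where "g x = l x * V\<^sub>0 x + C\<^sub>1 * \<epsilon>" for x
    have g_cont: "continuous_on \<Sigma> g"
      unfolding g_def l_def
      by (intro continuous_intros continuous_on_subset[OF d_cont closure_subset]
          continuous_on_subset[OF V0_cont closure_subset])
        (use \<sigma> B eps0 in \<open>auto dest!: \<sigma>\<close>)
    have g_nonneg: "0 \<le> g x" if "x \<in> \<Sigma>" for x
      using l[OF that] V0(1) C1(1) eps0 by (simp add: g_def)
    have g_bound: "g x \<le> VM + C\<^sub>1 * \<epsilon>" if "x \<in> \<Sigma>" for x
      using mult_left_le_one_le[OF V0(1)[of x] l[OF that]] VM(2)[OF sub[OF that]] by (simp add: g_def)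
    have jump: "(\<integral>\<^sup>+\<gamma>. indicator \<Sigma> (x + \<epsilon> *\<^sub>R \<gamma>) *
        ennreal (cosh (\<Phi> x - \<Phi> (x + \<epsilon> *\<^sub>R \<gamma>)) - 1) \<partial>K \<epsilon> x) \<le> ennreal (g x)" if x: "x \<in> \<Sigma>" for x
    proof -
      define \<xi> where "\<xi> = l x *\<^sub>R grad d x"
      have \<xi>: "norm \<xi> \<le> L'"
      proof -
        have "norm \<xi> \<le> norm (grad d x)"
          using l[OF x] by (simp add: \<xi>_def mult_left_le_one_le)
        then show ?thesis using TG(4)[OF x] L' by linarith
      qed
      \<comment> \<open>Jumps leaving the domain are assigned the linear phase, so that the growth
        and expansion bounds hold for every \<gamma>; the indicator in the form makes the choice
        harmless.\<close>
      define a where "a \<gamma> = (if x + \<epsilon> *\<^sub>R \<gamma> \<in> \<Sigma> then \<Phi> (x + \<epsilon> *\<^sub>R \<gamma>) - \<Phi> x else \<gamma> \<bullet> \<xi>)" for \<gamma>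
      have a_eq: "a = (\<lambda>\<gamma>. if x + \<epsilon> *\<^sub>R \<gamma> \<in> \<Sigma> then zero_ext \<Sigma> \<Phi> (x + \<epsilon> *\<^sub>R \<gamma>) - \<Phi> x else \<gamma> \<bullet> \<xi>)"
        by (auto simp: a_def zero_ext_def)
      have a_meas: "a \<in> borel_measurable borel"
      proof -
        have [measurable]: "zero_ext \<Sigma> \<Phi> \<in> borel_measurable borel"
          by (rule borel_measurable_zero_ext_continuous[OF \<Sigma>(1) lipschitz_on_continuous_on[OF \<Phi>_lip]])
        have [measurable]: "\<Sigma> \<in> sets borel" using \<Sigma>(1) by simp
        show ?thesis unfolding a_eq by measurable
      qed
      have aL: "\<bar>a \<gamma>\<bar> \<le> L' * norm \<gamma>" for \<gamma>
      proof (cases "x + \<epsilon> *\<^sub>R \<gamma> \<in> \<Sigma>")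
        case True
        have "\<bar>a \<gamma>\<bar> \<le> L * norm \<gamma>" using \<Phi>_diff[OF x True] True eps0 by (simp add: a_def)
        also have "\<dots> \<le> L' * norm \<gamma>" using L' by (intro mult_right_mono) auto
        finally show ?thesis .
      next
        case False
        have "\<bar>a \<gamma>\<bar> \<le> norm \<gamma> * norm \<xi>" using False Cauchy_Schwarz_ineq2[of \<gamma> \<xi>] by (simp add: a_def)
        also have "\<dots> \<le> norm \<gamma> * L'" by (intro mult_left_mono \<xi>) simp
        finally show ?thesis by (simp add: mult.commute)
      qed
      have aT: "\<bar>a \<gamma> - \<gamma> \<bullet> \<xi>\<bar> \<le> T' * \<epsilon> * (norm \<gamma>)\<^sup>2" for \<gamma>
      proof (cases "x + \<epsilon> *\<^sub>R \<gamma> \<in> \<Sigma>")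
        case True
        have "0 < B" using B by simp
        note agmon_phase_expansion[OF this eps0 d0(1)[OF sub[OF x]] d0(1)[OF sub[OF True]] TG(1) P(1)
            P(2)[OF x] TG(5)[OF x True], folded \<Phi>_def l_def q_def \<xi>_def T'_def]
        moreover have "\<xi> \<bullet> (x + \<epsilon> *\<^sub>R \<gamma> - x) / \<epsilon> = \<xi> \<bullet> \<gamma>" "norm (x + \<epsilon> *\<^sub>R \<gamma> - x) = \<epsilon> * norm \<gamma>"
          using eps0 by simp_all
        ultimately have "\<bar>\<Phi> (x + \<epsilon> *\<^sub>R \<gamma>) - \<Phi> x - \<xi> \<bullet> \<gamma>\<bar> \<le> T' * (\<epsilon> * norm \<gamma>)\<^sup>2 / \<epsilon>"
          by (simp only: T'_def)
        then show ?thesis using True eps0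
          by (simp add: a_def inner_commute power2_eq_square mult_ac)
      next
        case False
        then show ?thesis using T' eps0 by (simp add: a_def)
      qed
      have "(\<integral>\<^sup>+\<gamma>. indicator \<Sigma> (x + \<epsilon> *\<^sub>R \<gamma>) * ennreal (cosh (\<Phi> x - \<Phi> (x + \<epsilon> *\<^sub>R \<gamma>)) - 1) \<partial>K \<epsilon> x) \<le>
          (\<integral>\<^sup>+\<gamma>. ennreal (cosh (a \<gamma>) - 1) \<partial>K \<epsilon> x)"
      proof (rule nn_integral_mono)
        fix \<gamma>
        have "cosh (\<Phi> x - \<Phi> (x + \<epsilon> *\<^sub>R \<gamma>)) = cosh (\<Phi> (x + \<epsilon> *\<^sub>R \<gamma>) - \<Phi> x)"
          using cosh_minus[of "\<Phi> x - \<Phi> (x + \<epsilon> *\<^sub>R \<gamma>)"] unfolding minus_diff_eq by (rule sym)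
        then show "indicator \<Sigma> (x + \<epsilon> *\<^sub>R \<gamma>) * ennreal (cosh (\<Phi> x - \<Phi> (x + \<epsilon> *\<^sub>R \<gamma>)) - 1) \<le> ennreal (cosh (a \<gamma>) - 1)"
          by (simp only: a_def) (simp add: indicator_def)
      qed
      also have "\<dots> \<le> ennreal (t0_tilde K\<^sub>0 x \<xi> + C\<^sub>1 * \<epsilon>)"
        by (rule C1(2)[OF \<epsilon> a_meas \<xi> aL aT])
      also have "\<dots> \<le> ennreal (g x)"
      proof (rule ennreal_leI)
        have "t0_tilde K\<^sub>0 x \<xi> \<le> l x * t0_tilde K\<^sub>0 x (grad d x)"
          unfolding \<xi>_def by (rule t0_tilde_scale[OF Bk \<epsilon>\<^sub>0 l[OF x]])
        also have "\<dots> \<le> l x * V\<^sub>0 x" by (intro mult_left_mono eik x TG(3) l)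
        finally show "t0_tilde K\<^sub>0 x \<xi> + C\<^sub>1 * \<epsilon> \<le> g x" by (simp add: g_def)
      qed
      finally show ?thesis .
    qed
    have gap: "\<epsilon> \<le> V \<epsilon> x - g x - E \<or> (\<epsilon> - \<kappa> * \<epsilon> \<le> V \<epsilon> x - g x - E \<and> exp (\<Phi> x) \<le> exp B)" if x: "x \<in> \<Sigma>" for x
    proof -
      have "- (CR * \<epsilon>) \<le> R\<^sub>1 x \<epsilon>" using CR(2)[OF \<epsilon> x] by (simp add: abs_le_iff)
      moreover have "E \<le> R\<^sub>0 * \<epsilon>" using E by (simp add: mult.commute)
      ultimately have low: "(1 - l x) * V\<^sub>0 x + \<epsilon> - \<kappa> * \<epsilon> \<le> V \<epsilon> x - g x - E"
        unfolding VR[OF \<epsilon>] g_def \<kappa>_def by (simp add: algebra_simps)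
      show ?thesis
      proof (cases "B \<le> d x / \<epsilon>")
        case True
        have dx: "0 < d x" using True B eps0 by (simp add: field_simps) (smt (verit) mult_pos_pos)
        have "1 - s / (B + s) = B / (B + s)" if "0 \<le> s" for s using that B by (simp add: field_simps)
        from this[OF \<sigma>[OF x]] have "1 - l x = B / (B + d x / \<epsilon>)" unfolding l_def .
        \<comment> \<open>Here B + d/\<epsilon> is at most 2 d/\<epsilon>. Multiplied by c d, the
          lower bound of the potential, this gives B c \<epsilon> / 2, which covers
          \<open>\<kappa> * \<epsilon>\<close>.\<close>
        also have "\<dots> \<ge> B / (2 * (d x / \<epsilon>))"
          using True B \<sigma>[OF x] by (intro divide_left_mono mult_pos_pos) auto
        finally have "B / (2 * (d x / \<epsilon>)) \<le> 1 - l x" .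
        then have "B / (2 * (d x / \<epsilon>)) * (c * d x) \<le> (1 - l x) * V\<^sub>0 x"
          using c dx B eps0 l[OF x] x by (intro mult_mono) auto
        moreover have "B / (2 * (d x / \<epsilon>)) * (c * d x) = B * c / 2 * \<epsilon>" using dx eps0 by simp
        moreover have "\<kappa> * \<epsilon> \<le> B * c / 2 * \<epsilon>" using B eps0 by (intro mult_right_mono) auto
        ultimately show ?thesis using low by linarith
      next
        case False
        have "0 \<le> (1 - l x) * V\<^sub>0 x" using l[OF x] V0(1) by simp
        \<comment> \<open>Since B \<ge> 1 the logarithm in the profile is nonnegative, hence the
          phase is at most d/\<epsilon> < B.\<close>
        moreover have "\<Phi> x \<le> B"
        proof -
          have "0 \<le> B * ln (B + d x / \<epsilon>)" using B \<sigma>[OF x] by simp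
          then show ?thesis using False by (simp add: \<Phi>_def agmon_profile_def)
        qed
        ultimately show ?thesis using low by simp
      qed
    qed
    have main: "L2_norm \<Sigma> (\<lambda>x. exp (\<Phi> x) * u x) \<le>
      inverse \<epsilon> * L2_norm \<Sigma> (\<lambda>x. exp (\<Phi> x) * (f x - E * u x)) + sqrt \<kappa> * exp B * L2_norm \<Sigma> u"
      by (rule agmon_estimate[OF u \<Phi>_lip \<Phi>_bound g_cont g_nonneg g_bound jump gap]) (use \<kappa> in auto)
    have w: "exp (\<Phi> x) \<le> weight B \<epsilon> d x" "weight B \<epsilon> d x \<le> \<beta> * exp (\<Phi> x)" "0 \<le> weight B \<epsilon> d x" if "x \<in> \<Sigma>" for x
      using exp_agmon_profile_weight[where d=d and \<epsilon>=\<epsilon> and x=x, OF B(1) \<sigma>[OF that]] by (auto simp: \<Phi>_def \<beta>_def weight_def)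
    have zu: "square_integrable lborel (zero_ext \<Sigma> (\<lambda>x. exp (\<Phi> x) * u x))"
      by (rule agmon_form_lower_bound(1)[OF u(1) \<Phi>_lip \<Phi>_bound g_cont g_nonneg g_bound jump])
    \<comment> \<open>Comparing norms through \<open>L2_norm_le\<close> requires the larger side to
      be square integrable, as a divergent integral would count as 0.\<close>
    have zw: "square_integrable lborel (zero_ext \<Sigma> (\<lambda>x. weight B \<epsilon> d x * (f x - E * u x)))"
    proof (rule square_integrable_dominated)
      have uf2: "square_integrable lborel (zero_ext \<Sigma> f)" "square_integrable lborel (zero_ext \<Sigma> u)"
        using u(1,2) by (auto simp: N_iff L2_iff)
      show "square_integrable lborel (\<lambda>x. \<beta> * exp M\<Phi> * (zero_ext \<Sigma> f x - E * zero_ext \<Sigma> u x))"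
        by (intro square_integrable_cmult square_integrable_diff uf2)
      have "continuous_on \<Sigma> (weight B \<epsilon> d)"
        unfolding weight_def[abs_def] using continuous_on_subset[OF d_cont closure_subset]
        by (intro continuous_intros) (use \<sigma> eps0 in \<open>auto dest!: \<sigma>\<close>)
      then have "zero_ext \<Sigma> (weight B \<epsilon> d) \<in> borel_measurable borel"
        by (rule borel_measurable_zero_ext_continuous[OF \<Sigma>(1)])
      then have "(\<lambda>x. zero_ext \<Sigma> (weight B \<epsilon> d) x * (zero_ext \<Sigma> f x - E * zero_ext \<Sigma> u x)) \<in> borel_measurable borel"
        using uf2[THEN square_integrable_lborelD] by measurable
      moreover have "zero_ext \<Sigma> (\<lambda>x. weight B \<epsilon> d x * (f x - E * u x)) =
          (\<lambda>x. zero_ext \<Sigma> (weight B \<epsilon> d) x * (zero_ext \<Sigma> f x - E * zero_ext \<Sigma> u x))"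
        by (auto simp: zero_ext_def indicator_def)
      ultimately show "zero_ext \<Sigma> (\<lambda>x. weight B \<epsilon> d x * (f x - E * u x)) \<in> borel_measurable lborel" by simp
      fix x
      show "\<bar>zero_ext \<Sigma> (\<lambda>x. weight B \<epsilon> d x * (f x - E * u x)) x\<bar> \<le>
          \<bar>\<beta> * exp M\<Phi> * (zero_ext \<Sigma> f x - E * zero_ext \<Sigma> u x)\<bar>"
      proof (cases "x \<in> \<Sigma>")
        case True
        have "weight B \<epsilon> d x \<le> \<beta> * exp (\<Phi> x)" by (rule w[OF True])
        also have "\<dots> \<le> \<beta> * exp M\<Phi>" using \<Phi>_bound[OF True] \<beta> by (intro mult_left_mono) auto
        finally show ?thesis using True w(3)[OF True] \<beta>
          by (simp add: zero_ext_def abs_mult mult_right_mono)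
      qed (simp add: zero_ext_def)
    qed
    have "L2_norm \<Sigma> (\<lambda>x. weight B \<epsilon> d x * u x) \<le> \<beta> * L2_norm \<Sigma> (\<lambda>x. exp (\<Phi> x) * u x)"
      using w \<beta> by (intro L2_norm_le zu) (auto simp: abs_mult mult.assoc[symmetric] intro!: mult_right_mono)
    also have "\<dots> \<le> \<beta> * (inverse \<epsilon> * L2_norm \<Sigma> (\<lambda>x. exp (\<Phi> x) * (f x - E * u x)) + sqrt \<kappa> * exp B * L2_norm \<Sigma> u)"
      using main \<beta> by (intro mult_left_mono) auto
    also have "\<dots> \<le> \<beta> * (inverse \<epsilon> * L2_norm \<Sigma> (\<lambda>x. weight B \<epsilon> d x * (f x - E * u x)) + sqrt \<kappa> * exp B * L2_norm \<Sigma> u)"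
    proof -
      have "L2_norm \<Sigma> (\<lambda>x. exp (\<Phi> x) * (f x - E * u x)) \<le> 1 * L2_norm \<Sigma> (\<lambda>x. weight B \<epsilon> d x * (f x - E * u x))"
        using w by (intro L2_norm_le zw) (auto simp: abs_mult intro!: mult_right_mono)
      then show ?thesis using \<beta> eps0 by (intro mult_left_mono add_right_mono) auto
    qed
    also have "\<dots> \<le> C' * (inverse \<epsilon> * L2_norm \<Sigma> (\<lambda>x. weight B \<epsilon> d x * (f x - E * u x)) + L2_norm \<Sigma> u)"
    proof -
      have nn: "0 \<le> L2_norm \<Sigma> h" for h
        by (simp add: L2_norm_zero_ext Bochner_Integration.integral_nonneg)
      define X where "X = inverse \<epsilon> * L2_norm \<Sigma> (\<lambda>x. weight B \<epsilon> d x * (f x - E * u x))"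
      have X: "0 \<le> X" using nn eps0 by (simp add: X_def)
      have k: "0 \<le> sqrt \<kappa> * exp B" using \<kappa> by simp
      have "X + sqrt \<kappa> * exp B * L2_norm \<Sigma> u \<le> (1 + sqrt \<kappa> * exp B) * (X + L2_norm \<Sigma> u)"
        using mult_nonneg_nonneg[OF k X] nn[of u] by (simp add: algebra_simps)
      then show ?thesis unfolding X_def[symmetric] C'_def mult.assoc[of \<beta>]
        using \<beta> by (intro mult_left_mono) auto
    qed
    finally show ?thesis .
  qed
  show ?thesis
  proof (intro exI conjI ballI)
    show "0 < B" "0 < C'" using B C'_pos by auto
  qed (use est in blast)
qed

theorem theorem1p5:
  fixes \<epsilon>\<^sub>0 R\<^sub>0 :: real
    and K :: "real \<Rightarrow> 'a::euclidean_space \<Rightarrow> 'a measure"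
    and K\<^sub>0 :: "'a \<Rightarrow> 'a measure"
    and R\<^sub>p R\<^sub>m :: "real \<Rightarrow> 'a \<Rightarrow> 'a measure"
    and V :: "real \<Rightarrow> 'a \<Rightarrow> real" and V\<^sub>0 :: "'a \<Rightarrow> real" and R\<^sub>1 :: "'a \<Rightarrow> real \<Rightarrow> real"
    and r j :: nat and z :: "nat \<Rightarrow> 'a"
    and \<Sigma> \<Omega> U :: "'a set" and d :: "'a \<Rightarrow> real"
  assumes "\<epsilon>\<^sub>0 > 0"
    and "assumption_A \<epsilon>\<^sub>0 K V"
    and "assumption_B_kernel \<epsilon>\<^sub>0 K K\<^sub>0 R\<^sub>p R\<^sub>m"
    and "assumption_B_potential \<epsilon>\<^sub>0 V V\<^sub>0 R\<^sub>1 r z"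
    and "assumption_C K\<^sub>0 V\<^sub>0 r z j \<Sigma> \<Omega> U d"
    and "\<Sigma> = \<Omega>"
    and "R\<^sub>0 > 0"
  shows "(\<exists>\<epsilon>\<^sub>1 B C. 0 < \<epsilon>\<^sub>1 \<and> \<epsilon>\<^sub>1 \<le> \<epsilon>\<^sub>0 \<and> 0 < B \<and> 0 < C \<and>
           (\<forall>\<epsilon>\<in>{0<..\<epsilon>\<^sub>1}. \<forall>E\<in>{0..\<epsilon> * R\<^sub>0}.
              (\<forall>(u, Hu)\<in>H_dirichlet \<epsilon> (K \<epsilon>) (V \<epsilon>) \<Sigma>.
                 L2_norm \<Sigma> (\<lambda>x. weight B \<epsilon> d x * u x)
                 \<le> C * (inverse \<epsilon> * L2_norm \<Sigma> (\<lambda>x. weight B \<epsilon> d x * (Hu x - E * u x)) + L2_norm \<Sigma> u)) \<and>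
              (\<forall>u. eigenfunction \<Sigma> (H_dirichlet \<epsilon> (K \<epsilon>) (V \<epsilon>) \<Sigma>) E u \<longrightarrow>
                 L2_norm \<Sigma> (\<lambda>x. weight B \<epsilon> d x * u x) \<le> C * L2_norm \<Sigma> u)))
       \<and> (\<exists>\<epsilon>\<^sub>1 B C. 0 < \<epsilon>\<^sub>1 \<and> \<epsilon>\<^sub>1 \<le> \<epsilon>\<^sub>0 \<and> 0 < B \<and> 0 < C \<and>
           (\<forall>\<epsilon>\<in>{0<..\<epsilon>\<^sub>1}. \<forall>E\<in>{0..\<epsilon> * R\<^sub>0}.
              (\<forall>(u, Hu)\<in>H_neumann \<epsilon> (K \<epsilon>) (V \<epsilon>) \<Sigma>.
                 L2_norm \<Sigma> (\<lambda>x. weight B \<epsilon> d x * u x)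
                 \<le> C * (inverse \<epsilon> * L2_norm \<Sigma> (\<lambda>x. weight B \<epsilon> d x * (Hu x - E * u x)) + L2_norm \<Sigma> u)) \<and>
              (\<forall>u. eigenfunction \<Sigma> (H_neumann \<epsilon> (K \<epsilon>) (V \<epsilon>) \<Sigma>) E u \<longrightarrow>
                 L2_norm \<Sigma> (\<lambda>x. weight B \<epsilon> d x * u x) \<le> C * L2_norm \<Sigma> u)))"
proof -
  obtain B C where BC: "0 < B" "0 < C"
    and est: "\<And>\<epsilon> E u f. \<epsilon> \<in> {0<..\<epsilon>\<^sub>0} \<Longrightarrow> E \<in> {0..\<epsilon> * R\<^sub>0} \<Longrightarrow>
      (u, f) \<in> H_dirichlet \<epsilon> (K \<epsilon>) (V \<epsilon>) \<Sigma> \<union> H_neumann \<epsilon> (K \<epsilon>) (V \<epsilon>) \<Sigma> \<Longrightarrow>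
      L2_norm \<Sigma> (\<lambda>x. weight B \<epsilon> d x * u x)
      \<le> C * (inverse \<epsilon> * L2_norm \<Sigma> (\<lambda>x. weight B \<epsilon> d x * (f x - E * u x)) + L2_norm \<Sigma> u)"
    using agmon_uniform_estimate[OF assms] by blast
  have eigen: "L2_norm \<Sigma> (\<lambda>x. weight B \<epsilon> d x * u x) \<le> C * L2_norm \<Sigma> u"
    if "\<epsilon> \<in> {0<..\<epsilon>\<^sub>0}" "E \<in> {0..\<epsilon> * R\<^sub>0}" "eigenfunction \<Sigma> H E u"
      "H = H_dirichlet \<epsilon> (K \<epsilon>) (V \<epsilon>) \<Sigma> \<or> H = H_neumann \<epsilon> (K \<epsilon>) (V \<epsilon>) \<Sigma>" for \<epsilon> E u H
  proof -
    have "(u, \<lambda>x. E * u x) \<in> H_dirichlet \<epsilon> (K \<epsilon>) (V \<epsilon>) \<Sigma> \<union> H_neumann \<epsilon> (K \<epsilon>) (V \<epsilon>) \<Sigma>"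
      using that(3,4) by (auto simp: eigenfunction_def)
    \<comment> \<open>The representative of H u is E u itself, so the residual vanishes pointwise
      and its norm is 0.\<close>
    from est[OF that(1,2) this] show ?thesis
      by (simp add: L2_norm_def L2_inner_def)
  qed
  \<comment> \<open>Both boundary conditions share one pair of constants, and the estimate holds on
    the full parameter range, so \<open>\<epsilon>\<^sub>0\<close> itself is the witness for
    \<open>\<epsilon>\<^sub>1\<close>.\<close>
  have half: "\<exists>\<epsilon>\<^sub>1 B C. 0 < \<epsilon>\<^sub>1 \<and> \<epsilon>\<^sub>1 \<le> \<epsilon>\<^sub>0 \<and> 0 < B \<and> 0 < C \<and>
     (\<forall>\<epsilon>\<in>{0<..\<epsilon>\<^sub>1}. \<forall>E\<in>{0..\<epsilon> * R\<^sub>0}.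
        (\<forall>(u, Hu)\<in>H \<epsilon>. L2_norm \<Sigma> (\<lambda>x. weight B \<epsilon> d x * u x)
           \<le> C * (inverse \<epsilon> * L2_norm \<Sigma> (\<lambda>x. weight B \<epsilon> d x * (Hu x - E * u x)) + L2_norm \<Sigma> u)) \<and>
        (\<forall>u. eigenfunction \<Sigma> (H \<epsilon>) E u \<longrightarrow> L2_norm \<Sigma> (\<lambda>x. weight B \<epsilon> d x * u x) \<le> C * L2_norm \<Sigma> u))"
    if H: "\<And>\<epsilon>. H \<epsilon> = H_dirichlet \<epsilon> (K \<epsilon>) (V \<epsilon>) \<Sigma> \<or> H \<epsilon> = H_neumann \<epsilon> (K \<epsilon>) (V \<epsilon>) \<Sigma>" for H
  proof (rule exI[of _ \<epsilon>\<^sub>0], rule exI[of _ B], rule exI[of _ C], intro conjI)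
    show "\<forall>\<epsilon>\<in>{0<..\<epsilon>\<^sub>0}. \<forall>E\<in>{0..\<epsilon> * R\<^sub>0}.
        (\<forall>(u, Hu)\<in>H \<epsilon>. L2_norm \<Sigma> (\<lambda>x. weight B \<epsilon> d x * u x)
           \<le> C * (inverse \<epsilon> * L2_norm \<Sigma> (\<lambda>x. weight B \<epsilon> d x * (Hu x - E * u x)) + L2_norm \<Sigma> u)) \<and>
        (\<forall>u. eigenfunction \<Sigma> (H \<epsilon>) E u \<longrightarrow> L2_norm \<Sigma> (\<lambda>x. weight B \<epsilon> d x * u x) \<le> C * L2_norm \<Sigma> u)"
    proof (intro ballI conjI allI impI)
      fix \<epsilon> E p assume *: "\<epsilon> \<in> {0<..\<epsilon>\<^sub>0}" "E \<in> {0..\<epsilon> * R\<^sub>0}" and p: "p \<in> H \<epsilon>"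
      obtain u f where "p = (u, f)" by fastforce
      then show "case p of (u, Hu) \<Rightarrow> L2_norm \<Sigma> (\<lambda>x. weight B \<epsilon> d x * u x)
           \<le> C * (inverse \<epsilon> * L2_norm \<Sigma> (\<lambda>x. weight B \<epsilon> d x * (Hu x - E * u x)) + L2_norm \<Sigma> u)"
        using est[OF *, of u f] H[of \<epsilon>] p by auto
    next
      fix \<epsilon> E u assume "\<epsilon> \<in> {0<..\<epsilon>\<^sub>0}" "E \<in> {0..\<epsilon> * R\<^sub>0}" "eigenfunction \<Sigma> (H \<epsilon>) E u"
      then show "L2_norm \<Sigma> (\<lambda>x. weight B \<epsilon> d x * u x) \<le> C * L2_norm \<Sigma> u"
        by (rule eigen[OF _ _ _ H])
    qed
  qed (use assms(1) BC in auto)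
  show ?thesis by (intro conjI half) auto
qed

end
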